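(* Let $G$ be a locally compact group such that its reduced group $C^*$-algebra $C^*_r(G)$ is a nuclear $C^*$-algebra. If $G$ is non-amenable, then $C^*_r(G)$ has strong Property $(T)$.
   Context: Let $A$ be a (not necessarily unital) $C^*$-algebra with multiplier algebra $M(A)$. The strict topology on $M(A)$ is the weakest topology for which the maps $x\mapsto xa$ and $x\mapsto ax$ from $M(A)$ to $A$ (with the norm topology) are continuous for every $a\in A$. A non-degenerate Hilbert $^*$-bimodule over $A$ is a Hilbert space $\mathfrak{H}$ with a non-degenerate $^*$-representation $\xi\mapsto a\cdot\xi$ and a non-degenerate $^*$-anti-representation $\xi\mapsto\xi\cdot a$ of $A$ on $\mathfrak{H}$ which commute with each other; both extend uniquely to $M(A)$. A net $(\xi_i)_{i\in\mathfrak{I}}$ in $\mathfrak{H}$ is almost-$\mathfrak{K}_A$-central if $\sup_{x\in L}\|x\cdot\xi_i-\xi_i\cdot x\|\to_i 0$ for every strictly compact subset $L$ of $M(A)$. Put $\mathfrak{H}^A:=\{\xi\in\mathfrak{H}: a\cdot\xi=\xi\cdot a \text{ for every } a\in A\}$ and let $P^A$ be the orthogonal projection onto $\mathfrak{H}^A$. $A$ has strong Property $(T)$ if for every non-degenerate Hilbert $^*$-bimodule $\mathfrak{H}$ over $A$ and every almost-$\mathfrak{K}_A$-central net $(\xi_i)_{i\in\mathfrak{I}}$ of unit vectors in $\mathfrak{H}$, one has $\|\xi_i-P^A\xi_i\|\to_i 0$. *)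

theory Defs
  imports "HOL-Analysis.Analysis"
begin

section \<open>Complex vector spaces, Hilbert spaces and \<open>C\<^sup>*\<close>-algebras\<close>

class scaleC =
  fixes scaleC :: "complex \<Rightarrow> 'a \<Rightarrow> 'a" (infixr "*\<^sub>C" 75)

class complex_vector = scaleC + real_vector +
  assumes scaleC_add_right: "c *\<^sub>C (x + y) = c *\<^sub>C x + c *\<^sub>C y"
    and scaleC_add_left: "(c + d) *\<^sub>C x = c *\<^sub>C x + d *\<^sub>C x"
    and scaleC_scaleC: "c *\<^sub>C d *\<^sub>C x = (c * d) *\<^sub>C x"
    and scaleR_scaleC: "scaleR r x = complex_of_real r *\<^sub>C x"

text \<open>The complex inner product is linear in its first argument; its real part is the
  inner product that the library uses for norm and topology.\<close>

class complex_inner = complex_vector + real_inner +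
  fixes cinner :: "'a \<Rightarrow> 'a \<Rightarrow> complex"
  assumes cinner_add_left: "cinner (x + y) z = cinner x z + cinner y z"
    and cinner_scaleC_left: "cinner (c *\<^sub>C x) y = c * cinner x y"
    and cinner_commute: "cinner x y = cnj (cinner y x)"
    and inner_eq_Re_cinner: "inner x y = Re (cinner x y)"

class chilbert_space = complex_inner + complete_space

subclass (in chilbert_space) banach ..

text \<open>\<open>C\<^sup>*\<close>-algebras are not assumed to be unital.\<close>

class cstar_algebra = complex_vector + real_normed_algebra + complete_space +
  fixes star :: "'a \<Rightarrow> 'a"
  assumes mult_scaleC_left: "(c *\<^sub>C x) * y = c *\<^sub>C (x * y)"
    and mult_scaleC_right: "x * (c *\<^sub>C y) = c *\<^sub>C (x * y)"
    and norm_scaleC: "norm (c *\<^sub>C x) = cmod c * norm x"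
    and star_star: "star (star x) = x"
    and star_add: "star (x + y) = star x + star y"
    and star_scaleC: "star (c *\<^sub>C x) = cnj c *\<^sub>C star x"
    and star_mult: "star (x * y) = star y * star x"
    and norm_star_mult_self: "norm (star x * x) = (norm x)\<^sup>2"

subclass (in cstar_algebra) banach ..

definition complex_linear_on ::
    "'a::complex_vector set \<Rightarrow> ('a \<Rightarrow> 'b::complex_vector) \<Rightarrow> bool" where
  "complex_linear_on A f \<longleftrightarrow>
     (\<forall>x\<in>A. \<forall>y\<in>A. f (x + y) = f x + f y) \<and> (\<forall>c. \<forall>x\<in>A. f (c *\<^sub>C x) = c *\<^sub>C f x)"


subsection \<open>Elementary facts on complex inner product spaces\<close>

lemma scaleC_one: "1 *\<^sub>C (x :: 'a::complex_vector) = x"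
  using scaleR_scaleC[of 1 x] by simp

lemma scaleC_minus1: "(- 1) *\<^sub>C (x :: 'a::complex_vector) = - x"
  using scaleR_scaleC[of "-1" x] by simp

lemma scaleC_zero_right: "c *\<^sub>C (0 :: 'a::complex_vector) = 0"
  using scaleC_add_right[of c 0 "0::'a"] by simp

lemma cinner_add_right: "cinner x (y + z) = cinner x y + cinner x (z::'a::complex_inner)"
  by (metis cinner_add_left cinner_commute complex_cnj_add)

lemma cinner_scaleC_right: "cinner x (c *\<^sub>C y) = cnj c * cinner x (y::'a::complex_inner)"
  by (metis cinner_scaleC_left cinner_commute complex_cnj_mult)

lemma cinner_scaleR_left: "cinner (scaleR r x) y = of_real r * cinner x (y::'a::complex_inner)"
  by (simp add: scaleR_scaleC cinner_scaleC_left)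

lemma cinner_scaleR_right: "cinner x (scaleR r y) = of_real r * cinner x (y::'a::complex_inner)"
  by (simp add: scaleR_scaleC cinner_scaleC_right)

lemma cinner_self: "cinner x x = complex_of_real ((norm (x::'a::complex_inner))\<^sup>2)"
proof -
  have "Im (cinner x x) = 0"
    using arg_cong[OF cinner_commute[of x x], of Im] by simp
  thus ?thesis
    by (simp add: complex_eq_iff inner_eq_Re_cinner[symmetric] power2_norm_eq_inner)
qed

lemma norm_scaleC_inner: "norm (c *\<^sub>C x) = cmod c * norm (x::'a::complex_inner)"
proof -
  have "complex_of_real ((norm (c *\<^sub>C x))\<^sup>2) = (c * cnj c) * of_real ((norm x)\<^sup>2)"
    by (simp only: cinner_self[symmetric] cinner_scaleC_left cinner_scaleC_right ac_simps)
  also have "\<dots> = complex_of_real ((cmod c * norm x)\<^sup>2)"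
    by (simp add: complex_norm_square[symmetric] power_mult_distrib)
  finally have "(norm (c *\<^sub>C x))\<^sup>2 = (cmod c * norm x)\<^sup>2"
    by (simp only: of_real_eq_iff)
  thus ?thesis by (simp add: power2_eq_iff_nonneg)
qed

lemma cinner_Cauchy_Schwarz: "cmod (cinner x y) \<le> norm x * norm (y::'a::complex_inner)"
proof (cases "cinner x y = 0")
  case False
  define c where "c = cnj (cinner x y) / cmod (cinner x y)"
  have c: "cmod c = 1" using False by (simp add: c_def norm_divide)
  have "c * cinner x y = cmod (cinner x y)"
    using False by (simp add: c_def mult.commute[of "cnj _"] complex_norm_square[symmetric] power2_eq_square)
  hence "cmod (cinner x y) = inner (c *\<^sub>C x) y"
    by (simp add: inner_eq_Re_cinner cinner_scaleC_left)
  also have "\<dots> \<le> norm (c *\<^sub>C x) * norm y" by (rule norm_cauchy_schwarz)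
  finally show ?thesis by (simp add: norm_scaleC_inner c)
qed simp

lemma cinner_ext: "(\<And>z. cinner x z = cinner y z) \<Longrightarrow> x = (y::'a::complex_inner)"
proof -
  assume "\<And>z. cinner x z = cinner y z"
  hence "inner x (x - y) = inner y (x - y)" by (simp add: inner_eq_Re_cinner)
  hence "inner (x - y) (x - y) = 0" by (simp add: inner_diff_left)
  thus ?thesis by simp
qed

lemma riesz_real:
  fixes f :: "'a::{real_inner,complete_space} \<Rightarrow> real"
  assumes "bounded_linear f"
  shows "\<exists>y. \<forall>x. f x = inner x y"
proof -
  interpret f: bounded_linear f by fact
  obtain K where K: "\<And>x. \<bar>f x\<bar> \<le> norm x * K" "K > 0" using f.pos_bounded by auto
  define J where "J x = 2 * f x - (norm x)\<^sup>2" for x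
  have Jle: "J x \<le> K\<^sup>2" for x
  proof -
    have "2 * f x \<le> 2 * (norm x * K)" using K(1)[of x] by linarith
    moreover have "0 \<le> (norm x - K)\<^sup>2" by simp
    ultimately show ?thesis unfolding J_def power2_diff by linarith
  qed
  define S where "S = (SUP x. J x)"
  have bdd: "bdd_above (range J)" using Jle by (auto intro!: bdd_aboveI[of _ "K\<^sup>2"])
  have JS: "J x \<le> S" for x unfolding S_def by (rule cSUP_upper[OF _ bdd]) simp
  have "\<exists>x. S - 1 / Suc n < J x" for n
    using less_cSUP_iff[OF _ bdd, of "S - 1 / Suc n"] unfolding S_def[symmetric] by auto
  then obtain X where X: "\<And>n. S - 1 / Suc n < J (X n)" by metis
  have par: "(norm (x - y))\<^sup>2 = 4 * J ((1/2) *\<^sub>R (x + y)) - 2 * (J x + J y)" for x y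
    unfolding J_def
    by (simp add: f.scaleR f.add power2_norm_eq_inner inner_add_left inner_add_right
        inner_diff_left inner_diff_right inner_commute field_simps)
  have arith: "q = 4 * p - 2 * (u + v) \<Longrightarrow> p \<le> s \<Longrightarrow> s - a < u \<Longrightarrow> s - b < v \<Longrightarrow> q < 2 * a + 2 * b"
    for a b p q s u v :: real by (simp add: algebra_simps)
  have close: "(norm (X m - X n))\<^sup>2 < 2 / Suc m + 2 / Suc n" for m n
  proof -
    define a b where "a = 1 / real (Suc m)" and "b = 1 / real (Suc n)"
    have "S - a < J (X m)" "S - b < J (X n)" using X by (simp_all add: a_def b_def)
    hence "(norm (X m - X n))\<^sup>2 < 2 * a + 2 * b"
      using arith[OF par[of "X m" "X n"] JS[of "(1/2) *\<^sub>R (X m + X n)"]] by blast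
    thus ?thesis by (simp add: a_def b_def)
  qed
  have "Cauchy X"
  proof (rule CauchyI)
    fix e :: real assume e: "e > 0"
    obtain N where N: "4 / e\<^sup>2 < Suc N" using reals_Archimedean2 by (metis less_Suc_eq of_nat_less_iff order_less_trans)
    show "\<exists>M. \<forall>m\<ge>M. \<forall>n\<ge>M. norm (X m - X n) < e"
    proof (intro exI allI impI)
      fix m n assume "N \<le> m" "N \<le> n"
      hence "2 / Suc m \<le> 2 / real (Suc N)" "2 / Suc n \<le> 2 / real (Suc N)"
        by (auto intro!: divide_left_mono)
      moreover have "4 / real (Suc N) < e\<^sup>2" using N e by (simp add: field_simps)
      ultimately have "(norm (X m - X n))\<^sup>2 < e\<^sup>2" using close[of m n] by linarith
      thus "norm (X m - X n) < e" using e by (simp add: power2_less_imp_less)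
    qed
  qed
  then obtain y where y: "X \<longlonglongrightarrow> y" using Cauchy_convergent convergent_def by blast
  have "(\<lambda>n. J (X n)) \<longlonglongrightarrow> J y"
    unfolding J_def by (intro tendsto_intros f.tendsto y)
  moreover have "(\<lambda>n. S - 1 / Suc n) \<longlonglongrightarrow> S - 0"
    using LIMSEQ_inverse_real_of_nat by (intro tendsto_intros) (simp add: inverse_eq_divide)
  ultimately have "S \<le> J y"
    using X by (intro LIMSEQ_le[of "\<lambda>n. S - 1 / Suc n" _ "\<lambda>n. J (X n)"]) (auto intro: less_imp_le)
  hence Jy: "J x \<le> J y" for x using JS[of x] by linarith
  have "f x = inner x y" for x
  proof (cases "x = 0")
    case False
    define d where "d = f x - inner x y"
    have exp: "J (y + t *\<^sub>R x) = J y + 2 * t * d - t\<^sup>2 * (norm x)\<^sup>2" for t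
      unfolding J_def d_def power2_norm_eq_inner
      by (simp add: f.scaleR f.add inner_add_left inner_add_right
          inner_commute[of y x] algebra_simps power2_eq_square[of t])
    define t where "t = d / (norm x)\<^sup>2"
    have nz: "(norm x)\<^sup>2 > 0" using False by simp
    have "2 * t * d - t\<^sup>2 * (norm x)\<^sup>2 \<le> 0" using Jy[of "y + t *\<^sub>R x"] exp[of t] by linarith
    moreover have "2 * t * d - t\<^sup>2 * (norm x)\<^sup>2 = d\<^sup>2 / (norm x)\<^sup>2"
      unfolding t_def using nz by (simp add: field_simps power2_eq_square)
    ultimately have "d\<^sup>2 \<le> 0" using nz by (simp add: field_simps)
    hence "d = 0" by simp
    thus ?thesis by (simp add: d_def)
  qed (simp add: f.zero)
  thus ?thesis by blast
qed


section \<open>The \<open>C\<^sup>*\<close>-algebra of bounded operators on a Hilbert space\<close>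

definition bounded_clinear :: "('a::complex_inner \<Rightarrow> 'b::complex_inner) \<Rightarrow> bool" where
  "bounded_clinear f \<longleftrightarrow> bounded_linear f \<and> (\<forall>c x. f (c *\<^sub>C x) = c *\<^sub>C f x)"

lemma bounded_clinearD: "bounded_clinear f \<Longrightarrow> bounded_linear f"
  by (simp add: bounded_clinear_def)

lemma riesz_complex:
  fixes f :: "'a::chilbert_space \<Rightarrow> complex"
  assumes f: "bounded_linear f" and fc: "\<And>c x. f (c *\<^sub>C x) = c * f x"
  shows "\<exists>y. \<forall>x. f x = cinner x y"
proof -
  have "bounded_linear (\<lambda>x. Re (f x))"
    by (rule bounded_linear_compose[OF bounded_linear_Re f])
  then obtain y where y: "\<And>x. Re (f x) = Re (cinner x y)"
    using riesz_real by (metis inner_eq_Re_cinner)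
  have "Im (f x) = Im (cinner x y)" for x
    using y[of "(- \<i>) *\<^sub>C x"] by (simp add: fc cinner_scaleC_left)
  thus ?thesis using y by (auto simp: complex_eq_iff)
qed

lemma bounded_clinearI:
  fixes f :: "'a::complex_inner \<Rightarrow> 'b::complex_inner"
  assumes "\<And>x y. f (x + y) = f x + f y" "\<And>c x. f (c *\<^sub>C x) = c *\<^sub>C f x"
    "\<And>x. norm (f x) \<le> norm x * K"
  shows "bounded_clinear f"
  unfolding bounded_clinear_def
  using assms by (auto intro!: bounded_linear_intro[where K=K] simp: scaleR_scaleC)

lemma adjoint_exists:
  fixes T :: "'a::chilbert_space \<Rightarrow> 'a"
  assumes T: "bounded_clinear T"
  shows "\<exists>S. bounded_clinear S \<and> (\<forall>x y. cinner (T x) y = cinner x (S y))"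
proof -
  interpret T: bounded_linear T using T by (rule bounded_clinearD)
  obtain K where K: "\<And>x. norm (T x) \<le> norm x * K" "K \<ge> 0" using T.nonneg_bounded by auto
  have "\<exists>z. \<forall>x. cinner (T x) y = cinner x z" for y
  proof (rule riesz_complex)
    show "bounded_linear (\<lambda>x. cinner (T x) y)"
    proof (rule bounded_linear_intro[where K="K * norm y"])
      fix x
      have "cmod (cinner (T x) y) \<le> norm (T x) * norm y" by (rule cinner_Cauchy_Schwarz)
      also have "\<dots> \<le> norm x * K * norm y" using K(1)[of x] by (simp add: mult_right_mono)
      finally show "cmod (cinner (T x) y) \<le> norm x * (K * norm y)" by (simp add: mult.assoc)
    qed (simp_all add: T.add T.scaleR cinner_add_left cinner_scaleR_left scaleR_conv_of_real)
    show "cinner (T (c *\<^sub>C x)) y = c * cinner (T x) y" for c x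
      using T by (simp add: bounded_clinear_def cinner_scaleC_left)
  qed
  then obtain S where S: "\<And>x y. cinner (T x) y = cinner x (S y)" by metis
  have S': "cinner (S y) x = cinner y (T x)" for x y
    by (metis S cinner_commute)
  have "bounded_clinear S"
  proof (rule bounded_clinearI[where K=K])
    show "S (x + y) = S x + S y" for x y
      by (rule cinner_ext) (simp add: S' cinner_add_left)
    show "S (c *\<^sub>C x) = c *\<^sub>C S x" for c x
      by (rule cinner_ext) (simp add: S' cinner_scaleC_left)
    show "norm (S y) \<le> norm y * K" for y
    proof (cases "S y = 0")
      case False
      have "(norm (S y))\<^sup>2 = cmod (cinner (S y) (S y))" by (simp add: cinner_self norm_power)
      also have "\<dots> = cmod (cinner y (T (S y)))" by (simp add: S')
      also have "\<dots> \<le> norm y * norm (T (S y))" by (rule cinner_Cauchy_Schwarz)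
      also have "\<dots> \<le> norm y * (norm (S y) * K)" by (rule mult_left_mono[OF K(1)]) simp
      finally have "norm (S y) * norm (S y) \<le> norm (S y) * (norm y * K)"
        by (simp add: power2_eq_square algebra_simps)
      thus ?thesis using False by simp
    qed (use K(2) in simp)
  qed
  with S show ?thesis by blast
qed

lemma bounded_clinear_0: "bounded_clinear (\<lambda>_. 0)"
  by (rule bounded_clinearI[where K=0]) (simp_all add: scaleC_zero_right)

lemma bounded_clinear_add:
  "bounded_clinear f \<Longrightarrow> bounded_clinear g \<Longrightarrow> bounded_clinear (\<lambda>x. f x + g x)"
  by (simp add: bounded_clinear_def bounded_linear_add scaleC_add_right)

lemma bounded_clinear_scaleC:
  assumes "bounded_clinear f" shows "bounded_clinear (\<lambda>x. c *\<^sub>C f x)"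
proof -
  interpret f: bounded_linear f using assms by (rule bounded_clinearD)
  obtain K where K: "\<And>x. norm (f x) \<le> norm x * K" using f.bounded by auto
  show ?thesis
  proof (rule bounded_clinearI[where K="cmod c * K"])
    fix x show "norm (c *\<^sub>C f x) \<le> norm x * (cmod c * K)"
      using mult_left_mono[OF K[of x], of "cmod c"] by (simp add: norm_scaleC_inner ac_simps)
  qed (use assms in \<open>simp_all add: bounded_clinear_def f.add scaleC_add_right scaleC_scaleC mult.commute\<close>)
qed

lemma bounded_clinear_compose:
  "bounded_clinear f \<Longrightarrow> bounded_clinear g \<Longrightarrow> bounded_clinear (\<lambda>x. f (g x))"
  by (simp add: bounded_clinear_def bounded_linear_compose)

typedef (overloaded) 'h bop = "{T :: 'h::chilbert_space \<Rightarrow> 'h. bounded_clinear T}"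
  morphisms bop_apply Abs_bop
  using bounded_clinear_0 by blast

setup_lifting type_definition_bop

lemma bop_eqI: "(\<And>x. bop_apply S x = bop_apply T x) \<Longrightarrow> S = T"
  by transfer auto

lemma bounded_clinear_bop: "bounded_clinear (bop_apply T)"
  by transfer

lemma bounded_linear_bop: "bounded_linear (bop_apply T)"
  by (rule bounded_clinearD[OF bounded_clinear_bop])

instantiation bop :: (chilbert_space) complex_vector
begin

lift_definition zero_bop :: "'a bop" is "\<lambda>_. 0" by (rule bounded_clinear_0)

lift_definition plus_bop :: "'a bop \<Rightarrow> 'a bop \<Rightarrow> 'a bop" is "\<lambda>S T x. S x + T x"
  by (rule bounded_clinear_add)

lift_definition scaleC_bop :: "complex \<Rightarrow> 'a bop \<Rightarrow> 'a bop" is "\<lambda>c T x. c *\<^sub>C T x"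
  by (rule bounded_clinear_scaleC)

lift_definition scaleR_bop :: "real \<Rightarrow> 'a bop \<Rightarrow> 'a bop" is "\<lambda>r T x. r *\<^sub>R T x"
  unfolding scaleR_scaleC by (rule bounded_clinear_scaleC)

lift_definition uminus_bop :: "'a bop \<Rightarrow> 'a bop" is "\<lambda>T x. - T x"
  unfolding scaleC_minus1[symmetric] by (rule bounded_clinear_scaleC)

lift_definition minus_bop :: "'a bop \<Rightarrow> 'a bop \<Rightarrow> 'a bop" is "\<lambda>S T x. S x - T x"
  unfolding diff_conv_add_uminus scaleC_minus1[symmetric]
  by (intro bounded_clinear_add bounded_clinear_scaleC)

instance
proof
  fix S T R :: "'a bop" and a b :: real and c d :: complex
  show "S + T + R = S + (T + R)" by transfer (simp add: add.assoc)
  show "S + T = T + S" by transfer (simp add: add.commute)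
  show "0 + S = S" by transfer simp
  show "- S + S = 0" by transfer simp
  show "S - T = S + - T" by transfer simp
  show "a *\<^sub>R (S + T) = a *\<^sub>R S + a *\<^sub>R T" by transfer (simp add: scaleR_add_right)
  show "(a + b) *\<^sub>R S = a *\<^sub>R S + b *\<^sub>R S" by transfer (simp add: scaleR_add_left)
  show "a *\<^sub>R b *\<^sub>R S = (a * b) *\<^sub>R S" by transfer simp
  show "1 *\<^sub>R S = S" by transfer simp
  show "c *\<^sub>C (S + T) = c *\<^sub>C S + c *\<^sub>C T" by transfer (simp add: scaleC_add_right)
  show "(c + d) *\<^sub>C S = c *\<^sub>C S + d *\<^sub>C S" by transfer (simp add: scaleC_add_left)
  show "c *\<^sub>C d *\<^sub>C S = (c * d) *\<^sub>C S" by transfer (simp add: scaleC_scaleC)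
  show "a *\<^sub>R S = complex_of_real a *\<^sub>C S" by transfer (simp add: scaleR_scaleC)
qed

end

instantiation bop :: (chilbert_space) real_normed_algebra
begin

lift_definition times_bop :: "'a bop \<Rightarrow> 'a bop \<Rightarrow> 'a bop" is "\<lambda>S T x. S (T x)"
  by (rule bounded_clinear_compose)

lift_definition norm_bop :: "'a bop \<Rightarrow> real" is onorm .

definition dist_bop :: "'a bop \<Rightarrow> 'a bop \<Rightarrow> real" where "dist_bop S T = norm (S - T)"
definition sgn_bop :: "'a bop \<Rightarrow> 'a bop" where "sgn_bop T = T /\<^sub>R norm T"
definition uniformity_bop :: "('a bop \<times> 'a bop) filter" where
  "uniformity_bop = (INF e\<in>{0<..}. principal {(S, T). dist S T < e})"
definition open_bop :: "'a bop set \<Rightarrow> bool" where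
  "open_bop U \<longleftrightarrow> (\<forall>S\<in>U. \<forall>\<^sub>F (S', T) in uniformity. S' = S \<longrightarrow> T \<in> U)"

lemma norm_bop_apply: "norm (bop_apply T x) \<le> norm T * norm x"
  by (simp add: norm_bop.rep_eq onorm bounded_linear_bop)

lemma norm_bop_bound:
  "0 \<le> b \<Longrightarrow> (\<And>x. norm (bop_apply T x) \<le> b * norm x) \<Longrightarrow> norm T \<le> b"
  by (simp add: norm_bop.rep_eq onorm_bound)

lemma norm_bop_nonneg: "0 \<le> norm (T :: 'a bop)"
  by (simp add: norm_bop.rep_eq onorm_pos_le bounded_linear_bop)

instance
proof
  fix S T R :: "'a bop" and c d :: complex and a b :: real
  show "S * T * R = S * (T * R)" by transfer simp
  show "(S + T) * R = S * R + T * R" by transfer simp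
  show "R * (S + T) = R * S + R * T"
    by (rule bop_eqI) (simp add: times_bop.rep_eq plus_bop.rep_eq bounded_linear.linear[OF bounded_linear_bop] linear_add)
  show "(a *\<^sub>R S) * T = a *\<^sub>R (S * T)" by transfer simp
  show "S * (a *\<^sub>R T) = a *\<^sub>R (S * T)"
    by (rule bop_eqI) (simp add: times_bop.rep_eq scaleR_bop.rep_eq bounded_linear.linear[OF bounded_linear_bop] linear_scale)
  show "sgn S = S /\<^sub>R norm S" by (rule sgn_bop_def)
  show "dist S T = norm (S - T)" by (rule dist_bop_def)
  show "(uniformity :: ('a bop \<times> 'a bop) filter) = (INF e\<in>{0<..}. principal {(S, T). dist S T < e})"
    by (rule uniformity_bop_def)
  show "open U \<longleftrightarrow> (\<forall>S\<in>U. \<forall>\<^sub>F (S', T) in uniformity. S' = S \<longrightarrow> T \<in> U)" for U :: "'a bop set"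
    by (rule open_bop_def)
  show "norm S = 0 \<longleftrightarrow> S = 0"
    by transfer (auto simp: onorm_eq_0 bounded_clinearD fun_eq_iff)
  show "norm (S + T) \<le> norm S + norm T"
    by transfer (simp add: onorm_triangle bounded_clinearD)
  show "norm (a *\<^sub>R S) = \<bar>a\<bar> * norm S"
    by transfer (simp add: onorm_scaleR bounded_clinearD)
  have "norm (bop_apply (S * T) x) \<le> norm S * norm T * norm x" for x
    using order_trans[OF norm_bop_apply[of S] mult_left_mono[OF norm_bop_apply[of T x] norm_bop_nonneg]]
    by (simp add: times_bop.rep_eq mult.assoc)
  thus "norm (S * T) \<le> norm S * norm T" by (intro norm_bop_bound) (simp_all add: norm_bop_nonneg)
qed

end

instance bop :: (chilbert_space) complete_space
proof
  fix X :: "nat \<Rightarrow> 'a bop"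
  assume X: "Cauchy X"
  define B where "B T = Blinfun (bop_apply T)" for T :: "'a bop"
  have B: "blinfun_apply (B T) = bop_apply T" for T
    by (simp add: B_def bounded_linear_Blinfun_apply bounded_linear_bop)
  have distB: "dist (B S) (B T) = dist S T" for S T
    by (simp add: dist_norm norm_blinfun.rep_eq minus_blinfun.rep_eq B norm_bop.rep_eq minus_bop.rep_eq)
  have "Cauchy (\<lambda>n. B (X n))" using X by (simp add: Cauchy_def distB)
  then obtain L where L: "(\<lambda>n. B (X n)) \<longlonglongrightarrow> L" using Cauchy_convergent convergent_def by blast
  have lim: "(\<lambda>n. bop_apply (X n) x) \<longlonglongrightarrow> blinfun_apply L x" for x
    using blinfun.tendsto[OF L tendsto_const[of x]] by (simp add: B)
  have "blinfun_apply L (c *\<^sub>C x) = c *\<^sub>C blinfun_apply L x" for c x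
  proof (rule LIMSEQ_unique[OF lim])
    have bl: "bounded_linear (\<lambda>y::'a. c *\<^sub>C y)"
      by (rule bounded_clinearD, rule bounded_clinear_scaleC)
         (rule bounded_clinearI[where K=1], simp_all)
    have "bop_apply (X n) (c *\<^sub>C x) = c *\<^sub>C bop_apply (X n) x" for n
      using bounded_clinear_bop[of "X n"] by (simp add: bounded_clinear_def)
    thus "(\<lambda>n. bop_apply (X n) (c *\<^sub>C x)) \<longlonglongrightarrow> c *\<^sub>C blinfun_apply L x"
      using bounded_linear.tendsto[OF bl lim[of x]] by simp
  qed
  hence "bounded_clinear (blinfun_apply L)"
    by (simp add: bounded_clinear_def blinfun.bounded_linear_right)
  then obtain T where "bop_apply T = blinfun_apply L"
    using Abs_bop_inverse by blast
  hence "L = B T" by (metis B blinfun_apply_inject)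
  hence "X \<longlonglongrightarrow> T" using L by (simp add: tendsto_iff distB)
  thus "convergent X" by (auto simp: convergent_def)
qed

instantiation bop :: (chilbert_space) cstar_algebra
begin

lift_definition star_bop :: "'a bop \<Rightarrow> 'a bop" is
  "\<lambda>T. SOME S. bounded_clinear S \<and> (\<forall>x y. cinner (T x) y = cinner x (S y))"
  by (rule someI2_ex[OF adjoint_exists]) auto

lemma cinner_star_bop: "cinner (bop_apply T x) y = cinner x (bop_apply (star T) y)"
proof (transfer fixing: x y)
  fix T :: "'a \<Rightarrow> 'a" assume "bounded_clinear T"
  from someI_ex[OF adjoint_exists[OF this]]
  show "cinner (T x) y = cinner x
     ((SOME S. bounded_clinear S \<and> (\<forall>x y. cinner (T x) y = cinner x (S y))) y)" by blast
qed

lemma cinner_star_bop': "cinner (bop_apply (star T) x) y = cinner x (bop_apply T y)"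
  by (metis cinner_star_bop cinner_commute)

lemma norm_star_bop_le: "norm (star T) \<le> norm (T :: 'a bop)"
proof (rule norm_bop_bound[OF norm_bop_nonneg])
  fix x
  let ?y = "bop_apply (star T) x"
  show "norm ?y \<le> norm T * norm x"
  proof (cases "?y = 0")
    case False
    have "(norm ?y)\<^sup>2 = cmod (cinner ?y ?y)" by (simp add: cinner_self norm_power)
    also have "\<dots> = cmod (cinner x (bop_apply T ?y))" by (simp add: cinner_star_bop')
    also have "\<dots> \<le> norm x * norm (bop_apply T ?y)" by (rule cinner_Cauchy_Schwarz)
    also have "\<dots> \<le> norm x * (norm T * norm ?y)" by (rule mult_left_mono[OF norm_bop_apply]) simp
    finally have "norm ?y * norm ?y \<le> norm ?y * (norm T * norm x)"
      by (simp add: power2_eq_square algebra_simps)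
    thus ?thesis using False by simp
  qed simp
qed

instance
proof
  fix S T :: "'a bop" and c :: complex
  show "(c *\<^sub>C S) * T = c *\<^sub>C (S * T)" by transfer simp
  show "S * (c *\<^sub>C T) = c *\<^sub>C (S * T)" by transfer (simp add: bounded_clinear_def)
  have le: "norm (c *\<^sub>C T) \<le> cmod c * norm T" for c and T :: "'a bop"
    by (rule norm_bop_bound)
       (simp_all add: scaleC_bop.rep_eq norm_scaleC_inner mult_left_mono norm_bop_apply mult.assoc)
  show "norm (c *\<^sub>C S) = cmod c * norm S"
  proof (cases "c = 0")
    case True
    thus ?thesis using le[of c S] by simp
  next
    case False
    have "norm ((inverse c) *\<^sub>C c *\<^sub>C S) \<le> cmod (inverse c) * norm (c *\<^sub>C S)" by (rule le)
    moreover have "(inverse c) *\<^sub>C c *\<^sub>C S = S"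
      using False by (simp add: scaleC_scaleC scaleC_one)
    ultimately have "norm S \<le> norm (c *\<^sub>C S) / cmod c"
      by (simp add: norm_inverse divide_inverse mult.commute)
    hence "cmod c * norm S \<le> norm (c *\<^sub>C S)"
      using False by (simp add: pos_le_divide_eq mult.commute)
    thus ?thesis using le[of c S] by simp
  qed
  show "star (star S) = S"
    by (rule bop_eqI, rule cinner_ext) (metis cinner_star_bop cinner_star_bop')
  show "star (S + T) = star S + star T"
    by (rule bop_eqI, rule cinner_ext)
       (simp add: cinner_star_bop' plus_bop.rep_eq cinner_add_left cinner_add_right)
  show "star (c *\<^sub>C S) = cnj c *\<^sub>C star S"
    by (rule bop_eqI, rule cinner_ext)
       (simp add: cinner_star_bop' scaleC_bop.rep_eq cinner_scaleC_left cinner_scaleC_right)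
  show "star (S * T) = star T * star S"
    by (rule bop_eqI, rule cinner_ext) (simp add: cinner_star_bop' times_bop.rep_eq)
  show "norm (star S * S) = (norm S)\<^sup>2"
  proof (rule antisym)
    have "norm (star S * S) \<le> norm (star S) * norm S" by (rule norm_mult_ineq)
    also have "\<dots> \<le> norm S * norm S"
      by (rule mult_right_mono[OF norm_star_bop_le norm_ge_zero])
    finally show "norm (star S * S) \<le> (norm S)\<^sup>2" by (simp add: power2_eq_square)
    have "norm S \<le> sqrt (norm (star S * S))"
    proof (rule norm_bop_bound)
      fix x
      have "(norm (bop_apply S x))\<^sup>2 = cmod (cinner (bop_apply S x) (bop_apply S x))"
        by (simp add: cinner_self norm_power)
      also have "\<dots> = cmod (cinner x (bop_apply (star S * S) x))"
        by (simp add: cinner_star_bop times_bop.rep_eq)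
      also have "\<dots> \<le> norm x * norm (bop_apply (star S * S) x)" by (rule cinner_Cauchy_Schwarz)
      also have "\<dots> \<le> norm x * (norm (star S * S) * norm x)"
        by (rule mult_left_mono[OF norm_bop_apply]) simp
      also have "\<dots> = (sqrt (norm (star S * S)) * norm x)\<^sup>2"
        by (simp add: power_mult_distrib power2_eq_square)
      finally show "norm (bop_apply S x) \<le> sqrt (norm (star S * S)) * norm x"
        by (rule power2_le_imp_le) simp
    qed simp
    hence "(norm S)\<^sup>2 \<le> (sqrt (norm (star S * S)))\<^sup>2"
      by (rule power_mono) simp
    thus "(norm S)\<^sup>2 \<le> norm (star S * S)" by simp
  qed
qed

end


section \<open>The Hilbert space \<open>L\<^sup>2\<close>\<close>

text \<open>A type equipped with a distinguished measure. It serves both for a locally compact group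
  with its Haar measure and for the natural numbers with counting measure.\<close>

class measured =
  fixes msr :: "'a measure"

definition sq_integrable :: "('a::measured \<Rightarrow> complex) \<Rightarrow> bool" where
  "sq_integrable f \<longleftrightarrow> f \<in> borel_measurable msr \<and> integrable msr (\<lambda>x. (cmod (f x))\<^sup>2)"

definition L2_rel :: "('a::measured \<Rightarrow> complex) \<Rightarrow> ('a \<Rightarrow> complex) \<Rightarrow> bool" where
  "L2_rel f g \<longleftrightarrow> sq_integrable f \<and> sq_integrable g \<and> (AE x in msr. f x = g x)"

lemma sq_integrable_0: "sq_integrable (\<lambda>_. 0)"
  by (simp add: sq_integrable_def)

lemma sq_integrable_scale: "sq_integrable f \<Longrightarrow> sq_integrable (\<lambda>x. c * f x)"
  unfolding sq_integrable_def
  by (auto simp: norm_mult power_mult_distrib intro!: borel_measurable_times)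

lemma sq_integrable_add:
  assumes "sq_integrable f" "sq_integrable g"
  shows "sq_integrable (\<lambda>x. f x + g x)"
proof -
  have "(cmod (a + b))\<^sup>2 \<le> 2 * (cmod a)\<^sup>2 + 2 * (cmod b)\<^sup>2" for a b
  proof -
    have "(cmod (a + b))\<^sup>2 \<le> (cmod a + cmod b)\<^sup>2"
      by (rule power_mono[OF norm_triangle_ineq norm_ge_zero])
    moreover have "0 \<le> (cmod a - cmod b)\<^sup>2" by simp
    ultimately show ?thesis unfolding power2_sum power2_diff by linarith
  qed
  moreover have "integrable msr (\<lambda>x. 2 * (cmod (f x))\<^sup>2 + 2 * (cmod (g x))\<^sup>2)"
    using assms by (simp add: sq_integrable_def)
  moreover have [measurable]: "f \<in> borel_measurable msr" "g \<in> borel_measurable msr"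
    using assms by (simp_all add: sq_integrable_def)
  ultimately have "integrable msr (\<lambda>x. (cmod (f x + g x))\<^sup>2)"
    by (elim Bochner_Integration.integrable_bound) simp_all
  thus ?thesis by (simp add: sq_integrable_def)
qed

lemma sq_integrable_mult_cnj:
  assumes "sq_integrable f" "sq_integrable g"
  shows "integrable msr (\<lambda>x. f x * cnj (g x))"
proof (rule Bochner_Integration.integrable_bound)
  show "integrable msr (\<lambda>x. (cmod (f x))\<^sup>2 + (cmod (g x))\<^sup>2)"
    using assms by (simp add: sq_integrable_def)
  have "cmod a * cmod b \<le> (cmod a)\<^sup>2 + (cmod b)\<^sup>2" for a b
  proof -
    have "0 \<le> (cmod a - cmod b)\<^sup>2" "0 \<le> cmod a * cmod b" by simp_all
    thus ?thesis unfolding power2_diff by linarith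
  qed
  thus "AE x in msr. norm (f x * cnj (g x)) \<le> norm ((cmod (f x))\<^sup>2 + (cmod (g x))\<^sup>2)"
    by (simp add: norm_mult)
  show "(\<lambda>x. f x * cnj (g x)) \<in> borel_measurable msr"
  proof -
    have [measurable]: "f \<in> borel_measurable msr" "g \<in> borel_measurable msr"
      using assms by (simp_all add: sq_integrable_def)
    have [measurable]: "(\<lambda>x. cnj (g x)) \<in> borel_measurable msr"
      by (rule borel_measurable_continuous_onI[THEN measurable_compose_rev]) (auto intro: continuous_intros)
    show ?thesis by measurable
  qed
qed

quotient_type (overloaded) 'a L2 = "'a::measured \<Rightarrow> complex" / partial: L2_rel
  unfolding part_equivp_def
proof (intro conjI exI allI)
  show "L2_rel (\<lambda>_::'a. 0) (\<lambda>_. 0)" by (simp add: L2_rel_def sq_integrable_0)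
  fix f g :: "'a \<Rightarrow> complex"
  have "L2_rel f h \<longleftrightarrow> L2_rel g h" if "L2_rel f g" for h
  proof -
    have fg: "AE x in msr. f x = g x" using that by (simp add: L2_rel_def)
    have "(AE x in msr. f x = h x) \<longleftrightarrow> (AE x in msr. g x = h x)"
      by (rule eventually_subst) (use fg in \<open>eventually_elim, simp\<close>)
    thus ?thesis using that by (simp add: L2_rel_def)
  qed
  moreover have "L2_rel f f" "L2_rel g g" if "L2_rel f g" using that by (simp_all add: L2_rel_def)
  moreover have "L2_rel f g" if "L2_rel g g" "L2_rel f = L2_rel g" using that by simp
  ultimately show "L2_rel f g \<longleftrightarrow> L2_rel f f \<and> L2_rel g g \<and> L2_rel f = L2_rel g"
    using ext[of "L2_rel f" "L2_rel g"] by blast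
qed

lemma L2_rel_rep: "L2_rel (rep_L2 \<xi>) (rep_L2 \<xi>)"
  by (metis Quotient3_L2 Quotient3_rep_reflp)

lemma sq_integrable_rep: "sq_integrable (rep_L2 \<xi>)"
  using L2_rel_rep by (auto simp: L2_rel_def)

lemma rep_abs_L2: "sq_integrable f \<Longrightarrow> AE x in msr. rep_L2 (abs_L2 f) x = f x"
  using rep_abs_rsp_left[OF Quotient3_L2, of f f] by (auto simp: L2_rel_def)

lemma L2_eqI: "(AE x in msr. rep_L2 \<xi> x = rep_L2 \<eta> x) \<Longrightarrow> \<xi> = \<eta>"
  by (metis L2_rel_def Quotient3_L2 Quotient3_rel_rep sq_integrable_rep)

instantiation L2 :: (measured) complex_vector
begin

lift_definition zero_L2 :: "'a L2" is "\<lambda>_. 0"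
  by (simp add: L2_rel_def sq_integrable_0)

lift_definition plus_L2 :: "'a L2 \<Rightarrow> 'a L2 \<Rightarrow> 'a L2" is "\<lambda>f g x. f x + g x"
proof -
  fix f f' g g' :: "'a \<Rightarrow> complex"
  assume *: "L2_rel f f'" "L2_rel g g'"
  hence "AE x in msr. f x = f' x" "AE x in msr. g x = g' x" by (simp_all add: L2_rel_def)
  hence "AE x in msr. f x + g x = f' x + g' x" by eventually_elim simp
  thus "L2_rel (\<lambda>x. f x + g x) (\<lambda>x. f' x + g' x)"
    using * by (simp add: L2_rel_def sq_integrable_add)
qed

lift_definition scaleC_L2 :: "complex \<Rightarrow> 'a L2 \<Rightarrow> 'a L2" is "\<lambda>c f x. c * f x"
proof -
  fix c and f f' :: "'a \<Rightarrow> complex"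
  assume *: "L2_rel f f'"
  hence "AE x in msr. f x = f' x" by (simp add: L2_rel_def)
  hence "AE x in msr. c * f x = c * f' x" by eventually_elim simp
  thus "L2_rel (\<lambda>x. c * f x) (\<lambda>x. c * f' x)"
    using * unfolding L2_rel_def by (blast intro: sq_integrable_scale)
qed

definition scaleR_L2 :: "real \<Rightarrow> 'a L2 \<Rightarrow> 'a L2" where
  "scaleR_L2 r \<xi> = complex_of_real r *\<^sub>C \<xi>"

definition uminus_L2 :: "'a L2 \<Rightarrow> 'a L2" where "uminus_L2 \<xi> = (- 1) *\<^sub>C \<xi>"

definition minus_L2 :: "'a L2 \<Rightarrow> 'a L2 \<Rightarrow> 'a L2" where "minus_L2 \<xi> \<eta> = \<xi> + - \<eta>"

instance
proof
  fix \<xi> \<eta> \<zeta> :: "'a L2" and a b :: real and c d :: complex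
  show add_assoc: "\<xi> + \<eta> + \<zeta> = \<xi> + (\<eta> + \<zeta>)"
    by transfer (simp add: L2_rel_def sq_integrable_add add.assoc)
  show "\<xi> + \<eta> = \<eta> + \<xi>" by transfer (simp add: L2_rel_def sq_integrable_add add.commute)
  show "0 + \<xi> = \<xi>" by transfer (simp add: L2_rel_def)
  show "- \<xi> + \<xi> = 0" unfolding uminus_L2_def
    by transfer (simp add: L2_rel_def sq_integrable_0)
  show "\<xi> - \<eta> = \<xi> + - \<eta>" by (rule minus_L2_def)
  show 1: "c *\<^sub>C (\<xi> + \<eta>) = c *\<^sub>C \<xi> + c *\<^sub>C \<eta>" for c
    by transfer (simp add: L2_rel_def sq_integrable_add sq_integrable_scale algebra_simps)
  show 2: "(c + d) *\<^sub>C \<xi> = c *\<^sub>C \<xi> + d *\<^sub>C \<xi>" for c d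
    by transfer (simp add: L2_rel_def sq_integrable_add sq_integrable_scale algebra_simps)
  show 3: "c *\<^sub>C d *\<^sub>C \<xi> = (c * d) *\<^sub>C \<xi>" for c d
    by transfer (simp add: L2_rel_def sq_integrable_scale mult.assoc)
  show "a *\<^sub>R \<xi> = complex_of_real a *\<^sub>C \<xi>" by (rule scaleR_L2_def)
  show "a *\<^sub>R (\<xi> + \<eta>) = a *\<^sub>R \<xi> + a *\<^sub>R \<eta>" by (simp add: scaleR_L2_def 1)
  show "(a + b) *\<^sub>R \<xi> = a *\<^sub>R \<xi> + b *\<^sub>R \<xi>" by (simp add: scaleR_L2_def 2)
  show "a *\<^sub>R b *\<^sub>R \<xi> = (a * b) *\<^sub>R \<xi>" by (simp add: scaleR_L2_def 3)
  show "1 *\<^sub>R \<xi> = \<xi>" unfolding scaleR_L2_def by transfer (simp add: L2_rel_def)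
qed

end

instantiation L2 :: (measured) complex_inner
begin

lift_definition cinner_L2 :: "'a L2 \<Rightarrow> 'a L2 \<Rightarrow> complex" is
  "\<lambda>f g. LINT x|msr. f x * cnj (g x)"
proof -
  fix f f' g g' :: "'a \<Rightarrow> complex"
  assume "L2_rel f f'" "L2_rel g g'"
  hence sq: "sq_integrable f" "sq_integrable f'" "sq_integrable g" "sq_integrable g'"
    and ae: "AE x in msr. f x = f' x" "AE x in msr. g x = g' x" by (simp_all add: L2_rel_def)
  from ae have "AE x in msr. f x * cnj (g x) = f' x * cnj (g' x)" by eventually_elim simp
  thus "(LINT x|msr. f x * cnj (g x)) = (LINT x|msr. f' x * cnj (g' x))"
    by (intro integral_cong_AE borel_measurable_integrable sq_integrable_mult_cnj sq)
qed

definition inner_L2 :: "'a L2 \<Rightarrow> 'a L2 \<Rightarrow> real" where "inner_L2 \<xi> \<eta> = Re (cinner \<xi> \<eta>)"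
definition norm_L2 :: "'a L2 \<Rightarrow> real" where "norm_L2 \<xi> = sqrt (inner \<xi> \<xi>)"
definition dist_L2 :: "'a L2 \<Rightarrow> 'a L2 \<Rightarrow> real" where "dist_L2 \<xi> \<eta> = norm (\<xi> - \<eta>)"
definition sgn_L2 :: "'a L2 \<Rightarrow> 'a L2" where "sgn_L2 \<xi> = \<xi> /\<^sub>R norm \<xi>"
definition uniformity_L2 :: "('a L2 \<times> 'a L2) filter" where
  "uniformity_L2 = (INF e\<in>{0<..}. principal {(\<xi>, \<eta>). dist \<xi> \<eta> < e})"
definition open_L2 :: "'a L2 set \<Rightarrow> bool" where
  "open_L2 U \<longleftrightarrow> (\<forall>\<xi>\<in>U. \<forall>\<^sub>F (\<xi>', \<eta>) in uniformity. \<xi>' = \<xi> \<longrightarrow> \<eta> \<in> U)"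

instance
proof
  fix \<xi> \<eta> \<zeta> :: "'a L2" and r :: real and c :: complex
  show add: "cinner (\<xi> + \<eta>) \<zeta> = cinner \<xi> \<zeta> + cinner \<eta> \<zeta>"
    by transfer (simp add: L2_rel_def sq_integrable_mult_cnj distrib_right)
  show sc: "cinner (c *\<^sub>C \<xi>) \<eta> = c * cinner \<xi> \<eta>" for c
    by transfer (simp add: mult.assoc)
  show comm: "cinner \<xi> \<eta> = cnj (cinner \<eta> \<xi>)"
    by transfer (simp add: Bochner_Integration.integral_cnj[symmetric] mult.commute del: Bochner_Integration.integral_cnj)
  show "inner \<xi> \<eta> = Re (cinner \<xi> \<eta>)" by (rule inner_L2_def)
  show "inner \<xi> \<eta> = inner \<eta> \<xi>" unfolding inner_L2_def by (subst comm) simp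
  show "inner (\<xi> + \<eta>) \<zeta> = inner \<xi> \<zeta> + inner \<eta> \<zeta>" by (simp add: inner_L2_def add)
  show "inner (r *\<^sub>R \<xi>) \<eta> = r * inner \<xi> \<eta>" by (simp add: inner_L2_def sc scaleR_scaleC)
  have *: "Re (LINT x|msr. f x * cnj (f x)) = (LINT x|msr. (cmod (f x))\<^sup>2)" for f :: "'a \<Rightarrow> complex"
    by (simp add: complex_norm_square[symmetric] del: of_real_power)
  show "0 \<le> inner \<xi> \<xi>" unfolding inner_L2_def
    by transfer (simp add: *)
  show "inner \<xi> \<xi> = 0 \<longleftrightarrow> \<xi> = 0" unfolding inner_L2_def
    by transfer (simp add: * L2_rel_def sq_integrable_0, simp add: sq_integrable_def integral_nonneg_eq_0_iff_AE)
  show "norm \<xi> = sqrt (inner \<xi> \<xi>)" by (rule norm_L2_def)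
  show "dist \<xi> \<eta> = norm (\<xi> - \<eta>)" by (rule dist_L2_def)
  show "sgn \<xi> = \<xi> /\<^sub>R norm \<xi>" by (rule sgn_L2_def)
  show "(uniformity :: ('a L2 \<times> 'a L2) filter) = (INF e\<in>{0<..}. principal {(\<xi>, \<eta>). dist \<xi> \<eta> < e})"
    by (rule uniformity_L2_def)
  show "open U \<longleftrightarrow> (\<forall>\<xi>\<in>U. \<forall>\<^sub>F (\<xi>', \<eta>) in uniformity. \<xi>' = \<xi> \<longrightarrow> \<eta> \<in> U)" for U :: "'a L2 set"
    by (rule open_L2_def)
qed

end

lemma norm_L2_sq: "(norm \<xi>)\<^sup>2 = (LINT x|msr. (cmod (rep_L2 \<xi> x))\<^sup>2)"
proof -
  have "complex_of_real ((norm \<xi>)\<^sup>2) = (LINT x|msr. complex_of_real ((cmod (rep_L2 \<xi> x))\<^sup>2))"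
    unfolding cinner_self[symmetric] cinner_L2.rep_eq complex_norm_square ..
  thus ?thesis unfolding integral_complex_of_real of_real_eq_iff .
qed

lemma nn_norm_L2: "(\<integral>\<^sup>+x. ennreal ((cmod (rep_L2 \<xi> x))\<^sup>2) \<partial>msr) = ennreal ((norm \<xi>)\<^sup>2)"
  unfolding norm_L2_sq using sq_integrable_rep[of \<xi>]
  by (intro nn_integral_eq_integral) (auto simp: sq_integrable_def)

lemma rep_add_L2: "AE x in msr. rep_L2 (\<xi> + \<eta>) x = rep_L2 \<xi> x + rep_L2 \<eta> x"
proof -
  have "\<xi> + \<eta> = abs_L2 (\<lambda>x. rep_L2 \<xi> x + rep_L2 \<eta> x)"
    using plus_L2.abs_eq[OF L2_rel_rep L2_rel_rep] by (simp add: Quotient3_abs_rep[OF Quotient3_L2])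
  thus ?thesis using rep_abs_L2[OF sq_integrable_add[OF sq_integrable_rep sq_integrable_rep]] by simp
qed

lemma rep_diff_L2: "AE x in msr. rep_L2 (\<xi> - \<eta>) x = rep_L2 \<xi> x - rep_L2 \<eta> x"
  using rep_add_L2[of "\<xi> - \<eta>" \<eta>] by eventually_elim simp

lemma rep_0_L2: "AE x in msr. rep_L2 0 x = 0"
  unfolding zero_L2_def by (rule rep_abs_L2[OF sq_integrable_0])

lemma L2_abs_exists:
  "\<exists>\<eta>. norm \<eta> = norm \<xi> \<and> (AE x in msr. rep_L2 \<eta> x = of_real (cmod (rep_L2 \<xi> x)))"
proof -
  let ?f = "\<lambda>x. complex_of_real (cmod (rep_L2 \<xi> x))"
  have [measurable]: "rep_L2 \<xi> \<in> borel_measurable msr"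
    using sq_integrable_rep[of \<xi>] by (simp add: sq_integrable_def)
  have "?f \<in> borel_measurable msr" by measurable
  hence f: "sq_integrable ?f"
    using sq_integrable_rep[of \<xi>] by (simp add: sq_integrable_def)
  have ae: "AE x in msr. rep_L2 (abs_L2 ?f) x = ?f x" by (rule rep_abs_L2[OF f])
  from ae have "AE x in msr. (cmod (rep_L2 (abs_L2 ?f) x))\<^sup>2 = (cmod (rep_L2 \<xi> x))\<^sup>2"
    by eventually_elim simp
  hence "(norm (abs_L2 ?f))\<^sup>2 = (norm \<xi>)\<^sup>2"
    unfolding norm_L2_sq using sq_integrable_rep[of \<xi>] sq_integrable_rep[of "abs_L2 ?f"]
    by (intro integral_cong_AE borel_measurable_integrable) (simp_all only: sq_integrable_def)
  hence "norm (abs_L2 ?f) = norm \<xi>" by simp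
  with ae show ?thesis by blast
qed

instance L2 :: (measured) chilbert_space
proof
  fix X :: "nat \<Rightarrow> 'a L2"
  assume X: "Cauchy X"
  have "\<exists>N. \<forall>m\<ge>N. \<forall>n\<ge>N. dist (X m) (X n) < (1/2) ^ k" for k
    using X by (auto simp: Cauchy_def)
  then obtain N where N: "\<And>k m n. N k \<le> m \<Longrightarrow> N k \<le> n \<Longrightarrow> dist (X m) (X n) < (1/2) ^ k" by metis
  define r where "r = rec_nat (N 0) (\<lambda>k v. max (Suc v) (N (Suc k)))"
  have rS: "r (Suc k) = max (Suc (r k)) (N (Suc k))" and r0: "r 0 = N 0" for k by (simp_all add: r_def)
  have r: "strict_mono r" by (rule strict_monoI_Suc) (simp add: rS)
  have rN: "N k \<le> r k" for k by (cases k) (simp_all add: rS r0)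
  define Y where "Y k = X (r k)" for k
  have Ydist: "norm (Y m - Y k) < (1/2) ^ k" if "k \<le> m" for k m
    unfolding Y_def dist_norm[symmetric]
    using N[of k "r m" "r k"] rN[of k] strict_mono_leD[OF r that] by linarith
  define f where "f k = rep_L2 (Y k)" for k
  have fm [measurable]: "f k \<in> borel_measurable msr" for k
    using sq_integrable_rep[of "Y k"] by (simp add: f_def sq_integrable_def)
  have "\<forall>k. \<exists>\<eta>. norm \<eta> = norm (Y (Suc k) - Y k) \<and>
      (AE x in msr. rep_L2 \<eta> x = of_real (cmod (rep_L2 (Y (Suc k) - Y k) x)))"
    using L2_abs_exists by blast
  then obtain d where d: "\<And>k. norm (d k) = norm (Y (Suc k) - Y k)"
    "\<And>k. AE x in msr. rep_L2 (d k) x = of_real (cmod (rep_L2 (Y (Suc k) - Y k) x))" by metis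
  have d': "AE x in msr. rep_L2 (d k) x = of_real (cmod (f (Suc k) x - f k x))" for k
    using d(2)[of k] rep_diff_L2[of "Y (Suc k)" "Y k"] by eventually_elim (simp add: f_def)
  define g where "g n x = (\<Sum>k<n. cmod (f (Suc k) x - f k x))" for n x
  have gm [measurable]: "g n \<in> borel_measurable msr" for n unfolding g_def by measurable
  have S: "AE x in msr. rep_L2 (\<Sum>k<n. d k) x = of_real (g n x)" for n
  proof (induction n)
    case 0 show ?case using rep_0_L2 by (simp add: g_def)
  next
    case (Suc n)
    show ?case using Suc d'[of n] rep_add_L2[of "\<Sum>k<n. d k" "d n"]
      by eventually_elim (simp add: g_def)
  qed
  have gint: "(\<integral>\<^sup>+x. ennreal ((g n x)\<^sup>2) \<partial>msr) \<le> 4" for n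
  proof -
    have "norm (\<Sum>k<n. d k) \<le> (\<Sum>k<n. (1/2) ^ k)"
      using d(1) Ydist by (intro order_trans[OF norm_sum] sum_mono) (simp add: less_imp_le)
    also have "\<dots> \<le> (\<Sum>k. (1/2::real) ^ k)" by (rule sum_le_suminf) (simp_all add: summable_geometric)
    also have "\<dots> = 2" by (simp add: suminf_geometric)
    finally have "(norm (\<Sum>k<n. d k))\<^sup>2 \<le> 2\<^sup>2" by (rule power_mono) simp
    moreover have "(\<integral>\<^sup>+x. ennreal ((g n x)\<^sup>2) \<partial>msr) = ennreal ((norm (\<Sum>k<n. d k))\<^sup>2)"
      unfolding nn_norm_L2[symmetric]
      by (rule nn_integral_cong_AE) (use S[of n] in \<open>eventually_elim, simp\<close>)
    moreover have "ennreal (2\<^sup>2) = 4" by simp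
    ultimately show ?thesis by (metis ennreal_leI)
  qed
  have inc: "incseq (\<lambda>n x. ennreal ((g n x)\<^sup>2))"
    by (intro incseq_SucI le_funI ennreal_leI power_mono) (auto simp: g_def sum_nonneg)
  have "(\<integral>\<^sup>+x. (SUP n. ennreal ((g n x)\<^sup>2)) \<partial>msr) = (SUP n. \<integral>\<^sup>+x. ennreal ((g n x)\<^sup>2) \<partial>msr)"
    by (rule nn_integral_monotone_convergence_SUP[OF inc]) measurable
  also have "\<dots> \<le> 4" by (rule SUP_least) (rule gint)
  finally have "(\<integral>\<^sup>+x. (SUP n. ennreal ((g n x)\<^sup>2)) \<partial>msr) \<noteq> \<infinity>"
    using ennreal_numeral_less_top[of "num.Bit0 (num.Bit0 num.One)"] by (auto simp: top_unique)
  hence "AE x in msr. (SUP n. ennreal ((g n x)\<^sup>2)) \<noteq> \<infinity>"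
    by (intro nn_integral_noteq_infinite) measurable
  hence conv: "AE x in msr. convergent (\<lambda>k. f k x)"
  proof eventually_elim
    fix x assume "(SUP n. ennreal ((g n x)\<^sup>2)) \<noteq> \<infinity>"
    then obtain C where C: "(SUP n. ennreal ((g n x)\<^sup>2)) = ennreal C" "C \<ge> 0"
      by (cases "SUP n. ennreal ((g n x)\<^sup>2)") auto
    have "(g n x)\<^sup>2 \<le> C" for n
      using SUP_upper[of n UNIV "\<lambda>n. ennreal ((g n x)\<^sup>2)"] C by (simp add: ennreal_le_iff)
    hence "g n x \<le> sqrt C" for n by (rule real_le_rsqrt)
    hence "summable (\<lambda>k. cmod (f (Suc k) x - f k x))"
      by (intro summableI_nonneg_bounded[where x="sqrt C"]) (auto simp: g_def)
    hence "summable (\<lambda>k. f (Suc k) x - f k x)" by (rule summable_norm_cancel)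
    hence "convergent (\<lambda>n. f 0 x + (\<Sum>k<n. f (Suc k) x - f k x))"
      by (intro convergent_add convergent_const) (simp add: summable_iff_convergent)
    thus "convergent (\<lambda>k. f k x)" by (simp add: sum_lessThan_telescope[of "\<lambda>k. f k x"])
  qed
  define F where "F x = lim (\<lambda>k. f k x)" for x
  have Fm [measurable]: "F \<in> borel_measurable msr" unfolding F_def by measurable
  have est: "(\<integral>\<^sup>+x. ennreal ((cmod (F x - f k x))\<^sup>2) \<partial>msr) \<le> ennreal (((1/2) ^ k)\<^sup>2)" for k
  proof -
    have "(\<integral>\<^sup>+x. ennreal ((cmod (F x - f k x))\<^sup>2) \<partial>msr) =
          (\<integral>\<^sup>+x. liminf (\<lambda>m. ennreal ((cmod (f m x - f k x))\<^sup>2)) \<partial>msr)"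
    proof (rule nn_integral_cong_AE)
      show "AE x in msr. ennreal ((cmod (F x - f k x))\<^sup>2) =
          liminf (\<lambda>m. ennreal ((cmod (f m x - f k x))\<^sup>2))"
        using conv
      proof eventually_elim
        fix x assume "convergent (\<lambda>k. f k x)"
        hence "(\<lambda>k. f k x) \<longlonglongrightarrow> F x" by (simp add: F_def convergent_LIMSEQ_iff)
        hence "(\<lambda>m. ennreal ((cmod (f m x - f k x))\<^sup>2)) \<longlonglongrightarrow> ennreal ((cmod (F x - f k x))\<^sup>2)"
          by (intro tendsto_intros tendsto_ennrealI)
        from lim_imp_Liminf[OF _ this]
        show "ennreal ((cmod (F x - f k x))\<^sup>2) = liminf (\<lambda>m. ennreal ((cmod (f m x - f k x))\<^sup>2))" by simp
      qed
    qed
    also have "\<dots> \<le> liminf (\<lambda>m. \<integral>\<^sup>+x. ennreal ((cmod (f m x - f k x))\<^sup>2) \<partial>msr)"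
      by (rule nn_integral_liminf) measurable
    also have "\<dots> = liminf (\<lambda>m. ennreal ((norm (Y m - Y k))\<^sup>2))"
    proof -
      have "(\<integral>\<^sup>+x. ennreal ((cmod (f m x - f k x))\<^sup>2) \<partial>msr) = ennreal ((norm (Y m - Y k))\<^sup>2)" for m
        unfolding nn_norm_L2[symmetric] f_def
        by (rule nn_integral_cong_AE) (use rep_diff_L2[of "Y m" "Y k"] in \<open>eventually_elim, simp\<close>)
      thus ?thesis by simp
    qed
    also have "\<dots> \<le> ennreal (((1/2) ^ k)\<^sup>2)"
    proof (rule Liminf_le)
      show "\<forall>\<^sub>F m in sequentially. ennreal ((norm (Y m - Y k))\<^sup>2) \<le> ennreal (((1/2) ^ k)\<^sup>2)"
        using eventually_ge_at_top[of k]
        by eventually_elim (intro ennreal_leI power_mono less_imp_le[OF Ydist], auto)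
    qed simp
    finally show ?thesis .
  qed
  have sqd: "sq_integrable (\<lambda>x. F x - f k x)" for k
    unfolding sq_integrable_def
  proof (intro conjI integrableI_bounded)
    show "(\<integral>\<^sup>+x. ennreal (norm ((cmod (F x - f k x))\<^sup>2)) \<partial>msr) < \<infinity>"
      using est[of k] by (simp add: order_le_less_trans[OF _ ennreal_less_top])
  qed measurable
  have "sq_integrable (\<lambda>x. (F x - f 0 x) + f 0 x)"
    by (intro sq_integrable_add sqd) (simp add: f_def sq_integrable_rep)
  hence sqF: "sq_integrable F" by simp
  have "norm (Y k - abs_L2 F) \<le> (1/2) ^ k" for k
  proof -
    have "ennreal ((norm (abs_L2 F - Y k))\<^sup>2) = (\<integral>\<^sup>+x. ennreal ((cmod (F x - f k x))\<^sup>2) \<partial>msr)"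
      unfolding nn_norm_L2[symmetric]
    proof (rule nn_integral_cong_AE)
      show "AE x in msr. ennreal ((cmod (rep_L2 (abs_L2 F - Y k) x))\<^sup>2) = ennreal ((cmod (F x - f k x))\<^sup>2)"
        using rep_abs_L2[OF sqF] rep_diff_L2[of "abs_L2 F" "Y k"]
        by eventually_elim (simp add: f_def)
    qed
    hence "(norm (abs_L2 F - Y k))\<^sup>2 \<le> ((1/2) ^ k)\<^sup>2"
      using est[of k] by (metis ennreal_le_iff zero_le_power2)
    hence "norm (abs_L2 F - Y k) \<le> (1/2) ^ k" by (rule power2_le_imp_le) simp
    thus ?thesis by (simp add: norm_minus_commute)
  qed
  hence "(\<lambda>k. Y k - abs_L2 F) \<longlonglongrightarrow> 0"
    by (intro Lim_null_comparison[OF _ LIMSEQ_power_zero[of "1/2::real"]]) auto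
  hence "(X \<circ> r) \<longlonglongrightarrow> abs_L2 F" by (simp add: LIM_zero_iff Y_def comp_def)
  hence "X \<longlonglongrightarrow> abs_L2 F" using Cauchy_converges_subseq[OF X r] by blast
  thus "convergent X" by (auto simp: convergent_def)
qed


section \<open>Nuclearity\<close>

instantiation nat :: measured
begin
definition msr_nat :: "nat measure" where "msr_nat = count_space UNIV"
instance ..
end

text \<open>The matrix algebra \<open>M\<^sub>n(\<complex>)\<close> with its operator norm, realised as the corner of the bounded
  operators on \<open>\<ell>\<^sup>2(\<nat>)\<close> that is cut out by the first \<open>n\<close> coordinates. This makes \<open>n\<close> an ordinary
  variable and not a type. For counting measure \<^term>\<open>rep_L2 \<xi>\<close> is the only representative
  of \<open>\<xi>\<close>.\<close>

definition matrix_algebra :: "nat \<Rightarrow> nat L2 bop set" where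
  "matrix_algebra n = {T. \<forall>\<xi>. (\<forall>i\<ge>n. rep_L2 (bop_apply T \<xi>) i = 0) \<and>
                           ((\<forall>i<n. rep_L2 \<xi> i = 0) \<longrightarrow> bop_apply T \<xi> = 0)}"

text \<open>In the following definitions \<open>A\<close> and \<open>B\<close> are \<open>C\<^sup>*\<close>-algebras, given as norm-closed
  \<open>*\<close>-subalgebras of a type of class \<^class>\<open>cstar_algebra\<close>; maps and relations are only looked at
  on these sets.

  A linear map is completely positive if all its amplifications to matrices over \<open>A\<close> preserve
  positivity. The positive elements of the \<open>C\<^sup>*\<close>-algebra \<open>M\<^sub>k(A)\<close> are those of the form \<open>x\<^sup>* x\<close>, and
  \<open>\<Sum>l<k. star (x l i) * x l j\<close> is the \<open>(i, j)\<close> entry of \<open>x\<^sup>* x\<close>.\<close>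

definition completely_positive ::
    "'a::cstar_algebra set \<Rightarrow> 'b::cstar_algebra set \<Rightarrow> ('a \<Rightarrow> 'b) \<Rightarrow> bool" where
  "completely_positive A B \<phi> \<longleftrightarrow> \<phi> ` A \<subseteq> B \<and> complex_linear_on A \<phi> \<and>
     (\<forall>k::nat. \<forall>x. (\<forall>i<k. \<forall>j<k. x i j \<in> A) \<longrightarrow>
        (\<exists>y. (\<forall>i<k. \<forall>j<k. y i j \<in> B) \<and>
             (\<forall>i<k. \<forall>j<k. \<phi> (\<Sum>l<k. star (x l i) * x l j) = (\<Sum>l<k. star (y l i) * y l j))))"

definition contractive_on :: "'a::cstar_algebra set \<Rightarrow> ('a \<Rightarrow> 'b::cstar_algebra) \<Rightarrow> bool" where
  "contractive_on A \<phi> \<longleftrightarrow> (\<forall>a\<in>A. norm (\<phi> a) \<le> norm a)"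

text \<open>The identity of \<open>A\<close> is a limit, in the topology of pointwise norm convergence, of
  contractive completely positive maps that factor through matrix algebras.\<close>

definition nuclear :: "'a::cstar_algebra set \<Rightarrow> bool" where
  "nuclear A \<longleftrightarrow> (\<forall>F \<epsilon>. finite F \<longrightarrow> F \<subseteq> A \<longrightarrow> 0 < \<epsilon> \<longrightarrow>
     (\<exists>n \<phi> \<psi>. completely_positive A (matrix_algebra n) \<phi> \<and> contractive_on A \<phi> \<and>
        completely_positive (matrix_algebra n) A \<psi> \<and> contractive_on (matrix_algebra n) \<psi> \<and>
        (\<forall>a\<in>F. norm (\<psi> (\<phi> a) - a) < \<epsilon>)))"


section \<open>Multipliers and the strict topology\<close>

text \<open>\<open>M(A)\<close> is the algebra of double centralizers of \<open>A\<close>: the multiplier \<open>x\<close> is the pair of the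
  maps \<open>a \<mapsto> x a\<close> and \<open>a \<mapsto> a x\<close>. Linearity and boundedness follow from the identity
  \<open>a (x b) = (a x) b\<close>. The maps are taken to be \<^const>\<open>undefined\<close> outside \<open>A\<close>, so that a multiplier
  is determined by its values on \<open>A\<close>.\<close>

definition multipliers :: "'a::cstar_algebra set \<Rightarrow> (('a \<Rightarrow> 'a) \<times> ('a \<Rightarrow> 'a)) set" where
  "multipliers A = {(l, r). l \<in> A \<rightarrow>\<^sub>E A \<and> r \<in> A \<rightarrow>\<^sub>E A \<and> (\<forall>a\<in>A. \<forall>b\<in>A. a * l b = r a * b)}"

definition strict_topology :: "'a::cstar_algebra set \<Rightarrow> (('a \<Rightarrow> 'a) \<times> ('a \<Rightarrow> 'a)) topology" where
  "strict_topology A = topology_generated_by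
     ({{x \<in> multipliers A. fst x a \<in> U} | a U. a \<in> A \<and> open U} \<union>
      {{x \<in> multipliers A. snd x a \<in> U} | a U. a \<in> A \<and> open U})"


section \<open>Hilbert bimodules and strong Property (T)\<close>

definition star_representation ::
    "'a::cstar_algebra set \<Rightarrow> ('a \<Rightarrow> 'h::chilbert_space bop) \<Rightarrow> bool" where
  "star_representation A \<pi> \<longleftrightarrow> complex_linear_on A \<pi> \<and>
     (\<forall>a\<in>A. \<forall>b\<in>A. \<pi> (a * b) = \<pi> a * \<pi> b) \<and> (\<forall>a\<in>A. \<pi> (star a) = star (\<pi> a))"

definition star_antirepresentation ::
    "'a::cstar_algebra set \<Rightarrow> ('a \<Rightarrow> 'h::chilbert_space bop) \<Rightarrow> bool" where
  "star_antirepresentation A \<rho> \<longleftrightarrow> complex_linear_on A \<rho> \<and>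
     (\<forall>a\<in>A. \<forall>b\<in>A. \<rho> (a * b) = \<rho> b * \<rho> a) \<and> (\<forall>a\<in>A. \<rho> (star a) = star (\<rho> a))"

text \<open>The real span below is a complex subspace, because the spanning set is closed under
  complex scalars.\<close>

definition nondegenerate :: "'a set \<Rightarrow> ('a \<Rightarrow> 'h::chilbert_space bop) \<Rightarrow> bool" where
  "nondegenerate A \<pi> \<longleftrightarrow> closure (span {bop_apply (\<pi> a) \<xi> | a \<xi>. a \<in> A}) = UNIV"

text \<open>\<open>\<pi> a \<xi>\<close> stands for \<open>a \<cdot> \<xi>\<close> and \<open>\<rho> a \<xi>\<close> for \<open>\<xi> \<cdot> a\<close>.\<close>

definition hilbert_bimodule ::
    "'a::cstar_algebra set \<Rightarrow> ('a \<Rightarrow> 'h::chilbert_space bop) \<Rightarrow> ('a \<Rightarrow> 'h bop) \<Rightarrow> bool" where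
  "hilbert_bimodule A \<pi> \<rho> \<longleftrightarrow>
     star_representation A \<pi> \<and> nondegenerate A \<pi> \<and>
     star_antirepresentation A \<rho> \<and> nondegenerate A \<rho> \<and>
     (\<forall>a\<in>A. \<forall>b\<in>A. \<pi> a * \<rho> b = \<rho> b * \<pi> a)"

text \<open>The extensions of the two actions to a multiplier \<open>x\<close>. As the actions are non-degenerate,
  they are determined by \<open>x \<cdot> (a \<cdot> \<xi>) = (x a) \<cdot> \<xi>\<close> and \<open>(\<xi> \<cdot> a) \<cdot> x = \<xi> \<cdot> (a x)\<close>.\<close>

definition left_extension ::
    "'a::cstar_algebra set \<Rightarrow> ('a \<Rightarrow> 'h::chilbert_space bop) \<Rightarrow> ('a \<Rightarrow> 'a) \<times> ('a \<Rightarrow> 'a) \<Rightarrow> 'h bop" where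
  "left_extension A \<pi> x = (THE T. \<forall>a\<in>A. T * \<pi> a = \<pi> (fst x a))"

definition right_extension ::
    "'a::cstar_algebra set \<Rightarrow> ('a \<Rightarrow> 'h::chilbert_space bop) \<Rightarrow> ('a \<Rightarrow> 'a) \<times> ('a \<Rightarrow> 'a) \<Rightarrow> 'h bop" where
  "right_extension A \<rho> x = (THE T. \<forall>a\<in>A. T * \<rho> a = \<rho> (snd x a))"

text \<open>A net is a family indexed by a directed set; its limits are limits along the filter
  of tails.\<close>

definition directed_set :: "'i set \<Rightarrow> ('i \<Rightarrow> 'i \<Rightarrow> bool) \<Rightarrow> bool" where
  "directed_set I le \<longleftrightarrow> I \<noteq> {} \<and> (\<forall>i\<in>I. le i i) \<and>
     (\<forall>i\<in>I. \<forall>j\<in>I. \<forall>k\<in>I. le i j \<longrightarrow> le j k \<longrightarrow> le i k) \<and>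
     (\<forall>i\<in>I. \<forall>j\<in>I. \<exists>k\<in>I. le i k \<and> le j k)"

definition net_filter :: "'i set \<Rightarrow> ('i \<Rightarrow> 'i \<Rightarrow> bool) \<Rightarrow> 'i filter" where
  "net_filter I le = (INF i\<in>I. principal {j \<in> I. le i j})"

text \<open>The supremum is taken in \<^typ>\<open>ennreal\<close>, where it exists without any boundedness assumption
  and is \<open>0\<close> for the empty set.\<close>

definition almost_K_central ::
    "'a::cstar_algebra set \<Rightarrow> ('a \<Rightarrow> 'h::chilbert_space bop) \<Rightarrow> ('a \<Rightarrow> 'h bop) \<Rightarrow>
     'i set \<Rightarrow> ('i \<Rightarrow> 'i \<Rightarrow> bool) \<Rightarrow> ('i \<Rightarrow> 'h) \<Rightarrow> bool" where
  "almost_K_central A \<pi> \<rho> I le \<xi> \<longleftrightarrow>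
     (\<forall>L. compactin (strict_topology A) L \<longrightarrow>
        ((\<lambda>i. SUP x\<in>L. ennreal (norm (bop_apply (left_extension A \<pi> x) (\<xi> i)
                                  - bop_apply (right_extension A \<rho> x) (\<xi> i))))
          \<longlongrightarrow> 0) (net_filter I le))"

definition central_vectors ::
    "'a set \<Rightarrow> ('a \<Rightarrow> 'h::chilbert_space bop) \<Rightarrow> ('a \<Rightarrow> 'h bop) \<Rightarrow> 'h set" where
  "central_vectors A \<pi> \<rho> = {\<xi>. \<forall>a\<in>A. bop_apply (\<pi> a) \<xi> = bop_apply (\<rho> a) \<xi>}"

definition orthogonal_projection :: "'h::chilbert_space set \<Rightarrow> 'h \<Rightarrow> 'h" where
  "orthogonal_projection S \<xi> = (THE \<eta>. \<eta> \<in> S \<and> (\<forall>\<zeta>\<in>S. cinner (\<xi> - \<eta>) \<zeta> = 0))"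

text \<open>The type arguments are the types of the Hilbert spaces and of the index sets over which
  the definition quantifies; a statement about all bimodules and all nets leaves them
  arbitrary.\<close>

definition strong_property_T ::
    "'h::chilbert_space itself \<Rightarrow> 'i itself \<Rightarrow> 'a::cstar_algebra set \<Rightarrow> bool" where
  "strong_property_T _ _ A \<longleftrightarrow>
     (\<forall>(\<pi> :: 'a \<Rightarrow> 'h bop) \<rho>. hilbert_bimodule A \<pi> \<rho> \<longrightarrow>
        (\<forall>(I :: 'i set) le \<xi>. directed_set I le \<longrightarrow> (\<forall>i\<in>I. norm (\<xi> i) = 1) \<longrightarrow>
           almost_K_central A \<pi> \<rho> I le \<xi> \<longrightarrow>
           ((\<lambda>i. norm (\<xi> i - orthogonal_projection (central_vectors A \<pi> \<rho>) (\<xi> i)))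
             \<longlongrightarrow> 0) (net_filter I le)))"


section \<open>Locally compact groups\<close>

text \<open>A locally compact Hausdorff group together with a left Haar measure, that is, a nonzero
  left-invariant Radon measure. The group is written additively, as in
  \<^class>\<open>topological_group_add\<close>, but it is not assumed to be commutative.\<close>

class haar_group = measured + topological_group_add + t2_space +
  assumes locally_compact: "\<exists>U K. open U \<and> compact K \<and> x \<in> U \<and> U \<subseteq> K"
    and sets_msr_sigma: "sets msr = sigma_sets UNIV {U. open U}"
    and msr_left_invariant: "distr msr msr (\<lambda>t. s + t) = msr"
    and msr_nonzero: "emeasure msr UNIV \<noteq> 0"
    and msr_compact_finite: "compact K \<Longrightarrow> emeasure msr K < \<infinity>"
    and msr_outer_regular: "B \<in> sets msr \<Longrightarrow>
          emeasure msr B = (INF U\<in>{U. open U \<and> B \<subseteq> U}. emeasure msr U)"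
    and msr_inner_regular: "open U \<Longrightarrow>
          emeasure msr U = (SUP K\<in>{K. compact K \<and> K \<subseteq> U}. emeasure msr K)"

lemma sets_msr: "sets (msr :: 'g::haar_group measure) = sets borel"
  by (simp add: sets_msr_sigma borel_def)

lemma measurable_translate: "(\<lambda>t::'g::haar_group. s + t) \<in> borel \<rightarrow>\<^sub>M borel"
  by (intro borel_measurable_continuous_onI continuous_on_add continuous_on_const continuous_on_id)

lemma measurable_translate_msr: "(\<lambda>t. s + t) \<in> (msr :: 'g::haar_group measure) \<rightarrow>\<^sub>M msr"
  using measurable_translate by (simp add: measurable_cong_sets[OF sets_msr sets_msr])

lemma sq_integrable_translate:
  fixes f :: "'g::haar_group \<Rightarrow> complex"
  assumes "sq_integrable f" shows "sq_integrable (\<lambda>t. f (s + t))"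
proof -
  have f: "f \<in> borel_measurable msr" using assms by (simp add: sq_integrable_def)
  have "integrable (distr msr msr (\<lambda>t. s + t)) (\<lambda>t. (cmod (f t))\<^sup>2)"
    using assms by (simp add: msr_left_invariant sq_integrable_def)
  hence "integrable msr (\<lambda>t. (cmod (f (s + t)))\<^sup>2)"
    by (rule integrable_distr[OF measurable_translate_msr])
  moreover have "(\<lambda>t. f (s + t)) \<in> borel_measurable msr"
    by (rule measurable_compose[OF measurable_translate_msr f])
  ultimately show ?thesis by (simp add: sq_integrable_def)
qed

lemma AE_translate:
  fixes s :: "'g::haar_group"
  assumes "AE t in msr. P t" shows "AE t in msr. P (s + t)"
proof -
  have "AE t in distr msr msr (\<lambda>t. s + t). P t"
    using assms by (subst msr_left_invariant)
  thus ?thesis by (rule AE_distrD[OF measurable_translate_msr])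
qed

text \<open>Left translation \<open>(\<lambda>\<^sub>s \<xi>)(t) = \<xi>(s\<^sup>-\<^sup>1 t)\<close>.\<close>

lift_definition left_regular :: "'g::haar_group \<Rightarrow> 'g L2 \<Rightarrow> 'g L2" is
  "\<lambda>s f t. f (- s + t)"
proof -
  fix s and f f' :: "'g \<Rightarrow> complex"
  assume "L2_rel f f'"
  thus "L2_rel (\<lambda>t. f (- s + t)) (\<lambda>t. f' (- s + t))"
    using AE_translate[of "\<lambda>t. f t = f' t" "- s"] by (simp add: L2_rel_def sq_integrable_translate)
qed

text \<open>The reduced group \<open>C\<^sup>*\<close>-algebra is the norm closure of \<open>\<lambda>(L\<^sup>1(G))\<close>, where the operator
  \<open>\<lambda>(f) = \<integral> f(s) \<lambda>\<^sub>s ds\<close> (convolution by \<open>f\<close>) is given as a weak integral.\<close>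

definition reduced_group_cstar :: "'g::haar_group L2 bop set" where
  "reduced_group_cstar = closure
     {T. \<exists>f. integrable msr f \<and>
          (\<forall>\<xi> \<eta>. cinner (bop_apply T \<xi>) \<eta> = (LINT s|msr. f s * cinner (left_regular s \<xi>) \<eta>))}"

text \<open>Amenability is the existence of a left-invariant mean on \<open>L\<^sup>\<infinity>(G)\<close>. When \<open>G\<close> is not
  \<open>\<sigma>\<close>-compact, \<open>L\<^sup>\<infinity>(G)\<close> has to be formed modulo locally null sets. The norm bound
  expresses \<open>\<parallel>m\<parallel> \<le> 1\<close>, and it makes \<open>m\<close> well defined on classes of functions.\<close>

definition locally_AE :: "('g::haar_group \<Rightarrow> bool) \<Rightarrow> bool" where
  "locally_AE P \<longleftrightarrow> (\<forall>K. compact K \<longrightarrow> (AE x in msr. x \<in> K \<longrightarrow> P x))"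

definition Linf :: "('g::haar_group \<Rightarrow> complex) set" where
  "Linf = {f \<in> borel_measurable msr. \<exists>C. locally_AE (\<lambda>x. cmod (f x) \<le> C)}"

definition left_invariant_mean :: "(('g::haar_group \<Rightarrow> complex) \<Rightarrow> complex) \<Rightarrow> bool" where
  "left_invariant_mean m \<longleftrightarrow>
     (\<forall>f\<in>Linf. \<forall>g\<in>Linf. m (\<lambda>x. f x + g x) = m f + m g) \<and>
     (\<forall>c. \<forall>f\<in>Linf. m (\<lambda>x. c * f x) = c * m f) \<and>
     (\<forall>f\<in>Linf. \<forall>C. locally_AE (\<lambda>x. cmod (f x) \<le> C) \<longrightarrow> cmod (m f) \<le> C) \<and>
     m (\<lambda>_. 1) = 1 \<and>
     (\<forall>f\<in>Linf. \<forall>s. m (\<lambda>x. f (s + x)) = m f)"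

definition amenable :: "'g::haar_group itself \<Rightarrow> bool" where
  "amenable _ \<longleftrightarrow> (\<exists>m :: ('g \<Rightarrow> complex) \<Rightarrow> complex. left_invariant_mean m)"

end

theory Submission
  imports Defs
begin

text \<open>There are no almost central nets of unit vectors at all. Only the multipliers \<open>\<lambda>\<^sub>s\<close> matter. They
  act on a bimodule \<open>H\<close> from the left and from the right by isometries \<open>L\<^sub>s\<close> and \<open>V\<^sub>s\<close>. Unless \<open>G\<close> is
  amenable, there are a finite \<open>F \<subseteq> G\<close> and \<open>\<delta> > 0\<close> such that
  \<open>\<Sum>s\<in>F. \<parallel>(\<lambda>\<^sub>s \<otimes> 1) v - (1 \<otimes> V\<^sub>s) v\<parallel>\<^sup>2 \<ge> \<delta> \<parallel>v\<parallel>\<^sup>2\<close> on \<open>L\<^sup>2(G) \<otimes> H\<close>, because otherwise the densities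
  \<open>x \<mapsto> \<parallel>v(x)\<parallel>\<^sup>2\<close> would cluster at an invariant mean. Nuclearity preserves this positivity when
  \<open>\<lambda>\<close> is replaced by the left action on \<open>H\<close>, so that \<open>\<Sum>s\<in>F. \<parallel>L\<^sub>s \<xi> - V\<^sub>s \<xi>\<parallel>\<^sup>2 \<ge> \<delta> \<parallel>\<xi>\<parallel>\<^sup>2\<close> on \<open>H\<close>.\<close>

section \<open>Bounded operators and contractivity of representations\<close>

text \<open>On \<open>L^2(G) \<otimes> H\<close> the algebra acts through its defining
  representation, so inequalities there concern the smallest tensor norm; on \<open>H\<close> two
  commuting actions are a priori controlled by the largest one only. Nuclearity bridges the two.
  Expanded, the inequality says that \<open>2|F| - \<delta> - \<Sum>s. (\<lambda>_s \<otimes> V_s^*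
  + \<lambda>_s^* \<otimes> V_s)\<close> is positive. The obstacle is that
  \<open>\<lambda>_s\<close> is in general only a multiplier, while the approximating maps are
  defined on the algebra alone. Hence \<open>\<lambda>_s\<close> is compressed to
  \<open>c^* \<lambda>_s c\<close> with \<open>c\<close> in the algebra. This yields the inequality
  at the vectors \<open>\<pi> c v\<close>, which approximate every \<open>v\<close>. The mean
  becomes invariant because \<open>1 \<otimes> V_s\<close> keeps the density of a vector,
  \<open>V_s\<close> being isometric, while \<open>\<lambda>_s \<otimes> 1\<close> translates it:
  closeness of the two images is almost invariance of the density. No Hilbert space tensor product
  is constructed. Finite sums \<open>\<Sum>j. w_j \<otimes> v_j\<close> with their Gram form stand
  for its vectors, and positivity is tested on them.\<close>

notation bop_apply (infixl "$$" 100)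

lemma bop_add: "T $$ (x + y) = T $$ x + T $$ y"
  by (simp add: bounded_linear.linear[OF bounded_linear_bop] linear_add)

lemma bop_diff: "T $$ (x - y) = T $$ x - T $$ y"
  by (simp add: bounded_linear.linear[OF bounded_linear_bop] linear_diff)

lemma bop_minus: "T $$ (- x) = - T $$ x"
  by (simp add: bounded_linear.linear[OF bounded_linear_bop] linear_neg)

lemma bop_zero: "T $$ 0 = 0"
  by (simp add: bounded_linear.linear[OF bounded_linear_bop] linear_0)

lemma bop_scaleR: "T $$ (r *\<^sub>R x) = r *\<^sub>R T $$ x"
  by (simp add: bounded_linear.linear[OF bounded_linear_bop] linear_scale)

lemma bop_scaleC: "T $$ (c *\<^sub>C x) = c *\<^sub>C T $$ x"
  using bounded_clinear_bop[of T] by (simp add: bounded_clinear_def)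

lemma bop_sum: "T $$ sum f I = (\<Sum>i\<in>I. T $$ f i)"
  by (simp add: bounded_linear.linear[OF bounded_linear_bop] linear_sum)

lemma sum_bop_apply: "sum f I $$ x = (\<Sum>i\<in>I. f i $$ x)"
  by (induction I rule: infinite_finite_induct) (simp_all add: zero_bop.rep_eq plus_bop.rep_eq)

lemmas bop_simps = bop_add bop_diff bop_zero bop_scaleR bop_scaleC bop_sum sum_bop_apply
  zero_bop.rep_eq plus_bop.rep_eq minus_bop.rep_eq uminus_bop.rep_eq scaleC_bop.rep_eq
  scaleR_bop.rep_eq times_bop.rep_eq

lemma cinner_zero_left: "cinner 0 (x::'a::complex_inner) = 0"
  using cinner_add_left[of 0 0 x] by simp

lemma cinner_zero_right: "cinner (x::'a::complex_inner) 0 = 0"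
  using cinner_add_right[of x 0 0] by simp

lemma cinner_diff_left: "cinner (x - y) z = cinner x z - cinner y (z::'a::complex_inner)"
  using cinner_add_left[of "x - y" y z] by simp

lemma cinner_diff_right: "cinner z (x - y) = cinner z x - cinner (z::'a::complex_inner) y"
  using cinner_add_right[of z "x - y" y] by simp

lemma cinner_minus_left: "cinner (- x) z = - cinner x (z::'a::complex_inner)"
  using cinner_diff_left[of 0 x z] by (simp add: cinner_zero_left)

lemma cinner_minus_right: "cinner z (- x) = - cinner (z::'a::complex_inner) x"
  using cinner_diff_right[of z 0 x] by (simp add: cinner_zero_right)

lemma cinner_sum_left: "cinner (sum f I) (z::'a::complex_inner) = (\<Sum>i\<in>I. cinner (f i) z)"
  by (induction I rule: infinite_finite_induct) (simp_all add: cinner_zero_left cinner_add_left)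

lemma cinner_sum_right: "cinner (z::'a::complex_inner) (sum f I) = (\<Sum>i\<in>I. cinner z (f i))"
  by (induction I rule: infinite_finite_induct) (simp_all add: cinner_zero_right cinner_add_right)

lemmas cinner_simps = cinner_zero_left cinner_zero_right cinner_add_left cinner_add_right
  cinner_diff_left cinner_diff_right cinner_minus_left cinner_minus_right cinner_sum_left
  cinner_sum_right cinner_scaleC_left cinner_scaleC_right cinner_scaleR_left cinner_scaleR_right

lemma norm_bop_le_form:
  assumes "0 \<le> K" and "\<And>v w. cmod (cinner (T $$ v) w) \<le> K * norm v * norm w"
  shows "norm T \<le> K"
proof (rule norm_bop_bound[OF assms(1)])
  fix x
  have "(norm (T $$ x))\<^sup>2 \<le> K * norm x * norm (T $$ x)"
    using assms(2)[of x "T $$ x"] by (simp add: cinner_self norm_power)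
  thus "norm (T $$ x) \<le> K * norm x"
    by (cases "T $$ x = 0") (simp_all add: power2_eq_square assms(1))
qed

lemma cmod_form_le: "cmod (cinner (T $$ v) w) \<le> norm T * norm v * norm w"
  by (rule order_trans[OF cinner_Cauchy_Schwarz]) (simp add: mult_right_mono norm_bop_apply)

lemma bop_form_eqI:
  assumes "\<And>v w. cinner (S $$ v) w = cinner (T $$ v) w"
  shows "S = T"
  by (rule bop_eqI, rule cinner_ext) (rule assms)

text \<open>Riesz represents \<open>B v w\<close> as \<open>cinner v (S w)\<close>, and the operator
  sought is the adjoint of \<open>S\<close>. This is the source of the weak integrals of
  operators.\<close>

lemma bop_of_form_exists:
  fixes B :: "'a::chilbert_space \<Rightarrow> 'a \<Rightarrow> complex"
  assumes add_left: "\<And>v v' w. B (v + v') w = B v w + B v' w"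
    and scale_left: "\<And>c v w. B (c *\<^sub>C v) w = c * B v w"
    and add_right: "\<And>v w w'. B v (w + w') = B v w + B v w'"
    and scale_right: "\<And>c v w. B v (c *\<^sub>C w) = cnj c * B v w"
    and bound: "\<And>v w. cmod (B v w) \<le> K * norm v * norm w"
    and K: "0 \<le> K"
  shows "\<exists>T. \<forall>v w. cinner (T $$ v) w = B v w"
proof -
  have "\<exists>y. \<forall>v. B v w = cinner v y" for w
  proof (rule riesz_complex)
    show "bounded_linear (\<lambda>v. B v w)"
      by (rule bounded_linear_intro[where K="K * norm w"])
         (use bound[of _ w] in \<open>simp_all add: add_left scaleR_scaleC[where 'a='a] scale_left scaleR_conv_of_real mult_ac\<close>)
    show "B (c *\<^sub>C x) w = c * B x w" for c x by (rule scale_left)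
  qed
  then obtain S where S: "\<And>v w. B v w = cinner v (S w)" by metis
  have S': "cinner (S w) v = cnj (B v w)" for v w by (metis S cinner_commute)
  have "bounded_clinear S"
  proof (rule bounded_clinearI[where K=K])
    show "S (x + y) = S x + S y" for x y
      by (rule cinner_ext) (simp add: S' cinner_add_left add_right)
    show "S (c *\<^sub>C x) = c *\<^sub>C S x" for c x
      by (rule cinner_ext) (simp add: S' cinner_scaleC_left scale_right)
    show "norm (S y) \<le> norm y * K" for y
    proof (cases "S y = 0")
      case False
      have "(norm (S y))\<^sup>2 = cmod (B (S y) y)" by (simp add: S cinner_self norm_power)
      also have "\<dots> \<le> K * norm (S y) * norm y" by (rule bound)
      finally have "norm (S y) * norm (S y) \<le> norm (S y) * (norm y * K)"
        by (simp add: power2_eq_square mult_ac)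
      thus ?thesis using False by simp
    qed (use K in simp)
  qed
  then obtain T where "bop_apply T = S" using Abs_bop_inverse by blast
  hence "cinner (star T $$ v) w = B v w" for v w by (simp add: cinner_star_bop' S)
  thus ?thesis by blast
qed

section \<open>The involution and norm-closed subalgebras\<close>

lemma norm_star: "norm (star x) = norm (x::'a::cstar_algebra)"
proof -
  have le: "norm y \<le> norm (star y)" for y :: 'a
    using norm_mult_ineq[of "star y" y] unfolding norm_star_mult_self power2_eq_square
    by (cases "y = 0") simp_all
  from le[of x] le[of "star x"] show ?thesis by (simp add: star_star)
qed

lemma star_zero: "star 0 = (0::'a::cstar_algebra)"
  using star_add[of 0 "0::'a"] by simp

lemma star_scaleR: "star (r *\<^sub>R x) = r *\<^sub>R star (x::'a::cstar_algebra)"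
  by (simp add: scaleR_scaleC star_scaleC)

lemma star_minus: "star (- x) = - star (x::'a::cstar_algebra)"
  using star_scaleR[of "-1" x] by simp

lemma star_diff: "star (x - y) = star x - star (y::'a::cstar_algebra)"
  by (metis star_add star_minus diff_conv_add_uminus)

lemma star_sum: "star (sum f I) = (\<Sum>i\<in>I. star (f i :: 'a::cstar_algebra))"
  by (induction I rule: infinite_finite_induct) (simp_all add: star_zero star_add)

lemma continuous_star: "continuous_on S (star :: 'a::cstar_algebra \<Rightarrow> 'a)"
  by (rule linear_continuous_on, rule bounded_linear_intro[where K=1])
     (simp_all add: star_add star_scaleR norm_star)

definition cstar_subalgebra :: "'a::cstar_algebra set \<Rightarrow> bool" where
  "cstar_subalgebra A \<longleftrightarrow> closed A \<and> 0 \<in> A \<and> (\<forall>x\<in>A. \<forall>y\<in>A. x + y \<in> A) \<and>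
     (\<forall>x\<in>A. \<forall>y\<in>A. x * y \<in> A) \<and> (\<forall>c. \<forall>x\<in>A. c *\<^sub>C x \<in> A) \<and> (\<forall>x\<in>A. star x \<in> A)"

context
  fixes A :: "'a::cstar_algebra set"
  assumes A: "cstar_subalgebra A"
begin

lemma cstar_subalgebra_closed: "closed A"
  and cstar_subalgebra_zero: "0 \<in> A"
  and cstar_subalgebra_add: "x \<in> A \<Longrightarrow> y \<in> A \<Longrightarrow> x + y \<in> A"
  and cstar_subalgebra_mult: "x \<in> A \<Longrightarrow> y \<in> A \<Longrightarrow> x * y \<in> A"
  and cstar_subalgebra_scaleC: "x \<in> A \<Longrightarrow> c *\<^sub>C x \<in> A"
  and cstar_subalgebra_star: "x \<in> A \<Longrightarrow> star x \<in> A"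
  using A by (simp_all add: cstar_subalgebra_def)

lemma cstar_subalgebra_scaleR: "x \<in> A \<Longrightarrow> r *\<^sub>R x \<in> A"
  by (simp add: scaleR_scaleC cstar_subalgebra_scaleC)

lemma cstar_subalgebra_minus: "x \<in> A \<Longrightarrow> - x \<in> A"
  using cstar_subalgebra_scaleR[of x "-1"] by simp

lemma cstar_subalgebra_diff: "x \<in> A \<Longrightarrow> y \<in> A \<Longrightarrow> x - y \<in> A"
  using cstar_subalgebra_add[of x "- y"] by (simp add: cstar_subalgebra_minus)

lemma cstar_subalgebra_sum: "(\<And>i. i \<in> I \<Longrightarrow> f i \<in> A) \<Longrightarrow> sum f I \<in> A"
  by (induction I rule: infinite_finite_induct)
     (simp_all add: cstar_subalgebra_zero cstar_subalgebra_add)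

lemmas cstar_subalgebra_intros = cstar_subalgebra_zero cstar_subalgebra_add cstar_subalgebra_mult
  cstar_subalgebra_scaleC cstar_subalgebra_star cstar_subalgebra_scaleR cstar_subalgebra_minus
  cstar_subalgebra_diff cstar_subalgebra_sum

text \<open>The element \<open>y\<close> stands for \<open>1 - sqrt (1 - a\<^sup>* a)\<close>. The equation avoids the unit, and its
  solution is the fixed point of a contraction.\<close>

lemma one_minus_sqrt_exists:
  assumes a: "a \<in> A" "norm a < 1"
  shows "\<exists>y\<in>A. star y = y \<and> 2 *\<^sub>R y = star a * a + y * y"
proof -
  define b where "b = star a * a"
  have b: "b \<in> A" "star b = b" "norm b < 1"
    using a power_strict_mono[of "norm a" 1 2]
    by (simp_all add: b_def cstar_subalgebra_intros star_mult star_star norm_star_mult_self)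
  \<comment> \<open>The smaller root of \<open>2 r = norm b + r^2\<close>: the ball of radius
    \<open>r\<close> is then mapped into itself by \<open>f\<close>, and \<open>r < 1\<close> is
    also the contraction constant there.\<close>
  define r where "r = 1 - sqrt (1 - norm b)"
  have r: "0 \<le> r" "r < 1" using b(3) by (simp_all add: r_def)
  have r2: "norm b + r * r = 2 * r"
  proof -
    have "sqrt (1 - norm b) * sqrt (1 - norm b) = 1 - norm b" using b(3) by simp
    thus ?thesis by (simp add: r_def algebra_simps)
  qed
  define S where "S = A \<inter> cball 0 r \<inter> {y. star y = y}"
  define f where "f y = (1/2) *\<^sub>R (b + y * y)" for y
  have cl: "closed {y::'a. star y = y}"
    by (rule closed_Collect_eq) (auto intro: continuous_star continuous_intros)
  have "complete S" unfolding S_def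
    unfolding complete_eq_closed by (intro closed_Int cl cstar_subalgebra_closed closed_cball)
  moreover have "0 \<in> S" using r by (simp add: S_def cstar_subalgebra_zero star_zero)
  hence "S \<noteq> {}" by blast
  moreover have "f ` S \<subseteq> S"
  proof
    fix z assume "z \<in> f ` S"
    then obtain y where y: "y \<in> A" "norm y \<le> r" "star y = y" "z = f y" by (auto simp: S_def)
    have "norm (b + y * y) \<le> norm b + r * r"
      using norm_mult_ineq[of y y] mult_mono[OF y(2) y(2)] r(1)
      by (intro norm_triangle_le) auto
    thus "z \<in> S" using y b r2
      by (auto simp: S_def f_def cstar_subalgebra_intros star_scaleR star_add star_mult)
  qed
  moreover have "dist (f x) (f y) \<le> r * dist x y" if "x \<in> S \<and> y \<in> S" for x y
  proof -
    have xy: "norm x \<le> r" "norm y \<le> r" using that by (auto simp: S_def)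
    have "x * x - y * y = (x - y) * x + y * (x - y)" by (simp add: algebra_simps)
    hence "norm (x * x - y * y) \<le> norm ((x - y) * x) + norm (y * (x - y))"
      by (simp add: norm_triangle_ineq)
    also have "\<dots> \<le> norm (x - y) * r + r * norm (x - y)"
      using xy r by (intro add_mono order_trans[OF norm_mult_ineq] mult_mono) auto
    finally show ?thesis
      by (simp add: f_def dist_norm scaleR_diff_right[symmetric])
  qed
  ultimately have "\<exists>!x\<in>S. f x = x"
    using Banach_fix[of S r f] r by blast
  then obtain y where "y \<in> S" "f y = y" by blast
  moreover have "2 *\<^sub>R f y = b + y * y" by (simp add: f_def)
  ultimately show ?thesis by (auto simp: S_def b_def)
qed

text \<open>With \<open>y\<close> from \<open>one_minus_sqrt_exists\<close>, formally
  \<open>1 - a^* a = (1 - y)^2\<close>. Applying \<open>\<pi>\<close> gives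
  \<open>(norm (\<pi> a v))^2 = (norm v)^2 - (norm (v - \<pi> y v))^2\<close>, hence the claim for
  \<open>norm a < 1\<close>; scaling does the rest.\<close>

lemma star_representation_contractive:
  fixes \<pi> :: "'a \<Rightarrow> 'h::chilbert_space bop"
  assumes \<pi>: "star_representation A \<pi>" and a: "a \<in> A"
  shows "norm (\<pi> a) \<le> norm a"
proof -
  have add: "\<And>x y. x \<in> A \<Longrightarrow> y \<in> A \<Longrightarrow> \<pi> (x + y) = \<pi> x + \<pi> y"
    and mult: "\<And>x y. x \<in> A \<Longrightarrow> y \<in> A \<Longrightarrow> \<pi> (x * y) = \<pi> x * \<pi> y"
    and st: "\<And>x. x \<in> A \<Longrightarrow> \<pi> (star x) = star (\<pi> x)"
    and sc: "\<And>c x. x \<in> A \<Longrightarrow> \<pi> (c *\<^sub>C x) = c *\<^sub>C \<pi> x"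
    using \<pi> by (simp_all add: star_representation_def complex_linear_on_def)
  have 1: "norm (\<pi> a) \<le> 1" if a: "a \<in> A" "norm a < 1" for a
  proof -
    obtain y where y: "y \<in> A" "star y = y" "2 *\<^sub>R y = star a * a + y * y"
      using one_minus_sqrt_exists[OF a] by blast
    have eq: "star (\<pi> a) * \<pi> a + \<pi> y * \<pi> y = \<pi> y + \<pi> y"
      using arg_cong[OF y(3), of \<pi>] y(1) a(1)
      by (simp add: add mult st cstar_subalgebra_intros scaleR_2)
    have "norm (\<pi> a $$ v) \<le> 1 * norm v" for v
    proof -
      define \<eta> where "\<eta> = \<pi> y $$ v"
      have "cinner ((star (\<pi> a) * \<pi> a + \<pi> y * \<pi> y) $$ v) v = 2 * cinner \<eta> v"
        unfolding eq \<eta>_def by (simp add: bop_simps cinner_simps)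
      moreover have "cinner (\<pi> y $$ \<eta>) v = cinner \<eta> \<eta>"
        using st[OF y(1)] y(2) cinner_star_bop'[of "\<pi> y" \<eta> v] by (simp add: \<eta>_def)
      ultimately have *: "(norm (\<pi> a $$ v))\<^sup>2 + (norm \<eta>)\<^sup>2 = 2 * inner \<eta> v"
        by (simp add: bop_simps cinner_simps cinner_star_bop' \<eta>_def inner_eq_Re_cinner
            power2_norm_eq_inner complex_eq_iff)
      have "0 \<le> (norm (v - \<eta>))\<^sup>2" by simp
      also have "\<dots> = (norm v)\<^sup>2 - 2 * inner \<eta> v + (norm \<eta>)\<^sup>2"
        by (simp add: power2_norm_eq_inner inner_diff_left inner_diff_right inner_commute)
      finally have "(norm (\<pi> a $$ v))\<^sup>2 \<le> (norm v)\<^sup>2" using * by linarith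
      hence "norm (\<pi> a $$ v) \<le> norm v" by (rule power2_le_imp_le) simp
      thus ?thesis by simp
    qed
    thus ?thesis by (intro norm_bop_bound) auto
  qed
  show ?thesis
  proof (rule field_le_epsilon)
    fix e :: real assume e: "0 < e"
    define t where "t = norm a + e"
    have t: "0 < t" using e by (simp add: t_def add_nonneg_pos)
    have "norm ((1/t) *\<^sub>R a) < 1" using t e by (simp add: t_def)
    hence "norm (\<pi> ((1/t) *\<^sub>R a)) \<le> 1" by (intro 1 cstar_subalgebra_scaleR a)
    moreover have "\<pi> ((1/t) *\<^sub>R a) = (1/t) *\<^sub>R \<pi> a"
      using a by (simp only: scaleR_scaleC sc)
    ultimately show "norm (\<pi> a) \<le> norm a + e"
      using t by (simp add: t_def field_simps)
  qed
qed

end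

section \<open>Positive matrices over a \<open>C\<^sup>*\<close>-algebra\<close>

text \<open>Vectors and matrices of size \<open>n\<close> are functions on \<open>nat\<close> of
  which only the indices below \<open>n\<close> count, so \<open>n\<close> stays an ordinary
  variable. The real inner product is enough, since only real parts of quadratic forms are
  compared.\<close>

definition vec_inner :: "nat \<Rightarrow> (nat \<Rightarrow> 'l::real_inner) \<Rightarrow> (nat \<Rightarrow> 'l) \<Rightarrow> real" where
  "vec_inner n w z = (\<Sum>i<n. inner (w i) (z i))"

definition mat_apply :: "nat \<Rightarrow> (nat \<Rightarrow> nat \<Rightarrow> 'l::chilbert_space bop) \<Rightarrow> (nat \<Rightarrow> 'l) \<Rightarrow> nat \<Rightarrow> 'l" where
  "mat_apply n h w i = (\<Sum>j<n. h i j $$ w j)"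

definition mat_selfadjoint :: "nat \<Rightarrow> (nat \<Rightarrow> nat \<Rightarrow> 'a::cstar_algebra) \<Rightarrow> bool" where
  "mat_selfadjoint n h \<longleftrightarrow> (\<forall>i<n. \<forall>j<n. star (h i j) = h j i)"

text \<open>The operator inequality \<open>0 \<le> h \<le> c\<close>, stated through quadratic forms
  so that no operator on the \<open>n\<close>-fold sum has to be formed.\<close>

definition mat_between :: "nat \<Rightarrow> (nat \<Rightarrow> nat \<Rightarrow> 'l::chilbert_space bop) \<Rightarrow> real \<Rightarrow> bool" where
  "mat_between n h c \<longleftrightarrow> (\<forall>w. 0 \<le> vec_inner n (mat_apply n h w) w \<and>
     vec_inner n (mat_apply n h w) w \<le> c * vec_inner n w w)"

definition mat_square :: "nat \<Rightarrow> (nat \<Rightarrow> nat \<Rightarrow> 'a::cstar_algebra) \<Rightarrow> nat \<Rightarrow> nat \<Rightarrow> 'a" where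
  "mat_square n h i j = (\<Sum>l<n. h i l * h l j)"

lemma vec_inner_diff_left: "vec_inner n (\<lambda>i. x i - y i) z = vec_inner n x z - vec_inner n y z"
  by (simp add: vec_inner_def inner_diff_left sum_subtractf)

lemma vec_inner_scale_left: "vec_inner n (\<lambda>i. r *\<^sub>R x i) z = r * vec_inner n x z"
  by (simp add: vec_inner_def sum_distrib_left)

lemma vec_inner_commute: "vec_inner n x y = vec_inner n y x"
  by (simp add: vec_inner_def inner_commute)

lemma vec_inner_diff_right: "vec_inner n z (\<lambda>i. x i - y i) = vec_inner n z x - vec_inner n z y"
  by (simp add: vec_inner_def inner_diff_right sum_subtractf)

lemma vec_inner_scale_right: "vec_inner n z (\<lambda>i. r *\<^sub>R x i) = r * vec_inner n z x"
  by (simp add: vec_inner_def sum_distrib_left)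

lemma vec_inner_ge_0: "0 \<le> vec_inner n x x"
  by (simp add: vec_inner_def sum_nonneg)

lemma mat_apply_diff: "mat_apply n h (\<lambda>i. x i - y i) = (\<lambda>i. mat_apply n h x i - mat_apply n h y i)"
  by (simp add: mat_apply_def bop_diff sum_subtractf fun_eq_iff)

lemma mat_apply_scale: "mat_apply n h (\<lambda>i. r *\<^sub>R x i) = (\<lambda>i. r *\<^sub>R mat_apply n h x i)"
  by (simp add: mat_apply_def bop_scaleR scaleR_sum_right fun_eq_iff)

lemma mat_apply_square: "mat_apply n (mat_square n h) x = mat_apply n h (mat_apply n h x)"
proof
  fix i
  have "mat_apply n (mat_square n h) x i = (\<Sum>j<n. \<Sum>l<n. h i l $$ (h l j $$ x j))"
    by (simp add: mat_apply_def mat_square_def bop_simps)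
  also have "\<dots> = (\<Sum>l<n. \<Sum>j<n. h i l $$ (h l j $$ x j))"
    by (rule sum.swap)
  finally show "mat_apply n (mat_square n h) x i = mat_apply n h (mat_apply n h x) i"
    by (simp add: mat_apply_def bop_simps)
qed

lemma mat_apply_minus_square:
  "mat_apply n (\<lambda>i j. h i j - mat_square n h i j) x =
     (\<lambda>i. mat_apply n h x i - mat_apply n h (mat_apply n h x) i)"
  using mat_apply_square[of n h x]
  by (simp add: mat_apply_def minus_bop.rep_eq sum_subtractf fun_eq_iff)

lemma mat_apply_symmetric:
  assumes "mat_selfadjoint n h"
  shows "vec_inner n (mat_apply n h x) y = vec_inner n x (mat_apply n h y)"
proof -
  have "inner (h i j $$ x j) (y i) = inner (x j) (h j i $$ y i)"
    if "i < n" "j < n" for i j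
    using assms that cinner_star_bop[of "h i j" "x j" "y i"]
    by (simp add: mat_selfadjoint_def inner_eq_Re_cinner)
  hence "vec_inner n (mat_apply n h x) y = (\<Sum>i<n. \<Sum>j<n. inner (x j) (h j i $$ y i))"
    unfolding vec_inner_def mat_apply_def inner_sum_left by (intro sum.cong) auto
  also have "\<dots> = (\<Sum>j<n. \<Sum>i<n. inner (x j) (h j i $$ y i))" by (rule sum.swap)
  finally show ?thesis by (simp add: vec_inner_def mat_apply_def inner_sum_right)
qed

context
  fixes n :: nat and h :: "nat \<Rightarrow> nat \<Rightarrow> 'l::chilbert_space bop" and c :: real
  assumes sa: "mat_selfadjoint n h" and betw: "mat_between n h c" and c: "0 < c"
begin

text \<open>This is \<open>h^2 \<le> c h\<close>, obtained without functional calculus: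
  \<open>0 \<le> h\<close> is tested on \<open>c w - h w\<close>, and \<open>h \<le> c\<close> on
  \<open>h w\<close>.\<close>

lemma mat_between_square_le:
  "vec_inner n (mat_apply n h w) (mat_apply n h w) \<le> c * vec_inner n (mat_apply n h w) w"
proof -
  define g where "g = mat_apply n h w"
  define G where "G = vec_inner n g g"
  define q where "q = vec_inner n g w"
  define Q where "Q = vec_inner n (mat_apply n h g) g"
  have sym: "vec_inner n (mat_apply n h g) w = G" "vec_inner n w g = q"
    using mat_apply_symmetric[OF sa, of g w] by (simp_all add: g_def[symmetric] G_def q_def vec_inner_commute)
  have "0 \<le> vec_inner n (mat_apply n h (\<lambda>i. c *\<^sub>R w i - g i)) (\<lambda>i. c *\<^sub>R w i - g i)"
    using betw by (simp add: mat_between_def)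
  also have "\<dots> = c * (c * q - G) - (c * G - Q)"
    unfolding mat_apply_diff mat_apply_scale g_def[symmetric] vec_inner_diff_left vec_inner_diff_right
      vec_inner_scale_left vec_inner_scale_right sym q_def[symmetric] G_def[symmetric] Q_def[symmetric] by (simp add: algebra_simps)
  finally have 1: "0 \<le> c * (c * q - G) - (c * G - Q)" .
  have 2: "Q \<le> c * G" using betw by (simp add: mat_between_def Q_def G_def)
  have "0 \<le> c * (c * q - G)" using 1 2 by linarith
  hence "0 \<le> c * q - G" using c by (simp add: zero_le_mult_iff)
  thus ?thesis by (simp add: G_def q_def g_def)
qed

text \<open>The function \<open>t - t^2\<close> increases on \<open>[0, 1/2]\<close>. The upper
  bound rests on the identity \<open>(c - c^2) - (h - h^2) = (c - h)^2 + (1 - 2 c) (c - h)\<close>,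
  whose right side is a sum of positive terms.\<close>

lemma mat_between_minus_square:
  assumes c2: "c \<le> 1/2"
  shows "mat_between n (\<lambda>i j. h i j - mat_square n h i j) (c - c\<^sup>2)"
  unfolding mat_between_def
proof (intro allI conjI)
  fix w
  define g where "g = mat_apply n h w"
  define G where "G = vec_inner n g g"
  define N where "N = vec_inner n w w"
  define q where "q = vec_inner n g w"
  have sym: "vec_inner n (mat_apply n h g) w = G" "vec_inner n w g = q"
    using mat_apply_symmetric[OF sa, of g w] by (simp_all add: g_def[symmetric] G_def q_def vec_inner_commute)
  have eq: "vec_inner n (mat_apply n (\<lambda>i j. h i j - mat_square n h i j) w) w = q - G"
    by (simp add: mat_apply_minus_square vec_inner_diff_left g_def[symmetric] sym q_def)
  have "G \<le> c * q" using mat_between_square_le[of w] by (simp add: G_def q_def g_def)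
  moreover have q: "0 \<le> q" "q \<le> c * N" using betw by (simp_all add: mat_between_def q_def N_def g_def)
  moreover have "c * q \<le> 1 * q" using q(1) c2 by (intro mult_right_mono) auto
  ultimately show "0 \<le> vec_inner n (mat_apply n (\<lambda>i j. h i j - mat_square n h i j) w) w"
    unfolding eq by linarith
  have "0 \<le> vec_inner n (\<lambda>i. c *\<^sub>R w i - g i) (\<lambda>i. c *\<^sub>R w i - g i)" by (rule vec_inner_ge_0)
  also have "\<dots> = c * (c * N - q) - (c * q - G)"
    unfolding vec_inner_diff_left vec_inner_diff_right vec_inner_scale_left vec_inner_scale_right
      sym q_def[symmetric] G_def[symmetric] N_def[symmetric] by (simp add: algebra_simps)
  finally have "0 \<le> c * (c * N - q) - (c * q - G) + (1 - 2 * c) * (c * N - q)"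
    using q c2 by simp
  hence "q - G \<le> (c - c\<^sup>2) * N" by (simp add: algebra_simps power2_eq_square)
  thus "vec_inner n (mat_apply n (\<lambda>i j. h i j - mat_square n h i j) w) w
      \<le> (c - c\<^sup>2) * vec_inner n w w" by (simp add: eq N_def)
qed

text \<open>Tested on a vector with a single nonzero coordinate,
  \<open>h^2 \<le> c h \<le> c^2\<close> bounds a whole column of \<open>h\<close> and thereby the
  entry.\<close>

lemma mat_between_norm_entry_le:
  assumes ij: "i < n" "j < n"
  shows "norm (h i j) \<le> c"
proof (rule norm_bop_bound)
  fix x :: 'l
  define \<eta> where "\<eta> l = (if l = j then x else 0)" for l
  have a: "mat_apply n h \<eta> i = h i j $$ x"
    using ij by (simp add: mat_apply_def \<eta>_def if_distrib[of "bop_apply _"] bop_zero cong: if_cong)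
  have N: "vec_inner n \<eta> \<eta> = (norm x)\<^sup>2"
    using ij by (simp add: vec_inner_def \<eta>_def if_distrib[of "\<lambda>z. inner z _"] power2_norm_eq_inner cong: if_cong)
  have "(norm (mat_apply n h \<eta> i))\<^sup>2 \<le> vec_inner n (mat_apply n h \<eta>) (mat_apply n h \<eta>)"
    unfolding vec_inner_def power2_norm_eq_inner using ij by (intro member_le_sum) auto
  also have "\<dots> \<le> c * vec_inner n (mat_apply n h \<eta>) \<eta>" by (rule mat_between_square_le)
  also have "\<dots> \<le> c * (c * vec_inner n \<eta> \<eta>)"
    using betw c by (intro mult_left_mono) (auto simp: mat_between_def)
  also have "\<dots> = (c * norm x)\<^sup>2" by (simp add: N power2_eq_square)
  finally show "norm (h i j $$ x) \<le> c * norm x"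
    unfolding a by (rule power2_le_imp_le) (use c in simp)
qed (use c in simp)

end

text \<open>The scalars that bound the iterates of \<open>h - h^2\<close> from above. The start
  \<open>1/2\<close> is the point up to which \<open>t - t^2\<close> increases; the limit
  \<open>L\<close> of the decreasing sequence satisfies \<open>L = L - L^2\<close>.\<close>

lemma minus_square_iteration_tendsto_0:
  fixes c :: "nat \<Rightarrow> real"
  assumes c0: "c 0 = 1/2" and cS: "\<And>k. c (Suc k) = c k - (c k)\<^sup>2"
  shows "0 < c k \<and> c k \<le> 1/2" and "c \<longlonglongrightarrow> 0"
proof -
  have *: "0 < c k \<and> c k \<le> 1/2" for k
  proof (induction k)
    case (Suc k)
    have "c (Suc k) = c k * (1 - c k)" by (simp add: cS power2_eq_square algebra_simps)
    hence "0 < c (Suc k)" using Suc by simp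
    moreover have "c (Suc k) \<le> c k" by (simp add: cS)
    ultimately show ?case using Suc by linarith
  qed (simp add: c0)
  show "0 < c k \<and> c k \<le> 1/2" by (rule *)
  have "decseq c" by (rule decseq_SucI) (simp add: cS)
  then obtain L where L: "c \<longlonglongrightarrow> L"
    using decseq_convergent[of c 0] * by (metis less_imp_le)
  have "(\<lambda>k. c k - (c k)\<^sup>2) \<longlonglongrightarrow> L - L\<^sup>2" by (intro tendsto_intros L)
  moreover have "(\<lambda>k. c (Suc k)) \<longlonglongrightarrow> L" using L by (rule LIMSEQ_Suc)
  ultimately have "L = L - L\<^sup>2" using LIMSEQ_unique unfolding cS by blast
  thus "c \<longlonglongrightarrow> 0" using L by simp
qed

text \<open>Positivity of \<open>h\<close> as an operator gives positivity of the amplified image without a square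
  root of \<open>h\<close>: with \<open>h\<^sub>0 = h\<close> and \<open>h\<^sub>k\<^sub>+\<^sub>1 = h\<^sub>k - h\<^sub>k\<^sup>2\<close>, the functional below decreases along
  \<open>h\<^sub>k\<close> because it is non-negative on squares, and \<open>h\<^sub>k\<close> tends to \<open>0\<close>.\<close>

lemma completely_positive_matrix:
  fixes A :: "'l::chilbert_space bop set" and \<phi> :: "'l bop \<Rightarrow> 'm::chilbert_space bop"
  assumes A: "cstar_subalgebra A" and cp: "completely_positive A B \<phi>" and contr: "contractive_on A \<phi>"
    and hA: "\<And>i j. i < n \<Longrightarrow> j < n \<Longrightarrow> h i j \<in> A" and sa: "mat_selfadjoint n h"
    and pos: "\<And>w. 0 \<le> vec_inner n (mat_apply n h w) w"
  shows "0 \<le> vec_inner n (mat_apply n (\<lambda>i j. \<phi> (h i j)) z) z"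
proof -
  define f where "f h = vec_inner n (mat_apply n (\<lambda>i j. \<phi> (h i j)) z) z" for h
  have lin: "\<And>x y. x \<in> A \<Longrightarrow> y \<in> A \<Longrightarrow> \<phi> (x + y) = \<phi> x + \<phi> y" "\<And>c x. x \<in> A \<Longrightarrow> \<phi> (c *\<^sub>C x) = c *\<^sub>C \<phi> x"
    using cp by (simp_all add: completely_positive_def complex_linear_on_def)
  have diff: "\<phi> (x - y) = \<phi> x - \<phi> y" if "x \<in> A" "y \<in> A" for x y
    using lin(1)[of "x - y" y] that by (simp add: cstar_subalgebra_intros[OF A])
  define C where "C = (\<Sum>i<n. \<Sum>j<n. norm (z j) * norm (z i))"
  have bound: "\<bar>f h\<bar> \<le> C * b" if "\<And>i j. i < n \<Longrightarrow> j < n \<Longrightarrow> h i j \<in> A \<and> norm (h i j) \<le> b" for h b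
  proof -
    have "\<bar>f h\<bar> \<le> (\<Sum>i<n. \<Sum>j<n. \<bar>inner (\<phi> (h i j) $$ z j) (z i)\<bar>)"
      unfolding f_def vec_inner_def mat_apply_def inner_sum_left
      by (rule order_trans[OF sum_abs], rule sum_mono, rule sum_abs)
    also have "\<dots> \<le> (\<Sum>i<n. \<Sum>j<n. b * (norm (z j) * norm (z i)))"
    proof (intro sum_mono)
      fix i j assume ij: "i \<in> {..<n}" "j \<in> {..<n}"
      have "\<bar>inner (\<phi> (h i j) $$ z j) (z i)\<bar> \<le> norm (\<phi> (h i j) $$ z j) * norm (z i)"
        by (rule Cauchy_Schwarz_ineq2)
      also have "\<dots> \<le> norm (\<phi> (h i j)) * norm (z j) * norm (z i)"
        by (intro mult_right_mono norm_bop_apply) auto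
      also have "norm (\<phi> (h i j)) \<le> b"
        using that[of i j] ij contr by (auto simp: contractive_on_def intro: order_trans)
      finally show "\<bar>inner (\<phi> (h i j) $$ z j) (z i)\<bar> \<le> b * (norm (z j) * norm (z i))"
        by (simp add: mult.assoc mult_right_mono)
    qed
    also have "\<dots> = C * b" by (simp add: C_def sum_distrib_left mult.commute)
    finally show ?thesis .
  qed
  \<comment> \<open>For self-adjoint \<open>h\<close> the square is \<open>h^* h\<close>, the shape
    to which complete positivity applies; the resulting form is a sum of squared norms.\<close>
  have square: "0 \<le> f (mat_square n h)" if h: "mat_selfadjoint n h" "\<And>i j. i < n \<Longrightarrow> j < n \<Longrightarrow> h i j \<in> A" for h
  proof -
    have "\<exists>y. (\<forall>i<n. \<forall>j<n. y i j \<in> B) \<and>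
             (\<forall>i<n. \<forall>j<n. \<phi> (\<Sum>l<n. star (h l i) * h l j) = (\<Sum>l<n. star (y l i) * y l j))"
      using cp h(2) unfolding completely_positive_def by blast
    then obtain y where y: "\<And>i j. i < n \<Longrightarrow> j < n \<Longrightarrow>
        \<phi> (\<Sum>l<n. star (h l i) * h l j) = (\<Sum>l<n. star (y l i) * y l j)" by blast
    let ?y = "\<lambda>l i j. inner (y l j $$ z j) (y l i $$ z i)"
    have sq: "\<phi> (mat_square n h i j) = (\<Sum>l<n. star (y l i) * y l j)" if "i < n" "j < n" for i j
    proof -
      have "mat_square n h i j = (\<Sum>l<n. star (h l i) * h l j)"
        using h(1) that by (simp add: mat_square_def mat_selfadjoint_def)
      thus ?thesis using y[OF that] by simp
    qed
    have "f (mat_square n h) = (\<Sum>i<n. \<Sum>j<n. \<Sum>l<n. ?y l i j)"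
      unfolding f_def vec_inner_def mat_apply_def inner_sum_left
      by (intro sum.cong refl) (simp add: sq bop_simps inner_eq_Re_cinner cinner_simps cinner_star_bop')
    also have "\<dots> = (\<Sum>i<n. \<Sum>l<n. \<Sum>j<n. ?y l i j)"
      by (intro sum.cong refl sum.swap)
    also have "\<dots> = (\<Sum>l<n. \<Sum>i<n. \<Sum>j<n. ?y l i j)"
      by (rule sum.swap)
    also have "\<dots> = (\<Sum>l<n. (norm (\<Sum>i<n. y l i $$ z i))\<^sup>2)"
      unfolding power2_norm_eq_inner inner_sum_left inner_sum_right
      by (intro sum.cong refl sum.swap)
    finally show ?thesis by (simp add: sum_nonneg)
  qed
  have main: "0 \<le> f h" if h: "mat_selfadjoint n h" "\<And>i j. i < n \<Longrightarrow> j < n \<Longrightarrow> h i j \<in> A"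
    "mat_between n h (1/2)" for h
  proof -
    define H where "H = rec_nat h (\<lambda>_ g i j. g i j - mat_square n g i j)"
    define c where "c = rec_nat (1/2::real) (\<lambda>_ x. x - x\<^sup>2)"
    have H0: "H 0 = h" and HS: "H (Suc k) = (\<lambda>i j. H k i j - mat_square n (H k) i j)" for k
      by (simp_all add: H_def)
    have c0: "c 0 = 1/2" and cS: "c (Suc k) = c k - (c k)\<^sup>2" for k by (simp_all add: c_def)
    note c = minus_square_iteration_tendsto_0[of c, OF c0 cS]
    have inv: "mat_selfadjoint n (H k) \<and> (\<forall>i<n. \<forall>j<n. H k i j \<in> A) \<and> mat_between n (H k) (c k) \<and> f (H k) \<le> f h" for k
    proof (induction k)
      case 0 show ?case using h by (simp add: H0 c0)
    next
      case (Suc k)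
      hence IH: "mat_selfadjoint n (H k)" "\<And>i j. i < n \<Longrightarrow> j < n \<Longrightarrow> H k i j \<in> A"
        "mat_between n (H k) (c k)" "f (H k) \<le> f h" by auto
      have sqA: "mat_square n (H k) i j \<in> A" if "i < n" "j < n" for i j
        using that IH(2) unfolding mat_square_def
        by (intro cstar_subalgebra_sum[OF A] cstar_subalgebra_mult[OF A]) auto
      have "mat_selfadjoint n (H (Suc k))"
        using IH(1) by (simp add: HS mat_selfadjoint_def mat_square_def star_diff star_sum star_mult)
      moreover have "f (H (Suc k)) = f (H k) - f (mat_square n (H k))"
        unfolding f_def vec_inner_def mat_apply_def HS sum_subtractf[symmetric] inner_diff_left[symmetric]
        by (intro sum.cong refl arg_cong2[where f=inner])
           (simp add: diff IH(2) sqA minus_bop.rep_eq)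
      moreover have "mat_between n (H (Suc k)) (c (Suc k))"
        unfolding HS cS using mat_between_minus_square[OF IH(1,3)] c(1)[of k] by blast
      moreover have "0 \<le> f (mat_square n (H k))" by (rule square[OF IH(1,2)])
      ultimately show ?case using IH sqA by (simp add: HS cstar_subalgebra_diff[OF A])
    qed
    have "- (C * c k) \<le> f h" for k
    proof -
      have "\<bar>f (H k)\<bar> \<le> C * c k"
        using inv[of k] c(1)[of k] by (intro bound) (auto intro: mat_between_norm_entry_le)
      thus ?thesis using inv[of k] by linarith
    qed
    moreover have "(\<lambda>k. - (C * c k)) \<longlonglongrightarrow> - (C * 0)" by (intro tendsto_intros c(2))
    ultimately show ?thesis using LIMSEQ_le_const2[of "\<lambda>k. - (C * c k)"] by fastforce
  qed
  \<comment> \<open>\<open>M\<close> dominates the form of \<open>h\<close>, and the summand 1 keeps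
    it positive when all entries vanish. The factor \<open>r = 1 / (2 M)\<close> brings
    \<open>h\<close> below \<open>1/2\<close>, where the iteration starts.\<close>
  define M where "M = 1 + (\<Sum>i<n. \<Sum>j<n. norm (h i j))"
  have M: "1 \<le> M" by (simp add: M_def sum_nonneg)
  define r where "r = 1 / (2 * M)"
  have r: "0 < r" using M by (simp add: r_def)
  have form_le: "vec_inner n (mat_apply n h w) w \<le> M * vec_inner n w w" for w
  proof -
    let ?N = "vec_inner n w w"
    have "inner (h i j $$ w j) (w i) \<le> norm (h i j) * ?N" if "i < n" "j < n" for i j
    proof -
      have le: "(norm (w l))\<^sup>2 \<le> ?N" if "l < n" for l
        unfolding vec_inner_def power2_norm_eq_inner using that by (intro member_le_sum) auto
      have "norm (w j) * norm (w i) \<le> sqrt ?N * sqrt ?N"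
        using le that by (intro mult_mono real_le_rsqrt) (auto simp: vec_inner_ge_0)
      hence *: "norm (w j) * norm (w i) \<le> ?N" by (simp add: vec_inner_ge_0)
      have "inner (h i j $$ w j) (w i) \<le> norm (h i j $$ w j) * norm (w i)"
        by (rule norm_cauchy_schwarz)
      also have "\<dots> \<le> norm (h i j) * norm (w j) * norm (w i)"
        by (intro mult_right_mono norm_bop_apply) auto
      also have "\<dots> \<le> norm (h i j) * ?N" using * by (simp add: mult.assoc mult_left_mono)
      finally show ?thesis .
    qed
    hence "vec_inner n (mat_apply n h w) w \<le> (\<Sum>i<n. \<Sum>j<n. norm (h i j) * ?N)"
      unfolding vec_inner_def[of n "mat_apply n h w"] mat_apply_def inner_sum_left
      by (intro sum_mono) auto
    also have "\<dots> \<le> M * ?N"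
      by (simp add: M_def sum_distrib_right distrib_right vec_inner_ge_0)
    finally show ?thesis .
  qed
  have ap: "mat_apply n (\<lambda>i j. r *\<^sub>R h i j) w = (\<lambda>i. r *\<^sub>R mat_apply n h w i)" for w
    by (simp add: mat_apply_def scaleR_bop.rep_eq scaleR_sum_right fun_eq_iff)
  have "0 \<le> f (\<lambda>i j. r *\<^sub>R h i j)"
  proof (rule main)
    show "mat_selfadjoint n (\<lambda>i j. r *\<^sub>R h i j)" using sa by (simp add: mat_selfadjoint_def star_scaleR)
    show "r *\<^sub>R h i j \<in> A" if "i < n" "j < n" for i j using hA that by (simp add: cstar_subalgebra_scaleR[OF A])
    show "mat_between n (\<lambda>i j. r *\<^sub>R h i j) (1/2)"
      unfolding mat_between_def ap vec_inner_scale_left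
      using pos form_le r M by (simp add: r_def field_simps)
  qed
  moreover have "f (\<lambda>i j. r *\<^sub>R h i j) = r * f h"
    unfolding f_def vec_inner_def mat_apply_def sum_distrib_left inner_scaleR_left[symmetric] scaleR_sum_right
    by (intro sum.cong refl arg_cong2[where f=inner])
       (simp add: hA lin(2) scaleR_scaleC scaleC_bop.rep_eq)
  ultimately show ?thesis using r by (simp add: f_def zero_le_mult_iff)
qed

section \<open>Nuclearity and commuting representations\<close>

lemma complex_linear_on_sum:
  fixes f :: "'a::complex_vector \<Rightarrow> 'b::complex_vector"
  assumes f: "complex_linear_on B f" and zero: "0 \<in> B"
    and add: "\<And>x y. x \<in> B \<Longrightarrow> y \<in> B \<Longrightarrow> x + y \<in> B"
    and scale: "\<And>c x. x \<in> B \<Longrightarrow> c *\<^sub>C x \<in> B"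
    and x: "\<And>i. i \<in> I \<Longrightarrow> x i \<in> B"
  shows "f (\<Sum>i\<in>I. c i *\<^sub>C x i) = (\<Sum>i\<in>I. c i *\<^sub>C f (x i))"
proof -
  have "f (0 *\<^sub>C 0) = 0 *\<^sub>C f 0" using f zero by (simp add: complex_linear_on_def)
  hence f0: "f 0 = 0" using scaleR_scaleC[of 0 "f 0"] scaleC_zero_right[where 'a='a] by simp
  show ?thesis
  proof (cases "finite I")
    case True
    have "(\<Sum>i\<in>I. c i *\<^sub>C x i) \<in> B \<and> ?thesis" using True x
    proof (induction I)
      case (insert i I)
      thus ?case using f by (simp add: complex_linear_on_def add scale)
    qed (simp add: f0 zero)
    thus ?thesis by blast
  qed (simp add: f0)
qed

section \<open>Matrix units\<close>

lemma rep_abs_nat_L2: "sq_integrable (f :: nat \<Rightarrow> complex) \<Longrightarrow> rep_L2 (abs_L2 f) = f"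
  using rep_abs_L2[of f] unfolding msr_nat_def AE_count_space by (simp add: fun_eq_iff)

lemma nat_L2_eqI: "(\<And>i. rep_L2 v i = rep_L2 w i) \<Longrightarrow> v = (w :: nat L2)"
  by (rule L2_eqI) simp

definition unit_vec :: "nat \<Rightarrow> nat L2" where
  "unit_vec j = abs_L2 (\<lambda>i. if i = j then 1 else 0)"

lemma rep_unit_vec: "rep_L2 (unit_vec j) = (\<lambda>i. if i = j then 1 else 0)"
  unfolding unit_vec_def
proof (rule rep_abs_nat_L2)
  have "integrable (count_space UNIV) (\<lambda>x. (cmod (if x = j then 1 else 0))\<^sup>2)"
    by (rule integrable_count_space_nat_iff[THEN iffD2])
       (rule summable_finite[of "{j}"], auto)
  thus "sq_integrable (\<lambda>i. if i = j then 1 else 0)"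
    by (simp add: sq_integrable_def msr_nat_def)
qed

lemma cinner_unit_vec: "cinner v (unit_vec j) = rep_L2 v j"
proof -
  have "(\<lambda>x. rep_L2 v x * cnj (if x = j then 1 else 0)) = (\<lambda>x. if x = j then rep_L2 v j else 0)"
    by auto
  hence "cinner v (unit_vec j) = (LINT x|count_space UNIV. (if x = j then rep_L2 v j else 0))"
    unfolding cinner_L2.rep_eq rep_unit_vec by (simp add: msr_nat_def)
  also have "\<dots> = (\<Sum>x\<in>{x. x = j \<and> rep_L2 v j \<noteq> 0}. rep_L2 v j)"
    by (subst lebesgue_integral_count_space_finite_support) (auto intro!: sum.cong)
  also have "\<dots> = (\<Sum>x\<in>{j}. rep_L2 v j)"
    by (rule sum.mono_neutral_left) auto
  finally show ?thesis by simp
qed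

lift_definition rank_one :: "'h \<Rightarrow> 'h \<Rightarrow> 'h::chilbert_space bop" is "\<lambda>x y \<xi>. cinner \<xi> y *\<^sub>C x"
  by (rule bounded_clinearI)
     (auto simp: cinner_simps scaleC_add_left scaleC_scaleC norm_scaleC_inner mult.assoc
       intro!: order_trans[OF mult_right_mono[OF cinner_Cauchy_Schwarz]])

definition matrix_unit :: "nat \<Rightarrow> nat \<Rightarrow> nat L2 bop" where
  "matrix_unit i j = rank_one (unit_vec i) (unit_vec j)"

lemma matrix_unit_apply: "matrix_unit i j $$ v = rep_L2 v j *\<^sub>C unit_vec i"
  by (simp add: matrix_unit_def rank_one.rep_eq cinner_unit_vec)

lemma rep_scaleC_nat: "rep_L2 (c *\<^sub>C v) i = c * rep_L2 v (i::nat)"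
  by (simp add: cinner_unit_vec[symmetric] cinner_simps)

lemma rep_sum_nat: "rep_L2 (sum f I) (i::nat) = (\<Sum>k\<in>I. rep_L2 (f k) i)"
  by (simp add: cinner_unit_vec[symmetric] cinner_simps)

lemma rep_zero_nat: "rep_L2 0 (i::nat) = 0"
  by (simp add: cinner_unit_vec[symmetric] cinner_simps)

lemma rep_add_nat: "rep_L2 (v + w) (i::nat) = rep_L2 v i + rep_L2 w i"
  by (simp add: cinner_unit_vec[symmetric] cinner_simps)

lemma rep_diff_nat: "rep_L2 (v - w) (i::nat) = rep_L2 v i - rep_L2 w i"
  by (simp add: cinner_unit_vec[symmetric] cinner_simps)

lemma scaleC_zero_left: "0 *\<^sub>C x = (0::'a::complex_vector)"
  using scaleR_scaleC[of 0 x] by simp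

lemma matrix_unit_in: "i < n \<Longrightarrow> j < n \<Longrightarrow> matrix_unit i j \<in> matrix_algebra n"
  by (simp add: matrix_algebra_def matrix_unit_apply rep_scaleC_nat rep_unit_vec scaleC_zero_left)

text \<open>This shows that the matrix with entries \<open>matrix_unit i j\<close> is positive: it
  is \<open>x^* x\<close> for an \<open>x\<close> whose only nonzero row is \<open>k\<close>, with
  entries \<open>matrix_unit k j\<close>.\<close>

lemma matrix_unit_star_mult: "star (matrix_unit k i) * matrix_unit k j = matrix_unit i j"
  by (rule bop_form_eqI)
     (simp add: bop_simps cinner_star_bop' matrix_unit_apply cinner_simps cinner_unit_vec rep_unit_vec
       cinner_commute[of "unit_vec _"] rep_scaleC_nat)

lemma matrix_algebra_zero: "0 \<in> matrix_algebra n"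
  by (simp add: matrix_algebra_def bop_simps rep_zero_nat)

lemma matrix_algebra_add: "S \<in> matrix_algebra n \<Longrightarrow> T \<in> matrix_algebra n \<Longrightarrow> S + T \<in> matrix_algebra n"
  by (simp add: matrix_algebra_def bop_simps rep_add_nat)

lemma matrix_algebra_scaleC: "T \<in> matrix_algebra n \<Longrightarrow> c *\<^sub>C T \<in> matrix_algebra n"
  by (simp add: matrix_algebra_def bop_simps rep_scaleC_nat scaleC_zero_right)

text \<open>The difference between \<open>v\<close> and its truncation to the first \<open>n\<close>
  coordinates is annihilated by \<open>T\<close>, so \<open>T\<close> is determined by its values on
  the first \<open>n\<close> basis vectors.\<close>

lemma matrix_algebra_expand:
  assumes T: "T \<in> matrix_algebra n"
  shows "T = (\<Sum>(i, j)\<in>{..<n} \<times> {..<n}. cinner (T $$ unit_vec j) (unit_vec i) *\<^sub>C matrix_unit i j)"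
proof (rule bop_eqI, rule nat_L2_eqI)
  fix v and i :: nat
  define \<zeta> where "\<zeta> = (\<Sum>j<n. rep_L2 v j *\<^sub>C unit_vec j)"
  have "rep_L2 (v - \<zeta>) k = 0" if "k < n" for k
    using that by (simp add: \<zeta>_def rep_diff_nat rep_sum_nat rep_scaleC_nat rep_unit_vec
        if_distrib[of "\<lambda>x. _ * x"] cong: if_cong)
  hence "T $$ (v - \<zeta>) = 0" using T by (simp add: matrix_algebra_def)
  hence "T $$ v = (\<Sum>j<n. rep_L2 v j *\<^sub>C T $$ unit_vec j)"
    by (simp add: bop_diff \<zeta>_def bop_sum bop_scaleC)
  hence lhs: "rep_L2 (T $$ v) i = (\<Sum>j<n. rep_L2 v j * rep_L2 (T $$ unit_vec j) i)"
    by (simp add: rep_sum_nat rep_scaleC_nat)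
  have "rep_L2 ((\<Sum>(i, j)\<in>{..<n} \<times> {..<n}. cinner (T $$ unit_vec j) (unit_vec i) *\<^sub>C matrix_unit i j) $$ v) i
      = (\<Sum>k<n. \<Sum>j<n. rep_L2 (T $$ unit_vec j) k * (rep_L2 v j * (if i = k then 1 else 0)))"
    by (simp add: sum.cartesian_product[symmetric] bop_simps rep_sum_nat rep_scaleC_nat matrix_unit_apply
        cinner_unit_vec rep_unit_vec)
  also have "\<dots> = (\<Sum>k<n. if i = k then \<Sum>j<n. rep_L2 (T $$ unit_vec j) k * rep_L2 v j else 0)"
    by (intro sum.cong refl) auto
  also have "\<dots> = (if i < n then \<Sum>j<n. rep_L2 (T $$ unit_vec j) i * rep_L2 v j else 0)"
    by simp
  also have "\<dots> = rep_L2 (T $$ v) i"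
    using T unfolding lhs by (auto simp: matrix_algebra_def mult.commute)
  finally show "rep_L2 (T $$ v) i = rep_L2 ((\<Sum>(i, j)\<in>{..<n} \<times> {..<n}.
      cinner (T $$ unit_vec j) (unit_vec i) *\<^sub>C matrix_unit i j) $$ v) i" by simp
qed

text \<open>An element \<open>\<Sum>k. a\<^sub>k \<otimes> b\<^sub>k\<close> that is positive on the Hilbert space tensor
  product stays positive after \<open>a\<^sub>k\<close> has been replaced by \<open>\<pi> a\<^sub>k\<close>. A completely positive map
  \<open>M\<^sub>n \<rightarrow> A\<close> is given by a positive matrix \<open>\<Sum>l. y\<^sub>l\<^sub>i\<^sup>* y\<^sub>l\<^sub>j\<close> over \<open>A\<close>, and the vectors \<open>\<pi> y\<^sub>l\<^sub>j v\<close>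
  reduce the claim to the completely positive map \<open>A \<rightarrow> M\<^sub>n\<close>.\<close>

lemma nuclear_commuting_positive:
  fixes A :: "'l::chilbert_space bop set" and \<pi> :: "'l bop \<Rightarrow> 'h::chilbert_space bop"
    and a :: "'k \<Rightarrow> 'l bop" and b :: "'k \<Rightarrow> 'h bop"
  assumes A: "cstar_subalgebra A" and nuc: "nuclear A" and \<pi>: "star_representation A \<pi>"
    and K: "finite K" and aA: "\<And>k. k \<in> K \<Longrightarrow> a k \<in> A"
    and comm: "\<And>k x. k \<in> K \<Longrightarrow> x \<in> A \<Longrightarrow> b k * \<pi> x = \<pi> x * b k"
    and sa: "\<And>v w. star (\<Sum>k\<in>K. cinner (b k $$ v) w *\<^sub>C a k) =
          (\<Sum>k\<in>K. cinner (b k $$ w) v *\<^sub>C a k)"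
    and pos: "\<And>n (w :: nat \<Rightarrow> 'l) (v :: nat \<Rightarrow> 'h).
       0 \<le> Re (\<Sum>k\<in>K. \<Sum>i<n. \<Sum>j<n. cinner (a k $$ w j) (w i) * cinner (b k $$ v j) (v i))"
  shows "0 \<le> Re (\<Sum>k\<in>K. cinner (\<pi> (a k) $$ (b k $$ v)) v)"
proof -
  let ?c = "\<lambda>x k. cinner (\<pi> x $$ (b k $$ v)) v"
  have \<pi>D: "complex_linear_on A \<pi>" "\<And>x y. x \<in> A \<Longrightarrow> y \<in> A \<Longrightarrow> \<pi> (x * y) = \<pi> x * \<pi> y"
    "\<And>x. x \<in> A \<Longrightarrow> \<pi> (star x) = star (\<pi> x)"
    using \<pi> by (simp_all add: star_representation_def)
  note A_lin = cstar_subalgebra_zero[OF A] cstar_subalgebra_add[OF A] cstar_subalgebra_scaleC[OF A]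
  define C where "C = (\<Sum>k\<in>K. norm (b k $$ v) * norm v)"
  have approx: "- (\<epsilon> * C) \<le> Re (\<Sum>k\<in>K. ?c (a k) k)" if \<epsilon>: "0 < \<epsilon>" for \<epsilon>
  proof -
    have "finite (a ` K)" "a ` K \<subseteq> A" using K aA by auto
    then obtain n \<phi> \<psi> where \<phi>: "completely_positive A (matrix_algebra n) \<phi>" "contractive_on A \<phi>"
      and \<psi>: "completely_positive (matrix_algebra n) A \<psi>"
      and close: "\<And>k. k \<in> K \<Longrightarrow> norm (\<psi> (\<phi> (a k)) - a k) < \<epsilon>"
      using nuc \<epsilon> unfolding nuclear_def by (metis imageI)
    have \<phi>_lin: "complex_linear_on A \<phi>" and \<phi>_in: "\<And>x. x \<in> A \<Longrightarrow> \<phi> x \<in> matrix_algebra n"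
      using \<phi> by (auto simp: completely_positive_def)
    have \<psi>_lin: "complex_linear_on (matrix_algebra n) \<psi>" and \<psi>_in: "\<And>x. x \<in> matrix_algebra n \<Longrightarrow> \<psi> x \<in> A"
      using \<psi> by (auto simp: completely_positive_def)
    have "\<exists>y. (\<forall>i<n. \<forall>j<n. y i j \<in> A) \<and> (\<forall>i<n. \<forall>j<n. \<psi> (matrix_unit i j) = (\<Sum>l<n. star (y l i) * y l j))"
    proof -
      \<comment> \<open>The argument of Choi: row 0 alone carries the matrix units, so
        \<open>x^* x\<close> is the matrix of all units, and complete positivity of
        \<open>\<psi>\<close> turns it into the positive matrix \<open>y^* y\<close> over
        \<open>A\<close>.\<close>
      define x where "x l i = (if l = 0 then matrix_unit 0 i else 0)" for l i :: nat
      have x: "x i j \<in> matrix_algebra n" if "i < n" "j < n" for i j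
        using that by (simp add: x_def matrix_unit_in matrix_algebra_zero)
      have "\<exists>y. (\<forall>i<n. \<forall>j<n. y i j \<in> A) \<and>
             (\<forall>i<n. \<forall>j<n. \<psi> (\<Sum>l<n. star (x l i) * x l j) = (\<Sum>l<n. star (y l i) * y l j))"
        using \<psi> x unfolding completely_positive_def by blast
      moreover have "(\<Sum>l<n. star (x l i) * x l j) = matrix_unit i j" if "i < n" for i j
      proof -
        have "star (x l i) * x l j = (if l = 0 then matrix_unit i j else 0)" for l
          by (simp add: x_def matrix_unit_star_mult)
        thus ?thesis using that by simp
      qed
      ultimately show ?thesis by simp
    qed
    then obtain y where yA: "\<And>i j. i < n \<Longrightarrow> j < n \<Longrightarrow> y i j \<in> A"
      and y: "\<And>i j. i < n \<Longrightarrow> j < n \<Longrightarrow> \<psi> (matrix_unit i j) = (\<Sum>l<n. star (y l i) * y l j)" by blast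
    define \<zeta> where "\<zeta> l j = \<pi> (y l j) $$ v" for l j
    \<comment> \<open>Commutation enters here: \<open>b k\<close> passes
      \<open>\<pi> (y l j)\<close>, so that one factor \<open>\<pi> (y l j)\<close> reaches each of
      the two vectors \<open>v\<close>.\<close>
    have unit: "?c (\<psi> (matrix_unit i j)) k =
        (\<Sum>l<n. cinner (b k $$ \<zeta> l j) (\<zeta> l i))" if ij: "i < n" "j < n" and k: "k \<in> K" for i j k
    proof -
      have "\<pi> (\<Sum>l<n. 1 *\<^sub>C (star (y l i) * y l j)) = (\<Sum>l<n. 1 *\<^sub>C \<pi> (star (y l i) * y l j))"
        by (rule complex_linear_on_sum[OF \<pi>D(1) A_lin])
           (use ij in \<open>auto intro!: yA cstar_subalgebra_mult[OF A] cstar_subalgebra_star[OF A]\<close>)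
      moreover have "\<pi> (star (y l i) * y l j) = star (\<pi> (y l i)) * \<pi> (y l j)" if "l < n" for l
        using ij that by (simp add: \<pi>D yA cstar_subalgebra_star[OF A])
      ultimately have "\<pi> (\<psi> (matrix_unit i j)) = (\<Sum>l<n. star (\<pi> (y l i)) * \<pi> (y l j))"
        by (simp add: y ij scaleC_one)
      moreover have "\<pi> (y l j) $$ (b k $$ v) = b k $$ \<zeta> l j" if "l < n" for l
        using arg_cong[OF comm[OF k yA[OF that ij(2)]], of "\<lambda>T. T $$ v"]
        by (simp add: times_bop.rep_eq \<zeta>_def)
      ultimately show ?thesis
        by (simp add: bop_simps cinner_simps cinner_star_bop' \<zeta>_def)
    qed
    \<comment> \<open>Evaluating the operator matrix \<open>\<phi> (h l i j)\<close> at the tuple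
      \<open>u\<close> of basis vectors picks the coefficient \<open>(i, j)\<close> out of the entry
      \<open>(i, j)\<close>, which is exactly the expansion in \<open>factor\<close>.\<close>
    define u where "u = unit_vec"
    let ?t = "\<lambda>k l i j. cinner (\<phi> (a k) $$ u j) (u i) * cinner (b k $$ \<zeta> l j) (\<zeta> l i)"
    have factor: "cinner (\<pi> (\<psi> (\<phi> (a k))) $$ (b k $$ v)) v =
       (\<Sum>l<n. \<Sum>i<n. \<Sum>j<n. ?t k l i j)"
      if k: "k \<in> K" for k
    proof -
      define c where "c p = cinner (\<phi> (a k) $$ u (snd p)) (u (fst p))" for p
      let ?I = "{..<n} \<times> {..<n}"
      have "\<phi> (a k) = (\<Sum>p\<in>?I. c p *\<^sub>C matrix_unit (fst p) (snd p))"
        using matrix_algebra_expand[OF \<phi>_in[OF aA[OF k]]] by (simp add: c_def u_def case_prod_unfold)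
      hence "\<psi> (\<phi> (a k)) = (\<Sum>p\<in>?I. c p *\<^sub>C \<psi> (matrix_unit (fst p) (snd p)))"
        using complex_linear_on_sum[OF \<psi>_lin matrix_algebra_zero matrix_algebra_add matrix_algebra_scaleC,
            of ?I "\<lambda>p. matrix_unit (fst p) (snd p)" c]
        by (auto simp: matrix_unit_in)
      hence "\<pi> (\<psi> (\<phi> (a k))) = (\<Sum>p\<in>?I. c p *\<^sub>C \<pi> (\<psi> (matrix_unit (fst p) (snd p))))"
        using complex_linear_on_sum[OF \<pi>D(1) A_lin, of ?I "\<lambda>p. \<psi> (matrix_unit (fst p) (snd p))" c]
        by (auto simp: matrix_unit_in \<psi>_in)
      hence "cinner (\<pi> (\<psi> (\<phi> (a k))) $$ (b k $$ v)) v =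
         (\<Sum>p\<in>?I. c p * (\<Sum>l<n. cinner (b k $$ \<zeta> l (snd p)) (\<zeta> l (fst p))))"
        using k by (auto simp: bop_simps cinner_simps unit intro!: sum.cong)
      also have "\<dots> = (\<Sum>p\<in>?I. \<Sum>l<n. c p * cinner (b k $$ \<zeta> l (snd p)) (\<zeta> l (fst p)))"
        by (simp only: sum_distrib_left)
      also have "\<dots> = (\<Sum>l<n. \<Sum>p\<in>?I. c p * cinner (b k $$ \<zeta> l (snd p)) (\<zeta> l (fst p)))"
        by (rule sum.swap)
      finally show ?thesis by (simp add: sum.cartesian_product c_def case_prod_unfold)
    qed
    \<comment> \<open>Slicing the tensor by the vectors \<open>\<zeta> l j\<close> leaves a matrix
      over \<open>A\<close>. Its self-adjointness is \<open>sa\<close>, and its positivity as an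
      operator is \<open>pos\<close> at the vectors \<open>\<zeta> l\<close>.\<close>
    define h where "h l i j = (\<Sum>k\<in>K. cinner (b k $$ \<zeta> l j) (\<zeta> l i) *\<^sub>C a k)" for l i j
    have hA: "h l i j \<in> A" for l i j
      unfolding h_def by (intro cstar_subalgebra_sum[OF A] cstar_subalgebra_scaleC[OF A] aA)
    have "0 \<le> vec_inner n (mat_apply n (\<lambda>i j. \<phi> (h l i j)) u) u" for l
    proof (rule completely_positive_matrix[OF A \<phi> hA])
      show "mat_selfadjoint n (h l)" by (simp add: mat_selfadjoint_def h_def sa)
      fix w :: "nat \<Rightarrow> 'l"
      have "(\<Sum>k\<in>K. \<Sum>i<n. \<Sum>j<n. cinner (a k $$ w j) (w i) * cinner (b k $$ \<zeta> l j) (\<zeta> l i)) =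
        (\<Sum>i<n. \<Sum>k\<in>K. \<Sum>j<n. cinner (a k $$ w j) (w i) * cinner (b k $$ \<zeta> l j) (\<zeta> l i))"
        by (rule sum.swap)
      also have "\<dots> = (\<Sum>i<n. \<Sum>j<n. \<Sum>k\<in>K. cinner (a k $$ w j) (w i) * cinner (b k $$ \<zeta> l j) (\<zeta> l i))"
        by (intro sum.cong refl sum.swap)
      also have "\<dots> = (\<Sum>i<n. \<Sum>j<n. cinner (h l i j $$ w j) (w i))"
        by (intro sum.cong refl) (simp add: h_def bop_simps cinner_simps mult.commute)
      finally show "0 \<le> vec_inner n (mat_apply n (h l) w) w"
        using pos[where n=n and w=w and v="\<zeta> l"]
        by (simp add: vec_inner_def mat_apply_def inner_eq_Re_cinner cinner_sum_left)
    qed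
    moreover have "(\<Sum>k\<in>K. cinner (\<pi> (\<psi> (\<phi> (a k))) $$ (b k $$ v)) v) =
        (\<Sum>l<n. \<Sum>i<n. \<Sum>j<n. cinner (\<phi> (h l i j) $$ u j) (u i))"
    proof -
      have "(\<Sum>k\<in>K. cinner (\<pi> (\<psi> (\<phi> (a k))) $$ (b k $$ v)) v) =
        (\<Sum>k\<in>K. \<Sum>l<n. \<Sum>i<n. \<Sum>j<n. ?t k l i j)"
        by (intro sum.cong refl factor)
      also have "\<dots> = (\<Sum>l<n. \<Sum>k\<in>K. \<Sum>i<n. \<Sum>j<n. ?t k l i j)"
        by (rule sum.swap)
      also have "\<dots> = (\<Sum>l<n. \<Sum>i<n. \<Sum>k\<in>K. \<Sum>j<n. ?t k l i j)"
        by (intro sum.cong refl sum.swap)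
      also have "\<dots> = (\<Sum>l<n. \<Sum>i<n. \<Sum>j<n. \<Sum>k\<in>K. ?t k l i j)"
        by (intro sum.cong refl sum.swap)
      also have "\<dots> = (\<Sum>l<n. \<Sum>i<n. \<Sum>j<n. cinner (\<phi> (h l i j) $$ u j) (u i))"
      proof (intro sum.cong refl)
        fix l i j
        have "\<phi> (h l i j) = (\<Sum>k\<in>K. cinner (b k $$ \<zeta> l j) (\<zeta> l i) *\<^sub>C \<phi> (a k))"
          unfolding h_def by (rule complex_linear_on_sum[OF \<phi>_lin A_lin aA])
        thus "(\<Sum>k\<in>K. ?t k l i j) =
            cinner (\<phi> (h l i j) $$ u j) (u i)"
          by (simp add: bop_simps cinner_simps mult.commute)
      qed
      finally show ?thesis .
    qed
    ultimately have nonneg: "0 \<le> Re (\<Sum>k\<in>K. cinner (\<pi> (\<psi> (\<phi> (a k))) $$ (b k $$ v)) v)"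
      by (simp add: vec_inner_def mat_apply_def inner_eq_Re_cinner cinner_sum_left sum_nonneg)
    have err: "\<bar>Re (cinner (\<pi> (\<psi> (\<phi> (a k))) $$ (b k $$ v)) v)
        - Re (?c (a k) k)\<bar> \<le> \<epsilon> * (norm (b k $$ v) * norm v)"
      if k: "k \<in> K" for k
    proof -
      let ?x = "\<psi> (\<phi> (a k))"
      have x: "?x \<in> A" by (intro \<psi>_in \<phi>_in aA k)
      hence d: "?x - a k \<in> A" by (simp add: cstar_subalgebra_diff[OF A] aA k)
      have "\<pi> ?x = \<pi> (?x - a k) + \<pi> (a k)"
        using \<pi>D(1) d aA[OF k] unfolding complex_linear_on_def by (metis diff_add_cancel)
      hence "Re (?c ?x k) - Re (?c (a k) k)
          = Re (cinner ((\<pi> (?x - a k)) $$ (b k $$ v)) v)"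
        by (simp add: bop_simps cinner_simps)
      also have "\<bar>\<dots>\<bar> \<le> norm (\<pi> (?x - a k)) * norm (b k $$ v) * norm v"
        by (rule order_trans[OF abs_Re_le_cmod cmod_form_le])
      also have "\<dots> \<le> \<epsilon> * norm (b k $$ v) * norm v"
        using star_representation_contractive[OF A \<pi> d] close[OF k]
        by (intro mult_right_mono) auto
      finally show ?thesis by (simp add: mult.assoc)
    qed
    have "\<bar>Re (\<Sum>k\<in>K. cinner (\<pi> (\<psi> (\<phi> (a k))) $$ (b k $$ v)) v)
        - Re (\<Sum>k\<in>K. ?c (a k) k)\<bar> \<le> \<epsilon> * C"
      unfolding Re_sum sum_subtractf[symmetric] C_def sum_distrib_left
      by (rule order_trans[OF sum_abs], rule sum_mono, rule err)
    thus ?thesis using nonneg by linarith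
  qed
  have "0 \<le> C" by (simp add: C_def sum_nonneg)
  show ?thesis
  proof (rule field_le_epsilon)
    fix e :: real assume e: "0 < e"
    have "e / (C + 1) * C \<le> e" using \<open>0 \<le> C\<close> e by (simp add: field_simps)
    thus "0 \<le> Re (\<Sum>k\<in>K. ?c (a k) k) + e"
      using approx[of "e / (C + 1)"] \<open>0 \<le> C\<close> e by simp
  qed
qed

section \<open>Haar measure\<close>

lemma space_msr: "space (msr :: 'g::haar_group measure) = UNIV"
  using sets_eq_imp_space_eq[OF sets_msr] by simp

lemma borel_measurable_msr_continuous:
  "continuous_on UNIV f \<Longrightarrow> (f :: 'g::haar_group \<Rightarrow> 'b::topological_space) \<in> borel_measurable msr"
  using borel_measurable_continuous_onI[of f] by (simp add: measurable_cong_sets[OF sets_msr refl])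

lemma open_sets_msr: "open U \<Longrightarrow> U \<in> sets (msr :: 'g::haar_group measure)"
  by (simp add: sets_msr)

lemma compact_sets_msr: "compact K \<Longrightarrow> K \<in> sets (msr :: 'g::haar_group measure)"
  by (simp add: sets_msr borel_closed compact_imp_closed)

lemma translate_vimage_sets:
  "B \<in> sets (msr :: 'g::haar_group measure) \<Longrightarrow> (\<lambda>t. s + t) -` B \<in> sets msr"
  using measurable_sets[OF measurable_translate_msr, of B s] by (simp add: space_msr)

lemma emeasure_translate:
  assumes "B \<in> sets (msr :: 'g::haar_group measure)"
  shows "emeasure msr ((\<lambda>t. s + t) -` B) = emeasure msr B"
  using emeasure_distr[OF measurable_translate_msr assms, of s] msr_left_invariant[of s]
  by (simp add: space_msr)

lemma integrable_translate:
  fixes f :: "'g::haar_group \<Rightarrow> 'b::{banach, second_countable_topology}"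
  shows "integrable msr f \<Longrightarrow> integrable msr (\<lambda>t. f (s + t))"
  using integrable_distr[OF measurable_translate_msr, of s f] by (simp add: msr_left_invariant)

lemma integral_translate:
  fixes f :: "'g::haar_group \<Rightarrow> 'b::{banach, second_countable_topology}"
  assumes "f \<in> borel_measurable msr"
  shows "(LINT t|msr. f (s + t)) = (LINT t|msr. f t)"
  using integral_distr[OF measurable_translate_msr assms, of s] by (simp add: msr_left_invariant)

text \<open>Finitely many translates of \<open>U\<close> cover a given compact set. If
  \<open>U\<close> were null, all compact sets would be null, and by inner regularity so would the
  whole group.\<close>

lemma emeasure_open_pos:
  assumes U: "open U" "x \<in> U"
  shows "emeasure (msr :: 'g::haar_group measure) U \<noteq> 0"
proof
  assume 0: "emeasure msr U = 0"
  have translate_open: "open ((\<lambda>t. s + t) -` U)" for s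
    by (rule open_vimage[OF U(1)]) (intro continuous_intros)
  have "emeasure msr K = 0" if K: "compact K" for K :: "'g set"
  proof -
    have "K \<subseteq> (\<Union>k\<in>K. (\<lambda>t. (x - k) + t) -` U)"
    proof
      fix k assume "k \<in> K"
      moreover have "(x - k) + k \<in> U" using U(2) by simp
      ultimately show "k \<in> (\<Union>k\<in>K. (\<lambda>t. (x - k) + t) -` U)" by blast
    qed
    then obtain D where D: "finite D" "K \<subseteq> (\<Union>k\<in>D. (\<lambda>t. (x - k) + t) -` U)"
      using compactE_image[OF K, of K "\<lambda>k. (\<lambda>t. (x - k) + t) -` U"] translate_open by metis
    have "(\<Union>k\<in>D. (\<lambda>t. (x - k) + t) -` U) \<in> null_sets msr"
      by (rule null_sets_UN')
         (use D(1) 0 U(1) in \<open>auto simp: emeasure_translate translate_vimage_sets open_sets_msr countable_finite\<close>)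
    thus ?thesis using null_sets_subset[OF _ compact_sets_msr[OF K] D(2)] by auto
  qed
  hence "emeasure (msr :: 'g measure) UNIV \<le> 0"
    unfolding msr_inner_regular[OF open_UNIV] by (intro SUP_least) simp
  hence "emeasure (msr :: 'g measure) UNIV = 0" by simp
  thus False using msr_nonzero by blast
qed

lemma outer_approx:
  assumes B: "B \<in> sets (msr :: 'g::haar_group measure)" "emeasure msr B < \<infinity>" and e: "0 < e"
  shows "\<exists>U. open U \<and> B \<subseteq> U \<and> emeasure msr U < \<infinity> \<and> measure msr (U - B) < e"
proof -
  have "emeasure msr B < emeasure msr B + ennreal e"
    using B(2) e by (simp add: ennreal_add_left_cancel_less)
  hence "(INF U\<in>{U. open U \<and> B \<subseteq> U}. emeasure msr U) < emeasure msr B + ennreal e"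
    using msr_outer_regular[OF B(1)] by simp
  then obtain U where U: "open U" "B \<subseteq> U" "emeasure msr U < emeasure msr B + ennreal e"
    unfolding INF_less_iff by blast
  have fin: "emeasure msr U < \<infinity>"
    using U(3) B(2) by (metis ennreal_add_eq_top ennreal_neq_top infinity_ennreal_def less_top order_less_trans)
  have "measure msr (U - B) = measure msr U - measure msr B"
    using fin B U open_sets_msr[OF U(1)] by (intro measure_Diff) auto
  moreover have "ennreal (measure msr U) < ennreal (measure msr B + e)"
    using U(3) fin B(2) e by (simp add: emeasure_eq_ennreal_measure ennreal_plus less_top)
  hence "measure msr U < measure msr B + e" by (subst (asm) ennreal_less_iff) simp_all
  ultimately show ?thesis using U fin by fastforce
qed

lemma inner_approx:
  assumes U: "open (U :: 'g::haar_group set)" "emeasure msr U < \<infinity>" and e: "0 < e"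
  shows "\<exists>K. compact K \<and> K \<subseteq> U \<and> measure msr (U - K) < e"
\<comment> \<open>On a null set, subtracting \<open>e\<close> in \<open>ennreal\<close> yields no
  smaller value, so the supremum argument requires positive measure; the empty set serves
  otherwise.\<close>
proof (cases "emeasure msr U = 0")
  case True
  thus ?thesis using e by (intro exI[of _ "{}"]) (auto simp: measure_def)
next
  case False
  have "emeasure msr U - ennreal e < emeasure msr U"
  proof -
    obtain u where u: "emeasure msr U = ennreal u" "0 < u"
      using False U(2) by (cases "emeasure msr U") (auto simp: order_less_le)
    hence "emeasure msr U - ennreal e = ennreal (u - e)" using e by (simp add: ennreal_minus)
    thus ?thesis using u e by (simp add: ennreal_lessI)
  qed
  hence "emeasure msr U - ennreal e < (SUP K\<in>{K. compact K \<and> K \<subseteq> U}. emeasure msr K)"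
    using msr_inner_regular[OF U(1)] by simp
  then obtain K where K: "compact K" "K \<subseteq> U" "emeasure msr U - ennreal e < emeasure msr K"
    unfolding less_SUP_iff by blast
  have Kf: "emeasure msr K < \<infinity>" using msr_compact_finite[OF K(1)] .
  have "measure msr (U - K) = measure msr U - measure msr K"
    using U K Kf by (intro measure_Diff) (auto simp: compact_sets_msr open_sets_msr)
  moreover have "ennreal (measure msr U - e) < ennreal (measure msr K)"
    using K(3) U(2) Kf e by (simp add: emeasure_eq_ennreal_measure less_top ennreal_minus)
  hence "measure msr U - e < measure msr K" by (cases "measure msr U - e \<ge> 0") (auto simp: ennreal_less_iff ennreal_neg order_less_le_trans)
  ultimately show ?thesis using K by fastforce
qed

section \<open>Continuity of translation in \<open>L^1(G)\<close>\<close>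

lemma compact_translate_subset:
  fixes U :: "'g::haar_group set"
  assumes "compact K" "open U" "K \<subseteq> U"
  shows "\<forall>\<^sub>F s in nhds 0. \<forall>k\<in>K. s + k \<in> U"
proof -
  let ?W = "(\<lambda>p. fst p + snd p) -` U"
  have "open ?W" by (rule open_vimage[OF assms(2)]) (intro continuous_intros)
  moreover have "{0} \<times> K \<subseteq> ?W" using assms(3) by auto
  ultimately have "\<exists>X. 0 \<in> X \<and> open X \<and> X \<times> K \<subseteq> ?W"
    by (rule Elementary_Topology.tube_lemma[OF assms(1)])
  then obtain X where X: "0 \<in> X" "open X" "X \<times> K \<subseteq> ?W" by blast
  show ?thesis unfolding eventually_nhds using X by (intro exI[of _ X]) auto
qed

text \<open>Squeeze \<open>A\<close> into an open \<open>U\<close> of nearly the same measure, and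
  let a compact \<open>K\<close> fill up most of \<open>U\<close>. A small \<open>s\<close> keeps
  \<open>K\<close> inside \<open>U\<close>, so what \<open>s + A\<close> has outside
  \<open>A\<close> lies in \<open>s + (U - K)\<close> or in \<open>U - A\<close>.\<close>

lemma indicator_translate_L1:
  assumes A: "A \<in> sets (msr :: 'g::haar_group measure)" "emeasure msr A < \<infinity>" and e: "0 < e"
  shows "\<forall>\<^sub>F s in nhds 0. (LINT t|msr. \<bar>indicat_real A (- s + t) - indicat_real A t\<bar>) < e"
proof -
  obtain U where U: "open U" "A \<subseteq> U" "emeasure msr U < \<infinity>" "measure msr (U - A) < e/4"
    using outer_approx[OF A, of "e/4"] e by auto
  obtain K where K: "compact K" "K \<subseteq> U" "measure msr (U - K) < e/4"
    using inner_approx[OF U(1,3), of "e/4"] e by auto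
  show ?thesis
    using compact_translate_subset[OF K(1) U(1) K(2)]
  proof eventually_elim
    fix s assume s: "\<forall>k\<in>K. s + k \<in> U"
    let ?d = "\<lambda>t. \<bar>indicat_real A (- s + t) - indicat_real A t\<bar>"
    define As where "As = (\<lambda>t. - s + t) -` A"
    define V where "V = (\<lambda>t. - s + t) -` (U - K)"
    have UK: "U - K \<in> sets msr" "U - A \<in> sets msr"
      using U K A by (auto simp: open_sets_msr compact_sets_msr)
    have meas: "As \<in> sets msr" "V \<in> sets msr"
      unfolding As_def V_def by (rule translate_vimage_sets, rule A UK)+
    have em: "emeasure msr As = emeasure msr A" "emeasure msr V = emeasure msr (U - K)"
      unfolding As_def V_def by (rule emeasure_translate, rule A UK)+
    have UKf: "emeasure msr (U - K) < \<infinity>" "emeasure msr (U - A) < \<infinity>"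
      using U UK by (auto intro: order_le_less_trans[OF emeasure_mono] simp: open_sets_msr)
    have "As - A \<subseteq> V \<union> (U - A)"
    proof
      fix t assume t: "t \<in> As - A"
      have "t \<in> U" if "- s + t \<in> K" using bspec[OF s that] by (simp add: add.assoc[symmetric])
      thus "t \<in> V \<union> (U - A)" using t U(2) by (auto simp: As_def V_def)
    qed
    hence "measure msr (As - A) \<le> measure msr (V \<union> (U - A))"
      using meas UK UKf em emeasure_subadditive[of V msr "U - A"]
      by (intro measure_mono_fmeasurable) (auto simp: fmeasurable_def A intro: order_le_less_trans)
    also have "\<dots> \<le> measure msr V + measure msr (U - A)"
      by (rule measure_Un_le) (use meas UK in auto)
    also have "measure msr V = measure msr (U - K)" using em by (simp add: measure_def)
    finally have small: "measure msr (As - A) < e/2" using U K by linarith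
    have fin: "As \<in> fmeasurable msr" "A \<in> fmeasurable msr" "As - A \<in> fmeasurable msr"
      using meas A em by (auto simp: fmeasurable_def intro: order_le_less_trans[OF emeasure_mono])
    \<comment> \<open>\<open>As\<close> and \<open>A\<close> have equal measure, so integrating this
      identity shows that the symmetric difference has twice the measure of
      \<open>As - A\<close>.\<close>
    have ptw: "?d t =
        2 * indicat_real (As - A) t + indicat_real A t - indicat_real As t" for t
      by (auto simp: As_def indicator_def)
    have "(LINT t|msr. ?d t) =
        2 * measure msr (As - A) + measure msr A - measure msr As"
      unfolding ptw using fin
      by (simp add: integrable_indicator_iff fmeasurable_def less_top space_msr)
    also have "measure msr As = measure msr A" using em by (simp add: measure_def)
    finally show "(LINT t|msr. \<bar>indicat_real A (- s + t) - indicat_real A t\<bar>) < e"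
      using small by simp
  qed
qed

text \<open>Shaped after the limit case of \<open>integrable_induct\<close>, by which statements
  about indicators are carried over to all integrable functions.\<close>

lemma L1_dominated_tendsto:
  fixes f :: "'x \<Rightarrow> complex"
  assumes u: "\<And>i. integrable M (u i)" and f: "integrable M f"
    and lim: "\<And>x. x \<in> space M \<Longrightarrow> (\<lambda>i. u i x) \<longlonglongrightarrow> f x"
    and bound: "\<And>i x. x \<in> space M \<Longrightarrow> norm (u i x) \<le> 2 * norm (f x)"
  shows "(\<lambda>i. LINT t|M. cmod (u i t - f t)) \<longlonglongrightarrow> 0"
proof -
  have "(\<lambda>i. LINT t|M. cmod (u i t - f t)) \<longlonglongrightarrow> (LINT t|M. 0)"
  proof (rule integral_dominated_convergence[where w="\<lambda>t. 3 * cmod (f t)"])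
    show "AE t in M. (\<lambda>i. cmod (u i t - f t)) \<longlonglongrightarrow> 0"
      using lim by (intro AE_I2 tendsto_norm_zero) (auto simp: LIM_zero_iff)
    show "AE t in M. norm (cmod (u i t - f t)) \<le> 3 * cmod (f t)" for i
    proof (rule AE_I2)
      fix t assume "t \<in> space M"
      hence "cmod (u i t) \<le> 2 * cmod (f t)" by (rule bound)
      thus "norm (cmod (u i t - f t)) \<le> 3 * cmod (f t)"
        using norm_triangle_ineq4[of "u i t" "f t"] by simp
    qed
  qed (use u f in auto)
  thus ?thesis by simp
qed

text \<open>Indicators have the property, sums inherit it, and so do \<open>L^1\<close> limits,
  because translation preserves the \<open>L^1\<close> norm.\<close>

lemma translate_L1_continuous:
  fixes f :: "'g::haar_group \<Rightarrow> complex"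
  assumes f: "integrable msr f" and e: "0 < e"
  shows "\<forall>\<^sub>F s in nhds 0. (LINT t|msr. cmod (f (- s + t) - f t)) < e"
proof -
  let ?D = "\<lambda>f s. LINT t|msr. cmod (f (- s + t) - f t)"
  show ?thesis using f e
  proof (induction f arbitrary: e rule: integrable_induct)
    case (base A c)
    let ?I = "\<lambda>s. LINT t|msr. \<bar>indicat_real A (- s + t) - indicat_real A t\<bar>"
    have "0 < e / (cmod c + 1)" using base(3) by (simp add: add_nonneg_pos)
    from indicator_translate_L1[OF base(1,2) this] show ?case
    proof eventually_elim
      fix s assume s: "?I s < e / (cmod c + 1)"
      have "(LINT t|msr. cmod (indicat_real A (- s + t) *\<^sub>R c - indicat_real A t *\<^sub>R c)) =
          (LINT t|msr. \<bar>indicat_real A (- s + t) - indicat_real A t\<bar> * cmod c)"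
        by (simp add: scaleR_diff_left[symmetric] norm_scaleR)
      also have "\<dots> = ?I s * cmod c" by simp
      also have "\<dots> \<le> ?I s * (cmod c + 1)"
        by (intro mult_left_mono) auto
      also have "\<dots> < e" using s by (simp add: pos_less_divide_eq add_nonneg_pos)
      finally show "(LINT t|msr. cmod (indicat_real A (- s + t) *\<^sub>R c - indicat_real A t *\<^sub>R c)) < e" .
    qed
  next
    case (add f g)
    from add.IH(1)[of "e/2"] add.IH(2)[of "e/2"] add.prems
    have "\<forall>\<^sub>F s in nhds 0. ?D f s < e/2"
      "\<forall>\<^sub>F s in nhds 0. ?D g s < e/2" by auto
    thus ?case
    proof eventually_elim
      case (elim s)
      have int: "integrable msr (\<lambda>t. f (- s + t))" "integrable msr (\<lambda>t. g (- s + t))"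
        using add by (auto intro: integrable_translate)
      have "(LINT t|msr. cmod (f (- s + t) + g (- s + t) - (f t + g t))) \<le>
          (LINT t|msr. cmod (f (- s + t) - f t) + cmod (g (- s + t) - g t))"
        using int add.hyps
        by (intro integral_mono Bochner_Integration.integrable_add integrable_norm Bochner_Integration.integrable_diff)
           (auto simp: add_diff_add norm_triangle_ineq)
      also have "\<dots> = ?D f s + ?D g s"
        using int add.hyps
        by (intro Bochner_Integration.integral_add integrable_norm Bochner_Integration.integrable_diff) auto
      finally show ?case using elim by linarith
    qed
  next
    case (lim f u)
    have L1: "(\<lambda>i. LINT t|msr. cmod (u i t - f t)) \<longlonglongrightarrow> 0"
      by (rule L1_dominated_tendsto[OF lim.hyps(1,4,2,3)])
    hence "\<forall>\<^sub>F i in sequentially. (LINT t|msr. cmod (u i t - f t)) < e/3"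
      using lim.prems order_tendstoD(2)[of _ _ sequentially "e/3"] by simp
    then obtain i where i: "(LINT t|msr. cmod (u i t - f t)) < e/3"
      using eventually_happens trivial_limit_sequentially by blast
    have "\<forall>\<^sub>F s in nhds 0. ?D (u i) s < e/3"
      using lim.IH[of "e/3" i] lim.prems by simp
    thus ?case
    proof eventually_elim
      case (elim s)
      have int: "integrable msr (\<lambda>t. f (- s + t))" "integrable msr (\<lambda>t. u i (- s + t))" for i
        using lim by (auto intro: integrable_translate)
      have d: "integrable msr (\<lambda>t. cmod (u i t - f t))" using lim by auto
      have eq: "(LINT t|msr. cmod (u i (- s + t) - f (- s + t))) = (LINT t|msr. cmod (u i t - f t))"
        using integral_translate[of "\<lambda>t. cmod (u i t - f t)" "- s"] d by auto
      have tri: "cmod (a - b) \<le> cmod (c - a) + cmod (c - d) + cmod (d - b)" for a b c d :: complex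
        using norm_triangle_ineq[of "a - c" "c - d"] norm_triangle_ineq[of "a - d" "d - b"]
        by (simp add: norm_minus_commute)
      have "?D f s \<le>
          (LINT t|msr. cmod (u i (- s + t) - f (- s + t)) + cmod (u i (- s + t) - u i t) + cmod (u i t - f t))"
        using int lim.hyps d tri
        by (intro integral_mono Bochner_Integration.integrable_add integrable_norm Bochner_Integration.integrable_diff) auto
      also have "\<dots> = (LINT t|msr. cmod (u i (- s + t) - f (- s + t))) + ?D (u i) s
           + (LINT t|msr. cmod (u i t - f t))"
        using int lim.hyps d
        by (subst Bochner_Integration.integral_add, simp_all)+
      finally show ?case using elim i eq by linarith
    qed
  qed
qed

section \<open>The regular representation\<close>

lemma norm_abs_L2_sq:
  assumes "sq_integrable f"
  shows "(norm (abs_L2 f))\<^sup>2 = (LINT x|msr. (cmod (f x))\<^sup>2)"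
  unfolding norm_L2_sq
proof (rule integral_cong_AE)
  show "AE x in msr. (cmod (rep_L2 (abs_L2 f) x))\<^sup>2 = (cmod (f x))\<^sup>2"
    using rep_abs_L2[OF assms] by eventually_elim simp
qed (use assms sq_integrable_rep[of "abs_L2 f"] in \<open>auto simp: sq_integrable_def\<close>)

lemma abs_L2_eqI:
  "sq_integrable f \<Longrightarrow> (AE x in msr. rep_L2 v x = f x) \<Longrightarrow> v = abs_L2 f"
  by (rule L2_eqI) (use rep_abs_L2[of f] in \<open>auto elim: AE_mp\<close>)

lemma abs_rep_L2: "abs_L2 (rep_L2 v) = v"
  by (rule Quotient3_abs_rep[OF Quotient3_L2])

lemma abs_L2_diff:
  assumes "sq_integrable f" "sq_integrable g"
  shows "abs_L2 f - abs_L2 g = abs_L2 (\<lambda>x. f x - g x)"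
proof (rule abs_L2_eqI)
  show "sq_integrable (\<lambda>x. f x - g x)"
    using sq_integrable_add[OF assms(1) sq_integrable_scale[OF assms(2), of "-1"]] by simp
  show "AE x in msr. rep_L2 (abs_L2 f - abs_L2 g) x = f x - g x"
    using rep_diff_L2[of "abs_L2 f" "abs_L2 g"] rep_abs_L2[OF assms(1)] rep_abs_L2[OF assms(2)]
    by eventually_elim simp
qed

lemma left_regular_eq: "left_regular s v = abs_L2 (\<lambda>t. rep_L2 v (- s + t))"
  using left_regular.abs_eq[OF L2_rel_rep, of s v] by (simp add: abs_rep_L2)

lemma rep_left_regular: "AE t in msr. rep_L2 (left_regular s v) t = rep_L2 v (- s + t)"
  unfolding left_regular_eq by (rule rep_abs_L2[OF sq_integrable_translate[OF sq_integrable_rep]])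

lemma left_regular_abs: "sq_integrable f \<Longrightarrow> left_regular s (abs_L2 f) = abs_L2 (\<lambda>t. f (- s + t))"
  by (rule left_regular.abs_eq) (simp add: L2_rel_def)

lemma cinner_left_regular: "cinner (left_regular s v) (left_regular s w) = cinner v w"
proof -
  have m: "(\<lambda>t. rep_L2 v t * cnj (rep_L2 w t)) \<in> borel_measurable msr"
    by (intro borel_measurable_integrable sq_integrable_mult_cnj sq_integrable_rep)
  have "cinner (left_regular s v) (left_regular s w) =
      (LINT t|msr. rep_L2 v (- s + t) * cnj (rep_L2 w (- s + t)))"
    unfolding cinner_L2.rep_eq
  proof (rule integral_cong_AE)
    show "AE t in msr. rep_L2 (left_regular s v) t * cnj (rep_L2 (left_regular s w) t) =
        rep_L2 v (- s + t) * cnj (rep_L2 w (- s + t))"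
      using rep_left_regular[of s v] rep_left_regular[of s w] by eventually_elim simp
  qed (intro borel_measurable_integrable sq_integrable_mult_cnj sq_integrable_rep sq_integrable_translate)+
  also have "\<dots> = cinner v w"
    unfolding cinner_L2.rep_eq using integral_translate[OF m, of "- s"] by simp
  finally show ?thesis .
qed

lemma left_regular_left_regular: "left_regular s (left_regular t v) = left_regular (s + t) v"
  unfolding left_regular_eq[of t] left_regular_abs[OF sq_integrable_translate[OF sq_integrable_rep]]
    left_regular_eq[of "s + t"]
  by (simp add: minus_add add.assoc[symmetric])

lemma left_regular_zero: "left_regular 0 v = v"
  by (simp add: left_regular_eq abs_rep_L2)

lemma left_regular_add: "left_regular s (v + w) = left_regular s v + left_regular s w"
proof (rule cinner_ext)
  fix z
  have *: "cinner (left_regular s v) z = cinner v (left_regular (- s) z)" for v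
    using cinner_left_regular[of "- s" "left_regular s v" z]
    by (simp add: left_regular_left_regular left_regular_zero)
  show "cinner (left_regular s (v + w)) z = cinner (left_regular s v + left_regular s w) z"
    by (simp add: * cinner_add_left)
qed

lemma cinner_left_regular_left: "cinner (left_regular s v) w = cinner v (left_regular (- s) w)"
  using cinner_left_regular[of "- s" "left_regular s v" w]
  by (simp add: left_regular_left_regular left_regular_zero)

lemma left_regular_scaleC: "left_regular s (c *\<^sub>C v) = c *\<^sub>C left_regular s v"
  by (rule cinner_ext) (simp add: cinner_left_regular_left cinner_scaleC_left)

lemma norm_left_regular: "norm (left_regular s v) = norm v"
proof -
  have "complex_of_real ((norm (left_regular s v))\<^sup>2) = complex_of_real ((norm v)\<^sup>2)"
    unfolding cinner_self[symmetric] by (rule cinner_left_regular)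
  thus ?thesis by (simp only: of_real_eq_iff power2_eq_iff_nonneg norm_ge_zero)
qed

lift_definition left_mult :: "'g::haar_group \<Rightarrow> 'g L2 bop" is left_regular
  by (rule bounded_clinearI[where K=1])
     (simp_all add: left_regular_add left_regular_scaleC norm_left_regular)

lemma left_mult_left_mult: "left_mult s * (left_mult t * T) = left_mult (s + t) * T"
  by (rule bop_eqI) (simp add: times_bop.rep_eq left_mult.rep_eq left_regular_left_regular)

lemma left_mult_zero: "left_mult 0 * T = T" "T * left_mult 0 = T"
  by (auto intro!: bop_eqI simp: times_bop.rep_eq left_mult.rep_eq left_regular_zero)

lemma star_left_mult: "star (left_mult s) = left_mult (- s)"
  by (rule bop_form_eqI) (simp add: cinner_star_bop' left_mult.rep_eq cinner_left_regular_left)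

lemma norm_left_mult_times: "norm (left_mult s * T) = norm T"
proof -
  have "norm (left_mult s * T) \<le> norm T" for s and T :: "'a L2 bop"
    by (rule norm_bop_bound)
       (simp_all add: times_bop.rep_eq left_mult.rep_eq norm_left_regular norm_bop_apply)
  from this[of s T] this[of "- s" "left_mult s * T"] show ?thesis
    by (simp add: left_mult_left_mult left_mult_zero)
qed

text \<open>The truncation keeps the values of modulus between \<open>1/(n+1)\<close> and
  \<open>n+1\<close>: the lower threshold makes it integrable, since
  \<open>\<bar>g\<bar> \<le> (n+1) \<bar>g\<bar>^2\<close> there, and the upper one makes it
  bounded.\<close>

lemma bounded_approx_L2:
  fixes v :: "'g::haar_group L2"
  assumes e: "0 < e"
  shows "\<exists>f M. sq_integrable f \<and> integrable msr f \<and> (\<forall>x. cmod (f x) \<le> M) \<and> norm (v - abs_L2 f) < e"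
proof -
  define g where "g = rep_L2 v"
  have g: "sq_integrable g" by (simp add: g_def sq_integrable_rep)
  have gm [measurable]: "g \<in> borel_measurable msr" and gi: "integrable msr (\<lambda>x. (cmod (g x))\<^sup>2)"
    using g by (simp_all add: sq_integrable_def)
  define f where "f n x = (if 1 / real (Suc n) \<le> cmod (g x) \<and> cmod (g x) \<le> real (Suc n) then g x else 0)" for n x
  have fm [measurable]: "f n \<in> borel_measurable msr" for n unfolding f_def by measurable
  have fsq: "sq_integrable (f n)" for n
    unfolding sq_integrable_def
    by (intro conjI fm Bochner_Integration.integrable_bound[OF gi]) (auto simp: f_def)
  have fint: "integrable msr (f n)" for n
  proof (rule Bochner_Integration.integrable_bound)
    show "integrable msr (\<lambda>x. real (Suc n) * (cmod (g x))\<^sup>2)" using gi by simp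
    have "cmod (f n x) \<le> real (Suc n) * (cmod (g x))\<^sup>2" for x
    proof (cases "1 / real (Suc n) \<le> cmod (g x)")
      case True
      hence "1 * cmod (g x) \<le> real (Suc n) * cmod (g x) * cmod (g x)"
        by (intro mult_right_mono) (auto simp: field_simps)
      moreover have "cmod (f n x) \<le> cmod (g x)" by (simp add: f_def)
      ultimately show ?thesis by (simp add: power2_eq_square mult.assoc)
    qed (auto simp: f_def)
    thus "AE x in msr. norm (f n x) \<le> norm (real (Suc n) * (cmod (g x))\<^sup>2)"
      by (intro AE_I2) (auto intro: order_trans[OF _ abs_ge_self])
  qed measurable
  have "(\<lambda>n. LINT x|msr. (cmod (g x - f n x))\<^sup>2) \<longlonglongrightarrow> (LINT x|(msr::'g measure). 0)"
  proof (rule integral_dominated_convergence[where w="\<lambda>x. (cmod (g x))\<^sup>2"])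
    have "(\<lambda>n. (cmod (g x - f n x))\<^sup>2) \<longlonglongrightarrow> 0" for x
    proof (cases "g x = 0")
      case True
      thus ?thesis by (simp add: f_def)
    next
      case False
      obtain N where N: "1 / cmod (g x) + cmod (g x) \<le> real N" using real_arch_simple by blast
      have "g x - f n x = 0" if "N \<le> n" for n
      proof -
        have n: "1 / cmod (g x) + cmod (g x) \<le> real (Suc n)" using N that by linarith
        have p: "0 < cmod (g x)" "0 < 1 / cmod (g x)" using False by auto
        have "1 / cmod (g x) \<le> real (Suc n)" using n p by linarith
        hence "1 / real (Suc n) \<le> cmod (g x)" using p by (simp add: field_simps)
        moreover have "cmod (g x) \<le> real (Suc n)" using n p by linarith
        ultimately show ?thesis by (simp add: f_def)
      qed
      hence "\<forall>\<^sub>F n in sequentially. (cmod (g x - f n x))\<^sup>2 = 0"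
        unfolding eventually_sequentially by (metis norm_zero power_zero_numeral)
      thus ?thesis by (rule tendsto_eventually)
    qed
    thus "AE x in msr. (\<lambda>n. (cmod (g x - f n x))\<^sup>2) \<longlonglongrightarrow> 0" by simp
    show "AE x in msr. norm ((cmod (g x - f n x))\<^sup>2) \<le> (cmod (g x))\<^sup>2" for n
      by (auto simp: f_def)
  qed (use gi in measurable)
  hence "\<forall>\<^sub>F n in sequentially. (LINT x|msr. (cmod (g x - f n x))\<^sup>2) < e\<^sup>2"
    using e order_tendstoD(2)[of _ _ sequentially "e\<^sup>2"] by simp
  then obtain n where n: "(LINT x|msr. (cmod (g x - f n x))\<^sup>2) < e\<^sup>2"
    using eventually_happens trivial_limit_sequentially by blast
  have "(norm (abs_L2 g - abs_L2 (f n)))\<^sup>2 < e\<^sup>2"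
    using n unfolding abs_L2_diff[OF g fsq]
    by (subst norm_abs_L2_sq)
       (use sq_integrable_add[OF g sq_integrable_scale[OF fsq[of n], of "-1"]] in simp_all)
  hence "norm (v - abs_L2 (f n)) < e"
    using e by (auto simp: g_def abs_rep_L2 intro: power2_less_imp_less)
  moreover have "cmod (f n x) \<le> real (Suc n)" for x by (simp add: f_def)
  ultimately show ?thesis using fsq fint by blast
qed

text \<open>For an integrable \<open>f\<close> bounded by \<open>M\<close>, the squared
  \<open>L^2\<close> distance to a translate is at most \<open>2 M\<close> times the
  \<open>L^1\<close> distance. Such \<open>f\<close> are dense, and translations are
  isometric.\<close>

lemma left_regular_tendsto: "((\<lambda>s. left_regular s v) \<longlongrightarrow> v) (nhds 0)"
proof (rule tendstoI)
  fix e :: real assume e: "0 < e"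
  obtain f M where f: "sq_integrable f" "integrable msr f" "\<And>x. cmod (f x) \<le> M" "norm (v - abs_L2 f) < e/3"
    using bounded_approx_L2[of "e/3" v] e by auto
  have M: "0 \<le> M" using f(3)[of undefined] norm_ge_zero order_trans by blast
  define d where "d = (e/3)\<^sup>2 / (2 * M + 1)"
  have d: "0 < d" using e M by (simp add: d_def)
  show "\<forall>\<^sub>F s in nhds 0. dist (left_regular s v) v < e"
    using translate_L1_continuous[OF f(2) d]
  proof eventually_elim
    case (elim s)
    let ?D = "\<lambda>t. f (- s + t) - f t"
    have fs: "sq_integrable (\<lambda>t. f (- s + t))" "integrable msr (\<lambda>t. f (- s + t))"
      using f by (auto intro: sq_integrable_translate integrable_translate)
    have D: "sq_integrable ?D"
      using sq_integrable_add[OF fs(1) sq_integrable_scale[OF f(1), of "-1"]] by simp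
    have "(norm (left_regular s (abs_L2 f) - abs_L2 f))\<^sup>2 = (LINT t|msr. (cmod (?D t))\<^sup>2)"
      unfolding left_regular_abs[OF f(1)] abs_L2_diff[OF fs(1) f(1)] by (rule norm_abs_L2_sq[OF D])
    also have "\<dots> \<le> (LINT t|msr. (2 * M) * cmod (?D t))"
    proof (rule integral_mono)
      show "integrable msr (\<lambda>t. (cmod (?D t))\<^sup>2)" using D by (simp add: sq_integrable_def)
      show "integrable msr (\<lambda>t. 2 * M * cmod (?D t))" using fs f by auto
      fix t
      have "cmod (?D t) \<le> 2 * M" using norm_triangle_ineq4[of "f (- s + t)" "f t"] f(3)[of t] f(3)[of "- s + t"] by linarith
      thus "(cmod (?D t))\<^sup>2 \<le> 2 * M * cmod (?D t)" by (simp add: power2_eq_square mult_right_mono)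
    qed
    also have "\<dots> = 2 * M * (LINT t|msr. cmod (?D t))" by simp
    also have "\<dots> \<le> (2 * M + 1) * (LINT t|msr. cmod (?D t))" by (intro mult_right_mono) auto
    also have "\<dots> < (2 * M + 1) * d" using elim M by (intro mult_strict_left_mono) auto
    also have "\<dots> = (e/3)\<^sup>2" using M by (simp add: d_def)
    finally have small: "norm (left_regular s (abs_L2 f) - abs_L2 f) < e/3"
      by (rule power2_less_imp_less) (use e in simp)
    have "left_regular s v - v = left_regular s (v - abs_L2 f) + (left_regular s (abs_L2 f) - abs_L2 f) + (abs_L2 f - v)"
      using left_regular_add[of s "v - abs_L2 f" "abs_L2 f"] by simp
    also have "norm \<dots> \<le> norm (left_regular s (v - abs_L2 f)) + norm (left_regular s (abs_L2 f) - abs_L2 f) + norm (abs_L2 f - v)"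
      by (intro norm_triangle_le add_mono order_refl norm_triangle_ineq)
    finally show ?case using small f(4) by (simp add: norm_left_regular dist_norm norm_minus_commute)
  qed
qed

text \<open>Left translation by \<open>- t\<close> moves the question of continuity at
  \<open>t\<close> to the neutral element.\<close>

lemma continuous_of_left_invariant_norm:
  fixes F :: "'g::haar_group \<Rightarrow> 'b::real_normed_vector"
  assumes inv: "\<And>s t. norm (F s - F t) = norm (F (- t + s) - F 0)"
    and lim: "(F \<longlongrightarrow> F 0) (nhds 0)"
  shows "continuous_on UNIV F"
proof (rule continuous_at_imp_continuous_on, rule ballI, unfold isCont_def tendsto_iff, intro allI impI)
  fix t and e :: real assume e: "0 < e"
  have "continuous_on UNIV (\<lambda>s::'g. - t + s)" by (intro continuous_intros)
  hence "((\<lambda>s. - t + s) \<longlongrightarrow> - t + t) (at t)" unfolding continuous_on_def by blast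
  hence "filterlim (\<lambda>s. - t + s) (nhds 0) (at t)" by simp
  from filterlim_compose[OF lim this] e
  have "\<forall>\<^sub>F s in at t. dist (F (- t + s)) (F 0) < e" by (auto simp: tendsto_iff)
  thus "\<forall>\<^sub>F s in at t. dist (F s) (F t) < e" by (simp add: dist_norm inv[symmetric])
qed

lemma continuous_left_regular: "continuous_on UNIV (\<lambda>s. left_regular s v)"
proof (rule continuous_of_left_invariant_norm)
  show "((\<lambda>s. left_regular s v) \<longlongrightarrow> left_regular 0 v) (nhds 0)"
    by (simp add: left_regular_zero left_regular_tendsto)
  fix s t
  have "left_regular (- t) (left_regular s v - left_regular t v) = left_regular (- t + s) v - left_regular 0 v"
    using left_regular_add[of "- t" "left_regular s v - left_regular t v" "left_regular t v"]
    by (simp add: left_regular_left_regular)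
  thus "norm (left_regular s v - left_regular t v) = norm (left_regular (- t + s) v - left_regular 0 v)"
    by (metis norm_left_regular)
qed

section \<open>Weak integrals of operators\<close>

definition weak_integral :: "('g::haar_group \<Rightarrow> complex) \<Rightarrow> ('g \<Rightarrow> 'h::chilbert_space bop) \<Rightarrow> 'h bop \<Rightarrow> bool" where
  "weak_integral f c T \<longleftrightarrow>
     (\<forall>v w. cinner (T $$ v) w = (LINT s|msr. f s * cinner (c s $$ v) w))"

lemma continuous_cinner_left:
  assumes "continuous_on S f"
  shows "continuous_on S (\<lambda>s. cinner (f s) (w::'h::chilbert_space))"
proof -
  have "bounded_linear (\<lambda>v. cinner v w)"
    by (rule bounded_linear_intro[where K="norm w"])
       (simp_all add: cinner_simps cinner_Cauchy_Schwarz scaleR_conv_of_real)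
  from bounded_linear.continuous_on[OF this assms] show ?thesis .
qed

text \<open>Strong continuity makes the matrix coefficients continuous, hence measurable, and the
  uniform bound makes them integrable against \<open>L^1\<close> functions. This is all that a weak
  integral requires.\<close>

locale bounded_operator_field =
  fixes c :: "'g::haar_group \<Rightarrow> 'h::chilbert_space bop" and C :: real
  assumes cont: "\<And>\<xi>. continuous_on UNIV (\<lambda>s. c s $$ \<xi>)"
    and bound: "\<And>s. norm (c s) \<le> C"
begin

lemma bound_nonneg: "0 \<le> C"
  using bound[of undefined] norm_ge_zero order_trans by blast

lemma form_bound: "cmod (cinner (c s $$ v) w) \<le> C * norm v * norm w"
  by (rule order_trans[OF cmod_form_le]) (intro mult_right_mono bound norm_ge_zero)

lemma integrable_form:
  assumes f: "integrable msr f"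
  shows "integrable msr (\<lambda>s. f s * cinner (c s $$ v) w)"
proof (rule Bochner_Integration.integrable_bound)
  show "integrable msr (\<lambda>s. (C * norm v * norm w) * cmod (f s))" using f by simp
  have [measurable]: "f \<in> borel_measurable msr" "(\<lambda>s. cinner (c s $$ v) w) \<in> borel_measurable msr"
    using f by (auto intro!: borel_measurable_msr_continuous continuous_cinner_left cont)
  show "(\<lambda>s. f s * cinner (c s $$ v) w) \<in> borel_measurable msr" by measurable
  show "AE s in msr. norm (f s * cinner (c s $$ v) w) \<le> norm ((C * norm v * norm w) * cmod (f s))"
  proof (rule AE_I2)
    fix s
    have "norm (f s * cinner (c s $$ v) w) \<le> cmod (f s) * (C * norm v * norm w)"
      unfolding norm_mult by (intro mult_left_mono form_bound) simp
    thus "norm (f s * cinner (c s $$ v) w) \<le> norm ((C * norm v * norm w) * cmod (f s))"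
      using bound_nonneg by (simp add: mult.commute)
  qed
qed

lemma integral_form_bound:
  assumes f: "integrable msr f"
  shows "cmod (LINT s|msr. f s * cinner (c s $$ v) w) \<le> (C * (LINT s|msr. cmod (f s))) * norm v * norm w"
proof -
  have "cmod (LINT s|msr. f s * cinner (c s $$ v) w) \<le> (LINT s|msr. cmod (f s * cinner (c s $$ v) w))"
    by (rule integral_norm_bound)
  also have "\<dots> \<le> (LINT s|msr. cmod (f s) * (C * norm v * norm w))"
  proof (rule integral_mono)
    show "integrable msr (\<lambda>s. cmod (f s * cinner (c s $$ v) w))"
      by (intro integrable_norm integrable_form f)
    show "integrable msr (\<lambda>s. cmod (f s) * (C * norm v * norm w))" using f by simp
    show "cmod (f s * cinner (c s $$ v) w) \<le> cmod (f s) * (C * norm v * norm w)" for s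
      unfolding norm_mult by (intro mult_left_mono form_bound) simp
  qed
  finally show ?thesis by (simp add: mult_ac)
qed

lemma weak_integral_exists:
  assumes f: "integrable msr f"
  shows "\<exists>T. weak_integral f c T"
  unfolding weak_integral_def
proof (rule bop_of_form_exists[OF _ _ _ _ integral_form_bound[OF f]])
  fix v v' w w' k
  let ?B = "\<lambda>v w. LINT s|msr. f s * cinner (c s $$ v) w"
  show "0 \<le> C * (LINT s|msr. cmod (f s))" using bound_nonneg by simp
  show "?B (v + v') w = ?B v w + ?B v' w"
    by (simp add: bop_add cinner_add_left distrib_left integrable_form[OF f])
  show "?B v (w + w') = ?B v w + ?B v w'"
    by (simp add: cinner_add_right distrib_left integrable_form[OF f])
  show "?B (k *\<^sub>C v) w = k * ?B v w"
    by (simp add: bop_scaleC cinner_scaleC_left mult.left_commute[of _ k])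
  show "?B v (k *\<^sub>C w) = cnj k * ?B v w"
    by (simp add: cinner_scaleC_right mult.left_commute[of _ "cnj k"])
qed

lemma weak_integral_norm:
  assumes f: "integrable msr f" and T: "weak_integral f c T"
  shows "norm T \<le> C * (LINT s|msr. cmod (f s))"
  using T integral_form_bound[OF f] bound_nonneg
  by (intro norm_bop_le_form) (auto simp: weak_integral_def)

lemma weak_integral_diff:
  assumes "integrable msr f" "integrable msr g" "weak_integral f c S" "weak_integral g c T"
  shows "weak_integral (\<lambda>s. f s - g s) c (S - T)"
  using assms by (simp add: weak_integral_def bop_simps cinner_simps left_diff_distrib integrable_form)

lemma weak_integral_add:
  assumes "integrable msr f" "integrable msr g" "weak_integral f c S" "weak_integral g c T"
  shows "weak_integral (\<lambda>s. f s + g s) c (S + T)"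
  using assms by (simp add: weak_integral_def bop_simps cinner_simps distrib_right integrable_form)

end

lemma weak_integral_unique: "weak_integral f c S \<Longrightarrow> weak_integral f c T \<Longrightarrow> S = T"
  by (rule bop_form_eqI) (simp add: weak_integral_def)

text \<open>The field \<open>\<lambda>_s\<close> is strongly continuous, but
  \<open>\<lambda>_s a\<close> with \<open>a\<close> in the reduced algebra is continuous in norm.
  Norm continuity is what keeps a weak integral inside a norm-closed subspace containing the values
  of the field.\<close>

locale norm_continuous_field =
  fixes c :: "'g::haar_group \<Rightarrow> 'h::chilbert_space bop" and C :: real
  assumes norm_cont: "continuous_on UNIV c" and norm_bound: "\<And>s. norm (c s) \<le> C"

lemma bounded_linear_bop_apply_left: "bounded_linear (\<lambda>T::'h::chilbert_space bop. T $$ v)"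
  by (rule bounded_linear_intro[where K="norm v"]) (simp_all add: bop_simps norm_bop_apply)

sublocale norm_continuous_field \<subseteq> bounded_operator_field
  by unfold_locales
     (rule bounded_linear.continuous_on[OF bounded_linear_bop_apply_left norm_cont], rule norm_bound)

text \<open>Approximation by Riemann sums, on a large compact part of \<open>B\<close>.\<close>

lemma (in norm_continuous_field) weak_integral_indicator_mem:
  assumes S: "closed S" "0 \<in> S" "\<And>x y. x \<in> S \<Longrightarrow> y \<in> S \<Longrightarrow> x + y \<in> S" "\<And>a x. x \<in> S \<Longrightarrow> a *\<^sub>C x \<in> S"
    and cS: "\<And>s. c s \<in> S"
    and B: "B \<in> sets msr" "emeasure msr B < \<infinity>" and T: "weak_integral (\<lambda>s. indicat_real B s *\<^sub>R a) c T"
  shows "T \<in> S"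
proof -
  define I where "I D v w = (LINT s|msr. indicat_real D s *\<^sub>R a * cinner (c s $$ v) w)" for D v w
  have fin_int: "integrable msr (\<lambda>s. indicat_real D s *\<^sub>R a)" if "D \<in> sets msr" "emeasure msr D < \<infinity>" for D
    using that by (intro integrable_scaleR_left) (auto simp: integrable_indicator_iff space_msr)
  have int: "integrable msr (\<lambda>s. indicat_real D s *\<^sub>R a * cinner (c s $$ v) w)"
    if "D \<in> sets msr" "emeasure msr D < \<infinity>" for D v w
    using that by (intro integrable_form fin_int)
  have I_split: "I (D \<union> E) v w = I D v w + I E v w"
    if "D \<in> sets msr" "emeasure msr D < \<infinity>" "E \<in> sets msr" "emeasure msr E < \<infinity>" "D \<inter> E = {}" for D E v w
  proof -
    have "indicat_real (D \<union> E) s = indicat_real D s + indicat_real E s" for s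
      using that(5) by (auto simp: indicator_def)
    thus ?thesis using int[OF that(1,2)] int[OF that(3,4)]
      by (simp add: I_def scaleR_add_left distrib_right)
  qed
  have sub: "D \<in> sets msr \<Longrightarrow> D \<subseteq> B \<Longrightarrow> emeasure msr D < \<infinity>" for D
    using emeasure_mono[of D B msr] B by (auto intro: order_le_less_trans)
  have close: "\<exists>T'\<in>S. norm (T - T') \<le> e * (C * cmod a) + e * cmod a * measure msr B" if e: "0 < e" for e
  proof -
    \<comment> \<open>Inner regularity concerns open sets, hence the detour through
      \<open>U\<close>. The set \<open>B \<inter> K\<close> need not be compact; it only has to be
      covered by finitely many of the sets that cover \<open>K\<close>.\<close>
    obtain U where U: "open U" "B \<subseteq> U" "emeasure msr U < \<infinity>"
      using outer_approx[OF B, of 1] by auto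
    obtain K where K: "compact K" "K \<subseteq> U" "measure msr (U - K) < e"
      using inner_approx[OF U(1,3) e] by auto
    have "open (c -` ball (c t) e)" for t
      by (rule open_vimage[OF open_ball norm_cont])
    moreover have "K \<subseteq> (\<Union>t\<in>K. c -` ball (c t) e)" using e by auto
    ultimately obtain F where F: "finite F" "K \<subseteq> (\<Union>t\<in>F. c -` ball (c t) e)"
      using compactE_image[OF K(1), of K "\<lambda>t. c -` ball (c t) e"] by metis
    \<comment> \<open>The induction makes the cover disjoint: the part of \<open>D\<close> where the
      field is \<open>e\<close>-close to \<open>c t\<close> contributes one Riemann summand, and the
      rest is left to the induction hypothesis.\<close>
    have approx: "\<exists>T'\<in>S. \<forall>v w. cmod (I D v w - cinner (T' $$ v) w) \<le> e * cmod a * measure msr D * norm v * norm w"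
      if "D \<in> sets msr" "D \<subseteq> B" "D \<subseteq> (\<Union>t\<in>F. c -` ball (c t) e)" for D
      using F(1) that
    proof (induction F arbitrary: D)
      case empty
      hence "I D v w = 0" for v w by (simp add: I_def)
      thus ?case using S(2) e by (intro bexI[of _ 0]) (simp_all add: bop_simps cinner_simps)
    next
      case (insert t F)
      define N where "N = c -` ball (c t) e"
      have N: "N \<in> sets msr" unfolding N_def by (intro open_sets_msr open_vimage[OF open_ball norm_cont])
      have DN: "D \<inter> N \<in> sets msr" "D - N \<in> sets msr" using insert.prems N by auto
      have fin: "emeasure msr (D \<inter> N) < \<infinity>" "emeasure msr (D - N) < \<infinity>"
        using sub[OF DN(1)] sub[OF DN(2)] insert.prems(2) by blast+
      have fD: "emeasure msr D < \<infinity>" using insert.prems(1,2) by (rule sub)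
      have "D - N \<subseteq> B" "D - N \<subseteq> (\<Union>t\<in>F. c -` ball (c t) e)"
        using insert.prems(2,3) by (auto simp: N_def)
      from insert.IH[OF DN(2) this] obtain T1 where T1: "T1 \<in> S" "\<And>v w. cmod (I (D - N) v w - cinner (T1 $$ v) w)
          \<le> e * cmod a * measure msr (D - N) * norm v * norm w"
        by blast
      define T2 where "T2 = (measure msr (D \<inter> N) *\<^sub>R a) *\<^sub>C c t"
      have T2: "T2 \<in> S" unfolding T2_def by (intro S(4) cS)
      have I2: "cmod (I (D \<inter> N) v w - cinner (T2 $$ v) w) \<le> e * cmod a * measure msr (D \<inter> N) * norm v * norm w" for v w
      proof -
        let ?g = "\<lambda>s. indicat_real (D \<inter> N) s *\<^sub>R a * cinner (c s $$ v) w" and ?h = "\<lambda>s. indicat_real (D \<inter> N) s *\<^sub>R a * cinner (c t $$ v) w"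
        let ?r = "\<lambda>s. indicat_real (D \<inter> N) s * (e * cmod a * norm v * norm w)"
        have ii: "integrable msr (indicat_real (D \<inter> N))"
          using DN fin by (simp add: integrable_indicator_iff space_msr)
        have cT: "cinner (T2 $$ v) w = (LINT s|msr. ?h s)"
          using ii fin by (simp add: T2_def bop_simps cinner_simps space_msr less_top scaleR_conv_of_real)
        have i2: "integrable msr (\<lambda>s. ?h s)"
          by (intro integrable_mult_left fin_int DN fin)
        have "cmod (I (D \<inter> N) v w - cinner (T2 $$ v) w) =
            cmod (LINT s|msr. ?g s - ?h s)"
          unfolding cT I_def using int[OF DN(1) fin(1)] i2 by simp
        also have "\<dots> \<le> (LINT s|msr. cmod (?g s - ?h s))"
          by (rule integral_norm_bound)
        also have "\<dots> \<le> (LINT s|msr. ?r s)"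
        proof (rule integral_mono)
          show "integrable msr (\<lambda>s. cmod (?g s - ?h s))"
            using int[OF DN(1) fin(1)] i2 by (intro integrable_norm Bochner_Integration.integrable_diff)
          show "integrable msr (\<lambda>s. ?r s)"
            using ii by simp
          fix s
          show "cmod (?g s - ?h s)
              \<le> ?r s"
          proof (cases "s \<in> D \<inter> N")
            case True
            have "norm (c s - c t) \<le> e" using True by (simp add: N_def dist_norm norm_minus_commute)
            hence "cmod (cinner ((c s - c t) $$ v) w) \<le> e * norm v * norm w"
              by (intro order_trans[OF cmod_form_le] mult_right_mono) auto
            hence "cmod a * cmod (cinner ((c s - c t) $$ v) w) \<le> cmod a * (e * norm v * norm w)"
              by (intro mult_left_mono) auto
            thus ?thesis using True
              by (simp add: bop_simps cinner_simps norm_mult[symmetric] right_diff_distrib mult_ac)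
          qed simp
        qed
        also have "\<dots> = e * cmod a * measure msr (D \<inter> N) * norm v * norm w"
          by (simp add: space_msr)
        finally show ?thesis .
      qed
      have "cmod (I D v w - cinner ((T1 + T2) $$ v) w) \<le> e * cmod a * measure msr D * norm v * norm w" for v w
      proof -
        have "I ((D - N) \<union> (D \<inter> N)) v w = I (D - N) v w + I (D \<inter> N) v w"
          by (intro I_split DN fin) blast
        moreover have "(D - N) \<union> (D \<inter> N) = D" by blast
        ultimately have I: "I D v w = I (D - N) v w + I (D \<inter> N) v w" by simp
        have "measure msr (D - D \<inter> N) = measure msr D - measure msr (D \<inter> N)"
          using fD DN insert.prems(1) by (intro measure_Diff) auto
        moreover have "D - D \<inter> N = D - N" by blast
        ultimately have m: "measure msr D = measure msr (D - N) + measure msr (D \<inter> N)" by simp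
        have "cmod (I D v w - cinner ((T1 + T2) $$ v) w) \<le>
          cmod (I (D - N) v w - cinner (T1 $$ v) w) + cmod (I (D \<inter> N) v w - cinner (T2 $$ v) w)"
          unfolding I bop_simps cinner_simps by (rule norm_diff_triangle_ineq)
        also have "\<dots> \<le> e * cmod a * measure msr (D - N) * norm v * norm w + e * cmod a * measure msr (D \<inter> N) * norm v * norm w"
          by (intro add_mono T1 I2)
        also have "\<dots> = e * cmod a * measure msr D * norm v * norm w"
          unfolding m by (simp add: algebra_simps)
        finally show ?thesis .
      qed
      thus ?case using S(3)[OF T1(1) T2] by blast
    qed
    have BK: "B \<inter> K \<in> sets msr" "B - K \<in> sets msr" using B K by (auto simp: compact_sets_msr)
    have finBK: "emeasure msr (B \<inter> K) < \<infinity>" "emeasure msr (B - K) < \<infinity>" using sub[OF BK(1)] sub[OF BK(2)] by blast+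
    obtain T' where T': "T' \<in> S" "\<And>v w. cmod (I (B \<inter> K) v w - cinner (T' $$ v) w)
        \<le> e * cmod a * measure msr (B \<inter> K) * norm v * norm w"
      using approx[of "B \<inter> K"] BK F(2) by blast
    \<comment> \<open>The first error term comes from \<open>B - K\<close>, which has measure at
      most \<open>e\<close>; the second comes from the Riemann sum on
      \<open>B \<inter> K\<close>.\<close>
    have "norm (T - T') \<le> e * (C * cmod a) + e * cmod a * measure msr B"
    proof (rule norm_bop_le_form)
      show "0 \<le> e * (C * cmod a) + e * cmod a * measure msr B" using e bound_nonneg by simp
      fix v w
      have "I ((B - K) \<union> (B \<inter> K)) v w = I (B - K) v w + I (B \<inter> K) v w"
        by (intro I_split BK finBK) blast
      moreover have "(B - K) \<union> (B \<inter> K) = B" by blast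
      ultimately have IB: "I B v w = I (B - K) v w + I (B \<inter> K) v w" by simp
      have "measure msr (B - K) \<le> measure msr (U - K)"
        using U BK K by (intro measure_mono_fmeasurable)
          (auto simp: fmeasurable_def open_sets_msr compact_sets_msr intro: order_le_less_trans[OF emeasure_mono])
      hence mBK: "measure msr (B - K) \<le> e" using K(3) by linarith
      have "cmod (I (B - K) v w) \<le> (C * (LINT s|msr. cmod (indicat_real (B - K) s *\<^sub>R a))) * norm v * norm w"
        unfolding I_def by (rule integral_form_bound[OF fin_int[OF BK(2) finBK(2)]])
      also have "(LINT s|msr. cmod (indicat_real (B - K) s *\<^sub>R a)) = measure msr (B - K) * cmod a"
        by (simp add: space_msr)
      also have "C * (measure msr (B - K) * cmod a) * norm v * norm w \<le> C * (e * cmod a) * norm v * norm w"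
        by (intro mult_right_mono mult_left_mono mBK bound_nonneg norm_ge_zero)
      finally have 1: "cmod (I (B - K) v w) \<le> e * (C * cmod a) * norm v * norm w" by (simp add: mult_ac)
      have "cmod (I (B \<inter> K) v w - cinner (T' $$ v) w) \<le> e * cmod a * measure msr (B \<inter> K) * norm v * norm w"
        by (rule T')
      also have "\<dots> \<le> e * cmod a * measure msr B * norm v * norm w"
        using e B BK by (intro mult_right_mono mult_left_mono measure_mono_fmeasurable) (auto simp: fmeasurable_def)
      finally have 2: "cmod (I (B \<inter> K) v w - cinner (T' $$ v) w) \<le> e * cmod a * measure msr B * norm v * norm w" .
      have "cinner (T $$ v) w = I B v w"
        using T unfolding weak_integral_def I_def by blast
      hence "cinner ((T - T') $$ v) w = I (B - K) v w + (I (B \<inter> K) v w - cinner (T' $$ v) w)"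
        by (simp add: IB bop_simps cinner_simps)
      hence "cmod (cinner ((T - T') $$ v) w) \<le> cmod (I (B - K) v w) + cmod (I (B \<inter> K) v w - cinner (T' $$ v) w)"
        by (simp add: norm_triangle_ineq)
      thus "cmod (cinner ((T - T') $$ v) w) \<le> (e * (C * cmod a) + e * cmod a * measure msr B) * norm v * norm w"
        using 1 2 by (simp add: distrib_right)
    qed
    thus ?thesis using T'(1) by blast
  qed
  have "T \<in> closure S"
    unfolding closure_approachable_le
  proof (intro allI impI)
    fix d :: real assume d: "0 < d"
    define M where "M = C * cmod a + cmod a * measure msr B"
    have M: "0 \<le> M" using bound_nonneg by (simp add: M_def)
    define e where "e = d / (M + 1)"
    have e: "0 < e" "e * M \<le> d" using M d by (auto simp: e_def field_simps)
    obtain T' where "T' \<in> S" "norm (T - T') \<le> e * M"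
      using close[OF e(1)] by (auto simp: M_def distrib_left mult.assoc)
    thus "\<exists>y\<in>S. dist y T \<le> d" using e by (auto simp: dist_norm norm_minus_commute intro!: bexI[of _ T'])
  qed
  thus ?thesis using S(1) by simp
qed

text \<open>Indicators are settled by Riemann sums. Sums use the uniqueness of weak integrals, and
  limits use that the norm of a weak integral is bounded by the \<open>L^1\<close> norm.\<close>

lemma (in norm_continuous_field) weak_integral_mem:
  assumes S: "closed S" "0 \<in> S" "\<And>x y. x \<in> S \<Longrightarrow> y \<in> S \<Longrightarrow> x + y \<in> S" "\<And>a x. x \<in> S \<Longrightarrow> a *\<^sub>C x \<in> S"
    and cS: "\<And>s. c s \<in> S"
    and f: "integrable msr f" and T: "weak_integral f c T"
  shows "T \<in> S"
  using f T
proof (induction f arbitrary: T rule: integrable_induct)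
  case (base A a)
  show ?case by (rule weak_integral_indicator_mem[OF S cS base.hyps base.prems])
next
  case (add f g)
  obtain Tf Tg where T: "weak_integral f c Tf" "weak_integral g c Tg"
    using weak_integral_exists add.hyps by meson
  hence "T = Tf + Tg" using weak_integral_unique[OF add.prems weak_integral_add] add.hyps by blast
  thus ?case using add.IH T S(3) by blast
next
  case (lim f u)
  obtain W where W: "\<And>i. weak_integral (u i) c (W i)"
    using weak_integral_exists[OF lim.hyps(1)] by metis
  have L1: "(\<lambda>i. LINT t|msr. cmod (u i t - f t)) \<longlonglongrightarrow> 0"
    by (rule L1_dominated_tendsto[OF lim.hyps(1,4,2,3)])
  hence "(\<lambda>i. C * (LINT t|msr. cmod (u i t - f t))) \<longlonglongrightarrow> 0"
    by (rule tendsto_mult_right_zero)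
  hence "(\<lambda>i. W i - T) \<longlonglongrightarrow> 0"
    by (rule Lim_null_comparison[rotated])
       (intro always_eventually allI weak_integral_norm[OF _ weak_integral_diff[OF lim.hyps(1,4) W lim.prems]]
          Bochner_Integration.integrable_diff lim.hyps)
  hence "W \<longlonglongrightarrow> T" by (simp add: LIM_zero_iff)
  moreover have "W i \<in> S" for i using lim.IH W by blast
  ultimately show ?case using closed_sequentially[OF S(1)] by blast
qed

section \<open>The reduced group \<open>C\<^sup>*\<close>-algebra\<close>

interpretation left_mult: bounded_operator_field "left_mult :: 'g::haar_group \<Rightarrow> 'g L2 bop" 1
proof
  show "norm (left_mult s :: 'g L2 bop) \<le> 1" for s
    by (rule norm_bop_bound) (simp_all add: left_mult.rep_eq norm_left_regular)
qed (simp add: left_mult.rep_eq continuous_left_regular)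

definition convolutions :: "'g::haar_group L2 bop set" where
  "convolutions = {T. \<exists>f. integrable msr f \<and> weak_integral f left_mult T}"

lemma reduced_group_cstar_eq: "reduced_group_cstar = closure convolutions"
  unfolding reduced_group_cstar_def convolutions_def weak_integral_def left_mult.rep_eq ..

abbreviation (input) CrG :: "'g::haar_group L2 bop set" where
  "CrG \<equiv> reduced_group_cstar"

lemma convolutions_subset: "convolutions \<subseteq> CrG"
  unfolding reduced_group_cstar_eq by (rule closure_subset)

lemma convolutions_zero: "0 \<in> convolutions"
  unfolding convolutions_def mem_Collect_eq
  by (rule exI[of _ "\<lambda>_. 0"]) (simp add: weak_integral_def bop_simps cinner_simps)

lemma convolutions_add:
  "S \<in> convolutions \<Longrightarrow> T \<in> convolutions \<Longrightarrow> S + T \<in> convolutions"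
  unfolding convolutions_def
  using left_mult.weak_integral_add Bochner_Integration.integrable_add by blast

lemma convolutions_scaleC:
  assumes "T \<in> convolutions" shows "c *\<^sub>C T \<in> convolutions"
proof -
  obtain f where f: "integrable msr f" "weak_integral f left_mult T"
    using assms by (auto simp: convolutions_def)
  have "integrable msr (\<lambda>s. c * f s)" using f by simp
  moreover have "weak_integral (\<lambda>s. c * f s) left_mult (c *\<^sub>C T)"
    using f by (simp add: weak_integral_def bop_simps cinner_simps mult.assoc)
  ultimately show ?thesis by (auto simp: convolutions_def)
qed

lemma closed_reduced: "closed CrG"
  by (simp add: reduced_group_cstar_eq)

lemma reduced_zero: "0 \<in> CrG"
  using convolutions_zero convolutions_subset by blast

lemma reduced_add:
  assumes "S \<in> CrG" "T \<in> CrG" shows "S + T \<in> CrG"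
proof -
  obtain u v where "\<And>n. u n \<in> convolutions" "u \<longlonglongrightarrow> S" "\<And>n. v n \<in> convolutions" "v \<longlonglongrightarrow> T"
    using assms unfolding reduced_group_cstar_eq closure_sequential by blast
  thus ?thesis unfolding reduced_group_cstar_eq closure_sequential
    by (intro exI[of _ "\<lambda>n. u n + v n"]) (auto intro: convolutions_add tendsto_add)
qed

lemma reduced_image_mem:
  assumes F: "bounded_linear F" and gen: "\<And>T. T \<in> convolutions \<Longrightarrow> F T \<in> CrG"
    and a: "a \<in> CrG"
  shows "F a \<in> CrG"
proof -
  obtain u where u: "\<And>n. u n \<in> convolutions" "u \<longlonglongrightarrow> a"
    using a unfolding reduced_group_cstar_eq closure_sequential by blast
  show ?thesis
    using closed_sequentially[OF closed_reduced gen[OF u(1)] bounded_linear.tendsto[OF F u(2)]] by simp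
qed

lemma bounded_linear_scaleC: "bounded_linear (\<lambda>T::'h::chilbert_space bop. c *\<^sub>C T)"
  by (rule bounded_linear_intro[where K="cmod c"])
     (simp_all add: scaleC_add_right scaleR_scaleC scaleC_scaleC mult.commute norm_scaleC)

lemma reduced_scaleC: "T \<in> CrG \<Longrightarrow> c *\<^sub>C T \<in> CrG"
  by (rule reduced_image_mem[OF bounded_linear_scaleC])
     (use convolutions_scaleC convolutions_subset in blast)

lemma left_mult_convolution:
  assumes "integrable msr f" "weak_integral f left_mult T"
  shows "weak_integral (\<lambda>t. f (- s + t)) left_mult (left_mult s * T)"
  unfolding weak_integral_def
proof (intro allI)
  fix v w
  have "cinner ((left_mult s * T) $$ v) w = cinner (T $$ v) (left_regular (- s) w)"
    by (simp add: times_bop.rep_eq left_mult.rep_eq cinner_left_regular_left)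
  also have "\<dots> = (LINT t|msr. f t * cinner (left_regular t v) (left_regular (- s) w))"
    using assms(2) by (simp add: weak_integral_def left_mult.rep_eq)
  also have "\<dots> = (LINT t|msr. f (- s + t) * cinner (left_regular (- s + t) v) (left_regular (- s) w))"
    using integral_translate[of "\<lambda>t. f t * cinner (left_regular t v) (left_regular (- s) w)" "- s"]
      borel_measurable_integrable[OF left_mult.integrable_form[OF assms(1), of v "left_regular (- s) w"]]
    by (simp add: left_mult.rep_eq)
  also have "\<dots> = (LINT t|msr. f (- s + t) * cinner (left_mult t $$ v) w)"
    using cinner_left_regular_left[of s _ w]
    by (simp add: cinner_left_regular_left[symmetric] left_regular_left_regular left_mult.rep_eq add.assoc[symmetric])
  finally show "cinner ((left_mult s * T) $$ v) w =
      (LINT t|msr. f (- s + t) * cinner (left_mult t $$ v) w)" .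
qed

lemma reduced_left_mult: "a \<in> CrG \<Longrightarrow> left_mult s * a \<in> CrG"
proof (rule reduced_image_mem[OF bounded_linear_mult_right])
  fix T :: "'a L2 bop" assume "T \<in> convolutions"
  then obtain f where f: "integrable msr f" "weak_integral f left_mult T"
    by (auto simp: convolutions_def)
  have "left_mult s * T \<in> convolutions"
    unfolding convolutions_def mem_Collect_eq
    by (rule exI, rule conjI[OF integrable_translate[OF f(1)] left_mult_convolution[OF f]])
  thus "left_mult s * T \<in> CrG" using convolutions_subset by blast
qed

text \<open>Multiplying \<open>\<lambda>(f)\<close> by \<open>\<lambda>_s\<close> translates
  \<open>f\<close>, so continuity of translation in \<open>L^1\<close> gives convergence in operator
  norm; density of the convolution operators extends it to the algebra.\<close>

lemma left_mult_tendsto: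
  fixes a :: "'g::haar_group L2 bop"
  assumes a: "a \<in> CrG"
  shows "((\<lambda>s. left_mult s * a) \<longlongrightarrow> a) (nhds 0)"
proof (rule tendstoI)
  fix e :: real assume e: "0 < e"
  obtain T where T: "T \<in> convolutions" "dist T a < e/3"
    using a e unfolding reduced_group_cstar_eq closure_approachable by (metis divide_pos_pos zero_less_numeral)
  obtain f where f: "integrable msr f" "weak_integral f left_mult T"
    using T by (auto simp: convolutions_def)
  have "\<forall>\<^sub>F s in nhds 0. (LINT t|msr. cmod (f (- s + t) - f t)) < e/3"
    by (rule translate_L1_continuous[OF f(1)]) (use e in simp)
  thus "\<forall>\<^sub>F s in nhds 0. dist (left_mult s * a) a < e"
  proof eventually_elim
    case (elim s)
    have "norm (left_mult s * T - T) \<le> 1 * (LINT t|msr. cmod (f (- s + t) - f t))"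
      by (intro left_mult.weak_integral_norm left_mult.weak_integral_diff left_mult_convolution f
          Bochner_Integration.integrable_diff integrable_translate)
    hence "norm (left_mult s * T - T) < e/3" using elim by simp
    moreover have "left_mult s * a - a = left_mult s * (a - T) + (left_mult s * T - T) + (T - a)"
      by (simp add: algebra_simps)
    moreover have "norm (left_mult s * (a - T) + (left_mult s * T - T) + (T - a)) \<le>
        norm (left_mult s * (a - T)) + norm (left_mult s * T - T) + norm (T - a)"
      by (intro norm_triangle_le add_mono order_refl norm_triangle_ineq)
    ultimately show ?case using T(2) by (simp add: norm_left_mult_times dist_norm norm_minus_commute)
  qed
qed

lemma norm_continuous_field_left_mult:
  assumes a: "a \<in> CrG"
  shows "norm_continuous_field (\<lambda>s. left_mult s * a) (norm a)"
proof
  show "continuous_on UNIV (\<lambda>s. left_mult s * a)"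
  proof (rule continuous_of_left_invariant_norm)
    show "((\<lambda>s. left_mult s * a) \<longlongrightarrow> left_mult 0 * a) (nhds 0)"
      using left_mult_tendsto[OF a] by (simp add: left_mult_zero)
    show "norm (left_mult s * a - left_mult t * a) = norm (left_mult (- t + s) * a - left_mult 0 * a)" for s t
      using norm_left_mult_times[of "- t" "left_mult s * a - left_mult t * a"]
      by (simp add: right_diff_distrib left_mult_left_mult)
  qed
qed (simp add: norm_left_mult_times)

lemma norm_continuous_field_left_mult_minus:
  assumes a: "a \<in> CrG"
  shows "norm_continuous_field (\<lambda>s. left_mult (- s) * a) (norm a)"
proof
  interpret norm_continuous_field "\<lambda>s. left_mult s * a" "norm a"
    by (rule norm_continuous_field_left_mult[OF a])
  show "continuous_on UNIV (\<lambda>s. left_mult (- s) * a)"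
    by (rule continuous_on_compose2[OF norm_cont]) (auto intro: continuous_intros)
qed (simp add: norm_left_mult_times)

section \<open>Products, adjoints and approximate units\<close>

lemma weak_integral_times:
  "weak_integral f c T \<Longrightarrow> weak_integral f (\<lambda>s. c s * a) (T * a)"
  by (simp add: weak_integral_def times_bop.rep_eq)

text \<open>The adjoint of \<open>\<lambda>(f)\<close> integrates inverse translations against
  \<open>cnj f\<close>. The inversion stays on the operator side, since Haar measure need not be
  invariant under it.\<close>

lemma weak_integral_star_left_mult:
  assumes T: "weak_integral f left_mult T"
  shows "weak_integral (\<lambda>s. cnj (f s)) (\<lambda>s. left_mult (- s) * a) (star T * a)"
  unfolding weak_integral_def
proof (intro allI)
  fix v w
  have "cinner ((star T * a) $$ v) w = cnj (cinner (T $$ w) (a $$ v))"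
    using cinner_commute by (simp add: times_bop.rep_eq cinner_star_bop')
  also have "\<dots> = (LINT s|msr. cnj (f s * cinner (left_regular s w) (a $$ v)))"
    using T by (simp add: weak_integral_def left_mult.rep_eq del: complex_cnj_mult)
  also have "\<dots> = (LINT s|msr. cnj (f s) * cinner ((left_mult (- s) * a) $$ v) w)"
  proof (intro Bochner_Integration.integral_cong refl)
    fix s
    have "cnj (cinner (left_regular s w) (a $$ v)) = cinner (a $$ v) (left_regular s w)"
      by (metis cinner_commute)
    thus "cnj (f s * cinner (left_regular s w) (a $$ v)) =
        cnj (f s) * cinner ((left_mult (- s) * a) $$ v) w"
      by (simp add: times_bop.rep_eq left_mult.rep_eq cinner_left_regular_left)
  qed
  finally show "cinner ((star T * a) $$ v) w =
      (LINT s|msr. cnj (f s) * cinner ((left_mult (- s) * a) $$ v) w)" .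
qed

text \<open>For a convolution operator \<open>T\<close>, the product \<open>T * a\<close> is a weak
  integral of the norm continuous field \<open>\<lambda>_s a\<close>, whose values lie in the
  algebra. No convolution of functions, and so no interchange of integrals, is involved.\<close>

lemma reduced_mult:
  assumes S: "S \<in> CrG" and a: "a \<in> CrG"
  shows "S * a \<in> CrG"
  using S
proof (rule reduced_image_mem[OF bounded_linear_mult_left, rotated])
  interpret norm_continuous_field "\<lambda>s. left_mult s * a" "norm a"
    by (rule norm_continuous_field_left_mult[OF a])
  fix T :: "'a L2 bop" assume "T \<in> convolutions"
  then obtain f where f: "integrable msr f" "weak_integral f left_mult T" by (auto simp: convolutions_def)
  show "T * a \<in> CrG"
    by (rule weak_integral_mem[OF closed_reduced reduced_zero reduced_add reduced_scaleC
          reduced_left_mult[OF a] f(1) weak_integral_times[OF f(2)]])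
qed

lemma reduced_star_convolution_mult:
  assumes T: "T \<in> convolutions" and a: "a \<in> CrG"
  shows "star T * a \<in> CrG"
proof -
  interpret norm_continuous_field "\<lambda>s. left_mult (- s) * a" "norm a"
    by (rule norm_continuous_field_left_mult_minus[OF a])
  obtain f where f: "integrable msr f" "weak_integral f left_mult T" using T by (auto simp: convolutions_def)
  have cf: "integrable msr (\<lambda>s. cnj (f s))" using f(1) by simp
  show ?thesis
    by (rule weak_integral_mem[OF closed_reduced reduced_zero reduced_add reduced_scaleC
          reduced_left_mult[OF a] cf weak_integral_star_left_mult[OF f(2)]])
qed

text \<open>\<open>T\<close> is the mean of \<open>c\<close> over \<open>V\<close>, and the mean of
  the constant \<open>a\<close> is \<open>a\<close>. The comparison is made on matrix coefficients,
  as the integral is a weak one.\<close>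

lemma (in bounded_operator_field) average_approx:
  assumes V: "V \<in> sets msr" "emeasure msr V < \<infinity>" "emeasure msr V \<noteq> 0"
    and T: "weak_integral (\<lambda>s. indicat_real V s *\<^sub>R complex_of_real (1 / measure msr V)) c T"
    and close: "\<And>s. s \<in> V \<Longrightarrow> norm (c s - a) \<le> d" and d: "0 \<le> d"
  shows "norm (T - a) \<le> d"
proof (rule norm_bop_le_form[OF d])
  fix v w
  define r where "r = complex_of_real (1 / measure msr V)"
  let ?g = "\<lambda>s. indicat_real V s *\<^sub>R r * cinner (c s $$ v) w" and ?h = "\<lambda>s. indicat_real V s *\<^sub>R r * cinner (a $$ v) w"
  let ?d = "\<lambda>s. indicat_real V s *\<^sub>R r * cinner ((c s - a) $$ v) w"
  let ?r = "\<lambda>s. indicat_real V s * (1 / measure msr V * (d * norm v * norm w))"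
  have mV: "0 < measure msr V" using V by (simp add: measure_def enn2real_positive_iff less_top zero_less_iff_neq_zero)
  have iV: "integrable msr (indicat_real V)" using V by (simp add: integrable_indicator_iff space_msr)
  have fi: "integrable msr (\<lambda>s. indicat_real V s *\<^sub>R r)" using iV by (intro integrable_scaleR_left)
  have "(LINT s|msr. ?h s) = cinner (a $$ v) w"
    using mV iV V by (simp add: r_def space_msr scaleR_conv_of_real)
  hence "cinner ((T - a) $$ v) w =
     (LINT s|msr. ?g s) - (LINT s|msr. ?h s)"
    using T by (simp only: weak_integral_def r_def minus_bop.rep_eq cinner_diff_left)
  also have "\<dots> = (LINT s|msr. ?d s)"
    unfolding minus_bop.rep_eq cinner_diff_left right_diff_distrib
    by (rule Bochner_Integration.integral_diff[OF integrable_form[OF fi] integrable_mult_left[OF fi], symmetric])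
  also have "cmod \<dots> \<le> (LINT s|msr. cmod (?d s))"
    by (rule integral_norm_bound)
  also have "\<dots> \<le> (LINT s|msr. ?r s)"
  proof (rule integral_mono)
    have "integrable msr (\<lambda>s. ?g s - ?h s)"
      by (intro Bochner_Integration.integrable_diff integrable_form fi integrable_mult_left)
    thus "integrable msr (\<lambda>s. cmod (?d s))"
      unfolding minus_bop.rep_eq cinner_diff_left right_diff_distrib by (rule integrable_norm)
    show "integrable msr (\<lambda>s. ?r s)"
      using iV by (intro integrable_mult_left)
    fix s
    show "cmod (?d s) \<le>
        ?r s"
    proof (cases "s \<in> V")
      case True
      have "cmod (cinner ((c s - a) $$ v) w) \<le> d * norm v * norm w"
        by (rule order_trans[OF cmod_form_le]) (intro mult_right_mono close True norm_ge_zero)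
      hence "1 / measure msr V * cmod (cinner ((c s - a) $$ v) w) \<le> 1 / measure msr V * (d * norm v * norm w)"
        by (rule mult_left_mono) simp
      thus ?thesis using True by (simp add: norm_mult r_def norm_divide)
    qed simp
  qed
  also have "\<dots> = d * norm v * norm w" using mV V by (simp add: space_msr)
  finally show "cmod (cinner ((T - a) $$ v) w) \<le> d * norm v * norm w" .
qed

text \<open>The witness is \<open>\<lambda>\<close> of the normalized indicator of a neighbourhood
  of 0 inside \<open>P\<close>: openness makes its measure positive, a compact superset makes it
  finite. Leaving \<open>P\<close> open lets the caller treat several \<open>a\<close> at once. The
  estimate for \<open>star e\<close> is separate because closure of the algebra under adjoints is
  derived from it.\<close>

lemma approximate_unit:
  assumes U: "\<forall>\<^sub>F s::'g::haar_group in nhds 0. P s"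
  shows "\<exists>e :: 'g L2 bop. e \<in> convolutions \<and> norm e \<le> 1 \<and>
     (\<forall>a d. 0 \<le> d \<longrightarrow> (\<forall>s. P s \<longrightarrow> norm (left_mult s * a - a) \<le> d) \<longrightarrow> a \<in> CrG \<longrightarrow> norm (e * a - a) \<le> d) \<and>
     (\<forall>a d. 0 \<le> d \<longrightarrow> (\<forall>s. P s \<longrightarrow> norm (left_mult (- s) * a - a) \<le> d) \<longrightarrow> a \<in> CrG \<longrightarrow> norm (star e * a - a) \<le> d)"
proof -
  obtain W where W: "open W" "0 \<in> W" "\<And>s. s \<in> W \<Longrightarrow> P s" using U unfolding eventually_nhds by blast
  obtain N K where N: "open N" "compact K" "(0::'g) \<in> N" "N \<subseteq> K" using locally_compact by blast
  define V where "V = W \<inter> N"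
  have V: "V \<in> sets msr" "emeasure msr V < \<infinity>" "emeasure msr V \<noteq> 0"
  proof -
    have "open V" "0 \<in> V" using W N by (auto simp: V_def)
    thus "V \<in> sets msr" "emeasure msr V \<noteq> 0" using emeasure_open_pos by (auto intro: open_sets_msr)
    have "emeasure msr V \<le> emeasure msr K" using N by (intro emeasure_mono compact_sets_msr) (auto simp: V_def)
    thus "emeasure msr V < \<infinity>" using msr_compact_finite[OF N(2)] by (rule order_le_less_trans)
  qed
  define r where "r = complex_of_real (1 / measure msr V)"
  define f where "f s = indicat_real V s *\<^sub>R r" for s
  have mV: "0 < measure msr V" using V by (simp add: measure_def enn2real_positive_iff less_top zero_less_iff_neq_zero)
  have f: "integrable msr f" unfolding f_def using V by (intro integrable_scaleR_left) (simp add: integrable_indicator_iff space_msr)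
  obtain e where e: "weak_integral f left_mult e" using left_mult.weak_integral_exists[OF f] by blast
  have "norm e \<le> 1 * (LINT s|msr. cmod (f s))" by (rule left_mult.weak_integral_norm[OF f e])
  also have "\<dots> = 1" using mV by (simp add: f_def r_def space_msr norm_divide)
  finally have ne: "norm e \<le> 1" .
  have 1: "norm (e * a - a) \<le> d" if a: "a \<in> CrG" "0 \<le> d" "\<And>s. P s \<Longrightarrow> norm (left_mult s * a - a) \<le> d" for a d
  proof -
    interpret norm_continuous_field "\<lambda>s. left_mult s * a" "norm a"
      by (rule norm_continuous_field_left_mult[OF a(1)])
    show ?thesis
    proof (rule average_approx[OF V _ _ a(2)])
      show "weak_integral (\<lambda>s. indicat_real V s *\<^sub>R complex_of_real (1 / measure msr V)) (\<lambda>s. left_mult s * a) (e * a)"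
        using weak_integral_times[OF e] unfolding f_def r_def .
      show "norm (left_mult s * a - a) \<le> d" if "s \<in> V" for s
        using that W(3) a(3) by (simp add: V_def)
    qed
  qed
  have 2: "norm (star e * a - a) \<le> d" if a: "a \<in> CrG" "0 \<le> d" "\<And>s. P s \<Longrightarrow> norm (left_mult (- s) * a - a) \<le> d" for a d
  proof -
    interpret norm_continuous_field "\<lambda>s. left_mult (- s) * a" "norm a"
      by (rule norm_continuous_field_left_mult_minus[OF a(1)])
    have cf: "cnj (f s) = f s" for s by (simp add: f_def r_def)
    show ?thesis
    proof (rule average_approx[OF V _ _ a(2)])
      show "weak_integral (\<lambda>s. indicat_real V s *\<^sub>R complex_of_real (1 / measure msr V)) (\<lambda>s. left_mult (- s) * a) (star e * a)"
        using weak_integral_star_left_mult[OF e] unfolding cf unfolding f_def r_def .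
      show "norm (left_mult (- s) * a - a) \<le> d" if "s \<in> V" for s
        using that W(3) a(3) by (simp add: V_def)
    qed
  qed
  have "e \<in> convolutions" using f e by (auto simp: convolutions_def)
  thus ?thesis using ne 1 2 by blast
qed

text \<open>For a convolution operator \<open>T\<close>, \<open>T\<^sup>* e\<close> is a Riemann integral over elements of the algebra, and
  \<open>T\<^sup>* e - T\<^sup>*\<close> is the adjoint of \<open>e\<^sup>* T - T\<close>, which is small for an approximate unit \<open>e\<close>. This
  avoids the modular function.\<close>

lemma reduced_star:
  assumes "a \<in> CrG"
  shows "star a \<in> (CrG :: 'g::haar_group L2 bop set)"
  using assms
proof (rule reduced_image_mem[rotated 2])
  show "bounded_linear (star :: 'g L2 bop \<Rightarrow> 'g L2 bop)"
    by (rule bounded_linear_intro[where K=1]) (simp_all add: star_add star_scaleR norm_star)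
  fix T :: "'g L2 bop" assume T: "T \<in> convolutions"
  hence TA: "T \<in> CrG" using convolutions_subset by blast
  have "star T \<in> closure CrG"
    unfolding closure_approachable_le
  proof (intro allI impI)
    fix d :: real assume d: "0 < d"
    have "((\<lambda>s::'g. - s) \<longlongrightarrow> 0) (nhds 0)"
      using tendsto_minus[OF filterlim_ident, of "0::'g"] by simp
    from filterlim_compose[OF left_mult_tendsto[OF TA] this]
    have "\<forall>\<^sub>F s in nhds 0. dist (left_mult (- s) * T) T < d" using d by (rule tendstoD)
    from approximate_unit[OF this] obtain e :: "'g L2 bop" where
      e: "e \<in> convolutions" "norm (star e * T - T) \<le> d"
      using d TA by (auto simp: dist_norm)
    have "star T * e \<in> CrG"
      using reduced_star_convolution_mult[OF T] e(1) convolutions_subset by blast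
    moreover have "norm (star T * e - star T) \<le> d"
      using e(2) norm_star[of "star e * T - T"] by (simp add: star_diff star_mult star_star)
    ultimately show "\<exists>y\<in>CrG. dist y (star T) \<le> d" by (auto simp: dist_norm)
  qed
  thus "star T \<in> CrG" unfolding closure_closed[OF closed_reduced] .
qed

lemma cstar_subalgebra_reduced: "cstar_subalgebra CrG"
  by (simp add: cstar_subalgebra_def closed_reduced reduced_zero reduced_add reduced_mult reduced_scaleC reduced_star)

lemma reduced_right_mult:
  assumes "a \<in> CrG" shows "a * left_mult s \<in> CrG"
  using reduced_star[OF reduced_left_mult[OF reduced_star[OF assms], of "- s"]]
  by (simp add: star_mult star_star star_left_mult)

lemma reduced_approximate_unit:
  assumes "finite F" "F \<subseteq> (CrG :: 'g::haar_group L2 bop set)" "0 < d"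
  shows "\<exists>e\<in>CrG. norm e \<le> 1 \<and> (\<forall>a\<in>F. norm (e * a - a) \<le> d)"
proof -
  have "\<forall>\<^sub>F s in nhds 0. \<forall>a\<in>F. dist (left_mult s * a) a < d"
    using assms by (intro eventually_ball_finite ballI tendstoD[OF left_mult_tendsto]) auto
  from approximate_unit[OF this] obtain e :: "'g L2 bop" where
    "e \<in> convolutions" "norm e \<le> 1" "\<And>a d'. 0 \<le> d' \<Longrightarrow>
      (\<forall>s. (\<forall>a\<in>F. dist (left_mult s * a) a < d) \<longrightarrow> norm (left_mult s * a - a) \<le> d') \<Longrightarrow> a \<in> CrG \<Longrightarrow> norm (e * a - a) \<le> d'"
    by blast
  moreover from this(3)[of d] have "norm (e * a - a) \<le> d" if "a \<in> F" for a
    using that assms by (auto simp: dist_norm intro: less_imp_le)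
  ultimately show ?thesis using convolutions_subset by blast
qed

section \<open>Translations on a bimodule\<close>

lemma nondegenerate_ext:
  assumes nd: "nondegenerate A \<sigma>" and eq: "\<And>a. a \<in> A \<Longrightarrow> S * \<sigma> a = T * \<sigma> a"
  shows "S = T"
proof (rule bop_eqI)
  fix v
  let ?X = "{\<sigma> a $$ v | a v. a \<in> A}"
  let ?E = "{v. S $$ v = T $$ v}"
  have "?X \<subseteq> ?E"
  proof clarify
    fix a v assume "a \<in> A"
    from arg_cong[OF eq[OF this], of "\<lambda>R. R $$ v"]
    show "S $$ (\<sigma> a $$ v) = T $$ (\<sigma> a $$ v)"
      by (simp add: times_bop.rep_eq)
  qed
  moreover have "subspace ?E" by (simp add: subspace_def bop_simps)
  ultimately have "span ?X \<subseteq> ?E" by (rule span_minimal)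
  moreover have "closed ?E"
    by (intro closed_Collect_eq linear_continuous_on bounded_linear_bop)
  ultimately have "closure (span ?X) \<subseteq> ?E" by (rule closure_minimal)
  thus "S $$ v = T $$ v" using nd by (auto simp: nondegenerate_def)
qed

lemma bounded_linear_scaleC_inner: "bounded_linear (\<lambda>x::'h::chilbert_space. c *\<^sub>C x)"
  by (rule bounded_linear_intro[where K="cmod c"])
     (simp_all add: scaleC_add_right scaleR_scaleC scaleC_scaleC mult.commute norm_scaleC_inner)

text \<open>The operator below is built from its graph, the closure of a subspace of pairs on which
  the second component has the norm of the first.\<close>

lemma isometric_extension:
  fixes \<sigma> :: "'a::cstar_algebra \<Rightarrow> 'h::chilbert_space bop"
  assumes nd: "nondegenerate A \<sigma>"
    and gram: "\<And>a b. a \<in> A \<Longrightarrow> b \<in> A \<Longrightarrow> star (\<sigma> (\<theta> a)) * \<sigma> (\<theta> b) = star (\<sigma> a) * \<sigma> b"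
  shows "\<exists>T. (\<forall>a\<in>A. T * \<sigma> a = \<sigma> (\<theta> a)) \<and> (\<forall>\<xi>. norm (T $$ \<xi>) = norm \<xi>)"
proof -
  define X where "X = {(\<sigma> a $$ \<xi>, \<sigma> (\<theta> a) $$ \<xi>) | a \<xi>. a \<in> A}"
  define D where "D = span X"
  define R where "R = closure D"
  have X_inner: "cinner (snd p) (snd q) = cinner (fst p) (fst q)" if p: "p \<in> X" and q: "q \<in> X" for p q
  proof -
    obtain a \<xi> b \<eta> where "a \<in> A" "b \<in> A" "p = (\<sigma> a $$ \<xi>, \<sigma> (\<theta> a) $$ \<xi>)"
      "q = (\<sigma> b $$ \<eta>, \<sigma> (\<theta> b) $$ \<eta>)" using p q unfolding X_def by blast
    thus ?thesis
      using arg_cong[OF gram[of b a], of "\<lambda>S. cinner (S $$ \<xi>) \<eta>"]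
      by (simp add: times_bop.rep_eq cinner_star_bop')
  qed
  have D_inner: "cinner (snd p) (snd q) = cinner (fst p) (fst q)" if "p \<in> D" "q \<in> D" for p q
  proof -
    have 1: "cinner (snd p) (snd q) = cinner (fst p) (fst q)" if "p \<in> X" for p
      using \<open>q \<in> D\<close> unfolding D_def
    proof (induction rule: span_induct_alt)
      case (step c x y)
      thus ?case using X_inner[OF that, of x] by (simp add: cinner_simps)
    qed (simp add: cinner_simps)
    show ?thesis using \<open>p \<in> D\<close> unfolding D_def
    proof (induction rule: span_induct_alt)
      case (step c x y)
      thus ?case using 1[of x] by (simp add: cinner_simps)
    qed (simp add: cinner_simps)
  qed
  have D_norm: "norm (snd p) = norm (fst p)" if "p \<in> D" for p
  proof -
    have "(norm (snd p))\<^sup>2 = (norm (fst p))\<^sup>2"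
      using D_inner[OF that that] by (simp only: cinner_self of_real_eq_iff)
    thus ?thesis by (simp add: power2_eq_iff_nonneg)
  qed
  have "D \<subseteq> {p. norm (snd p) = norm (fst p)}" using D_norm by blast
  moreover have "closed {p::'h \<times> 'h. norm (snd p) = norm (fst p)}"
    by (intro closed_Collect_eq continuous_intros)
  ultimately have "R \<subseteq> {p. norm (snd p) = norm (fst p)}" unfolding R_def by (rule closure_minimal)
  hence R_norm: "norm v = norm u" if "(u, v) \<in> R" for u v using that by auto
  have D_add: "p \<in> D \<Longrightarrow> q \<in> D \<Longrightarrow> p + q \<in> D" and D_diff: "p \<in> D \<Longrightarrow> q \<in> D \<Longrightarrow> p - q \<in> D" for p q
    unfolding D_def by (auto intro: span_add span_diff)
  \<comment> \<open>\<open>D\<close> is a real span, but the generating set \<open>X\<close> is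
    stable under complex scalars, and this passes to the span.\<close>
  have D_scaleC: "(c *\<^sub>C fst p, c *\<^sub>C snd p) \<in> D" if "p \<in> D" for p c
    using that unfolding D_def
  proof (induction rule: span_induct_alt)
    case base
    show ?case using span_zero[of X] by (simp add: scaleC_zero_right zero_prod_def)
  next
    case (step r x y)
    obtain a \<xi> where "a \<in> A" "x = (\<sigma> a $$ \<xi>, \<sigma> (\<theta> a) $$ \<xi>)" using step by (auto simp: X_def)
    hence "(c *\<^sub>C fst x, c *\<^sub>C snd x) \<in> X" by (auto simp: X_def bop_scaleC[symmetric])
    hence "r *\<^sub>R (c *\<^sub>C fst x, c *\<^sub>C snd x) + (c *\<^sub>C fst y, c *\<^sub>C snd y) \<in> span X"
      using step.IH by (intro span_add span_scale) (auto intro: span_base)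
    thus ?case by (simp add: scaleC_add_right scaleR_scaleC scaleC_scaleC mult.commute)
  qed
  have R_add: "p + q \<in> R" if pq: "p \<in> R" "q \<in> R" for p q
  proof -
    obtain f g where "\<And>n. f n \<in> D" "f \<longlonglongrightarrow> p" "\<And>n. g n \<in> D" "g \<longlonglongrightarrow> q"
      using pq unfolding R_def closure_sequential by blast
    thus ?thesis unfolding R_def closure_sequential
      by (intro exI[of _ "\<lambda>n. f n + g n"]) (auto intro: D_add tendsto_add)
  qed
  have R_scaleC: "(c *\<^sub>C u, c *\<^sub>C v) \<in> R" if "(u, v) \<in> R" for u v c
  proof -
    obtain f where f: "\<And>n. f n \<in> D" "f \<longlonglongrightarrow> (u, v)"
      using \<open>(u, v) \<in> R\<close> unfolding R_def closure_sequential by blast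
    have "(\<lambda>n. (c *\<^sub>C fst (f n), c *\<^sub>C snd (f n))) \<longlonglongrightarrow> (c *\<^sub>C u, c *\<^sub>C v)"
      using tendsto_fst[OF f(2)] tendsto_snd[OF f(2)]
      by (intro tendsto_Pair bounded_linear.tendsto[OF bounded_linear_scaleC_inner]) simp_all
    moreover have "(c *\<^sub>C fst (f n), c *\<^sub>C snd (f n)) \<in> D" for n by (rule D_scaleC[OF f(1)])
    ultimately show ?thesis unfolding R_def closure_sequential
      by (intro exI[of _ "\<lambda>n. (c *\<^sub>C fst (f n), c *\<^sub>C snd (f n))"]) simp
  qed
  \<comment> \<open>The difference of two values at \<open>u\<close> is a value at 0, which has norm
    0.\<close>
  have R_unique: "v = w" if "(u, v) \<in> R" "(u, w) \<in> R" for u v w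
  proof -
    have "(u, v) + ((-1) *\<^sub>C u, (-1) *\<^sub>C w) \<in> R" using that by (intro R_add R_scaleC)
    thus ?thesis using R_norm[of 0 "v - w"] by (simp add: scaleC_minus1)
  qed
  have fst_X: "fst ` X = {\<sigma> a $$ \<xi> | a \<xi>. a \<in> A}" by (force simp: X_def image_iff)
  have fst_D: "fst ` D = span {\<sigma> a $$ \<xi> | a \<xi>. a \<in> A}"
    unfolding D_def fst_X[symmetric] by (rule linear_span_image[symmetric]) (rule linear_fst)
  \<comment> \<open>Approximate \<open>\<xi>\<close> by first components of pairs in
    \<open>D\<close>. The second components have the same mutual distances, so they converge as
    well.\<close>
  have R_total: "\<exists>v. (\<xi>, v) \<in> R" for \<xi>
  proof -
    have "\<xi> \<in> closure (fst ` D)" using nd by (simp add: nondegenerate_def fst_D)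
    then obtain f where f: "\<And>n. f n \<in> fst ` D" "f \<longlonglongrightarrow> \<xi>" unfolding closure_sequential by blast
    hence "\<exists>g. \<forall>n. (f n, g n) \<in> D" by (intro choice allI) force
    then obtain g where g: "\<And>n. (f n, g n) \<in> D" by blast
    have "dist (g m) (g n) = dist (f m) (f n)" for m n
      using D_norm[OF D_diff[OF g[of m] g[of n]]] by (simp add: dist_norm)
    hence "Cauchy g" using LIMSEQ_imp_Cauchy[OF f(2)] by (simp add: Cauchy_def)
    then obtain v where "g \<longlonglongrightarrow> v" using Cauchy_convergent convergent_def by blast
    hence "(\<lambda>n. (f n, g n)) \<longlonglongrightarrow> (\<xi>, v)" using f(2) by (intro tendsto_Pair)
    hence "(\<xi>, v) \<in> R" unfolding R_def closure_sequential
      using g by (intro exI[of _ "\<lambda>n. (f n, g n)"]) simp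
    thus ?thesis by blast
  qed
  then obtain F where F: "\<And>\<xi>. (\<xi>, F \<xi>) \<in> R" by metis
  have "bounded_clinear F"
  proof (rule bounded_clinearI[where K=1])
    show "F (x + y) = F x + F y" for x y using R_unique[OF F] R_add[OF F F, of x y] by simp
    show "F (c *\<^sub>C x) = c *\<^sub>C F x" for c x using R_unique[OF F R_scaleC[OF F]] .
    show "norm (F x) \<le> norm x * 1" for x using R_norm[OF F] by simp
  qed
  then obtain T where T: "bop_apply T = F" using Abs_bop_inverse by blast
  have "T * \<sigma> a = \<sigma> (\<theta> a)" if "a \<in> A" for a
  proof (rule bop_eqI)
    fix \<xi>
    have "(\<sigma> a $$ \<xi>, \<sigma> (\<theta> a) $$ \<xi>) \<in> R"
      unfolding R_def D_def using that by (intro closure_subset[THEN subsetD] span_base) (auto simp: X_def)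
    thus "(T * \<sigma> a) $$ \<xi> = \<sigma> (\<theta> a) $$ \<xi>"
      using R_unique[OF F] by (simp add: times_bop.rep_eq T)
  qed
  moreover have "norm (T $$ \<xi>) = norm \<xi>" for \<xi> using R_norm[OF F] by (simp add: T)
  ultimately show ?thesis by blast
qed

lemma isometry_cinner:
  assumes iso: "\<And>v. norm (T $$ v) = norm (v :: 'h::chilbert_space)"
  shows "cinner (T $$ v) (T $$ w) = cinner v w"
proof -
  have *: "inner (T $$ v) (T $$ w) = inner v w" for v w
    using iso[of "v + w"] iso[of v] iso[of w] dot_norm[of "T $$ v" "T $$ w"] dot_norm[of v w]
    by (simp add: bop_add)
  have "Im (cinner v w) = inner ((- \<i>) *\<^sub>C v) w" for v w :: 'h
    by (simp add: inner_eq_Re_cinner cinner_scaleC_left)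
  hence "Im (cinner (T $$ v) (T $$ w)) = Im (cinner v w)"
    using *[of "(- \<i>) *\<^sub>C v" w] by (simp add: bop_scaleC)
  thus ?thesis using *[of v w] by (simp add: complex_eq_iff inner_eq_Re_cinner)
qed

section \<open>The multipliers \<open>\<lambda>_s\<close> and their actions on a bimodule\<close>

definition translation_multiplier ::
    "'g::haar_group \<Rightarrow> ('g L2 bop \<Rightarrow> 'g L2 bop) \<times> ('g L2 bop \<Rightarrow> 'g L2 bop)" where
  "translation_multiplier s = (\<lambda>a\<in>CrG. left_mult s * a, \<lambda>a\<in>CrG. a * left_mult s)"

lemma translation_multiplier_in: "translation_multiplier s \<in> multipliers CrG"
  by (auto simp: multipliers_def translation_multiplier_def reduced_left_mult reduced_right_mult mult.assoc)

text \<open>Almost centrality will be tested on single multipliers. The element 0 of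
  \<open>A\<close> provides a generating open set that consists of all multipliers, which places
  \<open>x\<close> in the underlying space.\<close>

lemma compactin_singleton_multiplier:
  assumes A: "cstar_subalgebra A" and x: "x \<in> multipliers A"
  shows "compactin (strict_topology A) {x}"
proof -
  have "openin (strict_topology A) {x \<in> multipliers A. fst x 0 \<in> UNIV}"
    unfolding strict_topology_def
    by (rule topology_generated_by_Basis) (use cstar_subalgebra_zero[OF A] in blast)
  hence "x \<in> topspace (strict_topology A)" using x openin_subset by fastforce
  thus ?thesis by (simp add: finite_imp_compactin)
qed

definition left_translation ::
    "('g L2 bop \<Rightarrow> 'h bop) \<Rightarrow> 'g::haar_group \<Rightarrow> 'h::chilbert_space bop" where
  "left_translation \<pi> s = left_extension CrG \<pi> (translation_multiplier s)"

definition right_translation ::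
    "('g L2 bop \<Rightarrow> 'h bop) \<Rightarrow> 'g::haar_group \<Rightarrow> 'h::chilbert_space bop" where
  "right_translation \<rho> s = right_extension CrG \<rho> (translation_multiplier s)"

context
  fixes \<pi> \<rho> :: "'g::haar_group L2 bop \<Rightarrow> 'h::chilbert_space bop"
  assumes bimod: "hilbert_bimodule CrG \<pi> \<rho>"
begin

text \<open>As \<open>\<lambda>_s\<close> is unitary, \<open>a \<mapsto> \<lambda>_s a\<close>
  preserves the products \<open>a^* b\<close>. So \<open>isometric_extension\<close> supplies an
  operator with the property described by \<open>THE\<close>, and non-degeneracy its
  uniqueness.\<close>

lemma left_translation:
  shows left_translation_mult: "a \<in> CrG \<Longrightarrow> left_translation \<pi> s * \<pi> a = \<pi> (left_mult s * a)"
    and norm_left_translation: "norm (left_translation \<pi> s $$ v) = norm v"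
proof -
  have \<pi>: "nondegenerate CrG \<pi>" "star_representation CrG \<pi>"
    using bimod by (simp_all add: hilbert_bimodule_def)
  have mult: "\<pi> (a * b) = \<pi> a * \<pi> b" and st: "\<pi> (star a) = star (\<pi> a)"
    if "a \<in> CrG" "b \<in> CrG" for a b
    using \<pi>(2) that by (auto simp: star_representation_def)
  have "star (\<pi> (left_mult s * a)) * \<pi> (left_mult s * b) = star (\<pi> a) * \<pi> b"
    if ab: "a \<in> CrG" "b \<in> CrG" for a b
  proof -
    have "star (left_mult s * a) * (left_mult s * b) = star a * b"
      by (simp add: star_mult star_left_mult mult.assoc left_mult_left_mult left_mult_zero)
    thus ?thesis
      using mult[OF reduced_star[OF reduced_left_mult[OF ab(1), of s]] reduced_left_mult[OF ab(2), of s]]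
        mult[OF reduced_star[OF ab(1)] ab(2)] st[OF ab] st[OF reduced_left_mult[OF ab(1), of s] ab(1)]
      by simp
  qed
  from isometric_extension[OF \<pi>(1) this] obtain T where
    T: "\<And>a. a \<in> CrG \<Longrightarrow> T * \<pi> a = \<pi> (left_mult s * a)" "\<And>v. norm (T $$ v) = norm v" by blast
  have "left_translation \<pi> s = T"
    unfolding left_translation_def left_extension_def
  proof (rule the_equality)
    show "\<forall>a\<in>CrG. T * \<pi> a = \<pi> (fst (translation_multiplier s) a)"
      by (simp add: translation_multiplier_def T(1))
    fix S assume S: "\<forall>a\<in>CrG. S * \<pi> a = \<pi> (fst (translation_multiplier s) a)"
    show "S = T" by (rule nondegenerate_ext[OF \<pi>(1)]) (use S in \<open>simp add: translation_multiplier_def T(1)\<close>)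
  qed
  thus "a \<in> CrG \<Longrightarrow> left_translation \<pi> s * \<pi> a = \<pi> (left_mult s * a)"
    "norm (left_translation \<pi> s $$ v) = norm v" using T by auto
qed

text \<open>For an anti-representation the Gram operator of \<open>a\<close> and \<open>b\<close> is
  \<open>\<rho> (b * star a)\<close>, and it is right multiplication by \<open>\<lambda>_s\<close>
  that preserves \<open>b * star a\<close>.\<close>

lemma right_translation:
  shows right_translation_mult: "a \<in> CrG \<Longrightarrow> right_translation \<rho> s * \<rho> a = \<rho> (a * left_mult s)"
    and norm_right_translation: "norm (right_translation \<rho> s $$ v) = norm v"
proof -
  have \<rho>: "nondegenerate CrG \<rho>" "star_antirepresentation CrG \<rho>"
    using bimod by (simp_all add: hilbert_bimodule_def)
  have mult: "\<rho> (a * b) = \<rho> b * \<rho> a" and st: "\<rho> (star a) = star (\<rho> a)"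
    if "a \<in> CrG" "b \<in> CrG" for a b
    using \<rho>(2) that by (auto simp: star_antirepresentation_def)
  have "star (\<rho> (a * left_mult s)) * \<rho> (b * left_mult s) = star (\<rho> a) * \<rho> b"
    if ab: "a \<in> CrG" "b \<in> CrG" for a b
  proof -
    have "(b * left_mult s) * star (a * left_mult s) = b * star a"
      by (simp add: star_mult star_left_mult mult.assoc left_mult_left_mult left_mult_zero)
    thus ?thesis
      using mult[OF reduced_right_mult[OF ab(2), of s] reduced_star[OF reduced_right_mult[OF ab(1), of s]]]
        mult[OF ab(2) reduced_star[OF ab(1)]] st[OF ab] st[OF reduced_right_mult[OF ab(1), of s] ab(1)]
      by simp
  qed
  from isometric_extension[OF \<rho>(1) this] obtain T where
    T: "\<And>a. a \<in> CrG \<Longrightarrow> T * \<rho> a = \<rho> (a * left_mult s)" "\<And>v. norm (T $$ v) = norm v" by blast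
  have "right_translation \<rho> s = T"
    unfolding right_translation_def right_extension_def
  proof (rule the_equality)
    show "\<forall>a\<in>CrG. T * \<rho> a = \<rho> (snd (translation_multiplier s) a)"
      by (simp add: translation_multiplier_def T(1))
    fix S assume S: "\<forall>a\<in>CrG. S * \<rho> a = \<rho> (snd (translation_multiplier s) a)"
    show "S = T" by (rule nondegenerate_ext[OF \<rho>(1)]) (use S in \<open>simp add: translation_multiplier_def T(1)\<close>)
  qed
  thus "a \<in> CrG \<Longrightarrow> right_translation \<rho> s * \<rho> a = \<rho> (a * left_mult s)"
    "norm (right_translation \<rho> s $$ v) = norm v" using T by auto
qed

text \<open>On the vectors \<open>\<rho> b \<xi>\<close>, which span a dense subspace, the
  translation replaces \<open>\<rho> b\<close> by \<open>\<rho> (b * left_mult s)\<close>, and this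
  still commutes with \<open>\<pi> a\<close>.\<close>

lemma right_translation_commute:
  assumes a: "a \<in> CrG"
  shows "right_translation \<rho> s * \<pi> a = \<pi> a * right_translation \<rho> s"
proof (rule nondegenerate_ext)
  show "nondegenerate CrG \<rho>" using bimod by (simp add: hilbert_bimodule_def)
  have comm: "\<pi> a * \<rho> b = \<rho> b * \<pi> a" if "b \<in> CrG" for b
    using bimod a that by (simp add: hilbert_bimodule_def)
  fix b assume b: "b \<in> (CrG :: 'g L2 bop set)"
  have "right_translation \<rho> s * \<pi> a * \<rho> b = (right_translation \<rho> s * \<rho> b) * \<pi> a"
    by (simp add: comm[OF b] mult.assoc)
  also have "\<dots> = \<pi> a * \<rho> (b * left_mult s)"
    by (simp add: right_translation_mult[OF b] comm reduced_right_mult b)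
  also have "\<dots> = \<pi> a * right_translation \<rho> s * \<rho> b"
    by (simp add: right_translation_mult[OF b, symmetric] mult.assoc)
  finally show "right_translation \<rho> s * \<pi> a * \<rho> b = \<pi> a * right_translation \<rho> s * \<rho> b" .
qed

text \<open>An approximate unit \<open>e\<close> moves \<open>\<pi> a $$ z\<close> by at most
  \<open>norm (e * a - a) * norm z\<close>, and contractivity carries the estimate to the closed
  span. Needed because the gap is first proved at vectors \<open>\<pi> c $$ v\<close> only.\<close>

lemma left_action_approx:
  assumes d: "0 < d"
  shows "\<exists>c\<in>CrG. norm (\<pi> c $$ v - v) < d"
proof -
  have \<pi>: "nondegenerate CrG \<pi>" "star_representation CrG \<pi>"
    using bimod by (simp_all add: hilbert_bimodule_def)
  let ?A = "CrG :: 'g L2 bop set"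
  let ?X = "{\<pi> a $$ v | a v. a \<in> ?A}"
  \<comment> \<open>\<open>F\<close> and \<open>C\<close> depend on \<open>w\<close> alone and the
    bound is linear in \<open>d\<close>; in this form the claim survives the induction over the
    span.\<close>
  have "\<exists>F C. finite F \<and> F \<subseteq> ?A \<and> 0 \<le> C \<and>
      (\<forall>e\<in>?A. \<forall>d\<ge>0. (\<forall>a\<in>F. norm (e * a - a) \<le> d) \<longrightarrow> norm (\<pi> e $$ w - w) \<le> d * C)"
    if "w \<in> span ?X" for w
    using that
  proof (induction rule: span_induct_alt)
    case base
    show ?case by (rule exI[of _ "{}"], rule exI[of _ 0]) (simp add: bop_zero)
  next
    case (step r x y)
    obtain a z where x: "a \<in> ?A" "x = \<pi> a $$ z" using step by blast
    from step.IH obtain F C where FC: "finite F" "F \<subseteq> ?A" "0 \<le> C"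
      and approx: "\<forall>e\<in>?A. \<forall>d\<ge>0. (\<forall>a\<in>F. norm (e * a - a) \<le> d) \<longrightarrow> norm (\<pi> e $$ y - y) \<le> d * C"
      by (elim exE conjE)
    have "norm (\<pi> e $$ (r *\<^sub>R x + y) - (r *\<^sub>R x + y)) \<le> d * (C + \<bar>r\<bar> * norm z)"
      if e: "e \<in> ?A" "0 \<le> d" "\<And>b. b \<in> insert a F \<Longrightarrow> norm (e * b - b) \<le> d" for e d
    proof -
      have ea: "e * a - a \<in> ?A"
        by (intro cstar_subalgebra_diff[OF cstar_subalgebra_reduced] reduced_mult e x)
      have "\<pi> (e * a) = \<pi> (e * a - a) + \<pi> a"
        using \<pi>(2) ea x(1) unfolding star_representation_def complex_linear_on_def by (metis diff_add_cancel)
      moreover have "\<pi> (e * a) = \<pi> e * \<pi> a" using \<pi>(2) e x by (simp add: star_representation_def)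
      ultimately have "(\<pi> e * \<pi> a) $$ z = (\<pi> (e * a - a) + \<pi> a) $$ z" by simp
      hence "\<pi> e $$ x - x = (\<pi> (e * a - a)) $$ z"
        by (simp add: x(2) times_bop.rep_eq plus_bop.rep_eq)
      hence "norm (\<pi> e $$ x - x) \<le> norm (\<pi> (e * a - a)) * norm z" by (simp add: norm_bop_apply)
      also have "\<dots> \<le> d * norm z"
        using star_representation_contractive[OF cstar_subalgebra_reduced \<pi>(2) ea] e(3)[of a]
        by (intro mult_right_mono) auto
      finally have "norm (r *\<^sub>R (\<pi> e $$ x - x)) \<le> \<bar>r\<bar> * (d * norm z)"
        by (simp add: mult_left_mono)
      moreover have "norm (\<pi> e $$ y - y) \<le> d * C" using approx e by simp
      moreover have "\<pi> e $$ (r *\<^sub>R x + y) - (r *\<^sub>R x + y) =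
          r *\<^sub>R (\<pi> e $$ x - x) + (\<pi> e $$ y - y)"
        by (simp add: bop_simps algebra_simps)
      ultimately show ?thesis
        using norm_triangle_ineq[of "r *\<^sub>R (\<pi> e $$ x - x)" "\<pi> e $$ y - y"]
        by (simp add: algebra_simps)
    qed
    thus ?case using FC x
      by (intro exI[of _ "insert a F"] exI[of _ "C + \<bar>r\<bar> * norm z"]) auto
  qed
  note span_approx = this
  have "v \<in> closure (span ?X)" using \<pi>(1) by (simp add: nondegenerate_def)
  moreover have "0 < d/3" using d by simp
  ultimately obtain w where w: "w \<in> span ?X" "dist w v < d/3"
    unfolding closure_approachable by blast
  from span_approx[OF w(1)] obtain F C where FC: "finite F" "F \<subseteq> ?A" "0 \<le> C"
    and approx: "\<forall>e\<in>?A. \<forall>d\<ge>0. (\<forall>a\<in>F. norm (e * a - a) \<le> d) \<longrightarrow> norm (\<pi> e $$ w - w) \<le> d * C"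
    by (elim exE conjE)
  define d' where "d' = d / (3 * (C + 1))"
  have d': "0 < d'" "d' * C \<le> d/3" using d FC(3) by (auto simp: d'_def field_simps)
  obtain e where e: "e \<in> ?A" "norm e \<le> 1" "\<And>a. a \<in> F \<Longrightarrow> norm (e * a - a) \<le> d'"
    using reduced_approximate_unit[OF FC(1,2) d'(1)] by blast
  have "norm (\<pi> e $$ w - w) \<le> d' * C" using approx e d'(1) by simp
  hence "norm (\<pi> e $$ w - w) \<le> d/3" using d'(2) by linarith
  moreover have "norm (\<pi> e $$ (v - w)) \<le> 1 * norm (v - w)"
    using star_representation_contractive[OF cstar_subalgebra_reduced \<pi>(2) e(1)] e(2)
    by (intro order_trans[OF norm_bop_apply] mult_right_mono) auto
  moreover have "\<pi> e $$ v - v = \<pi> e $$ (v - w) + (\<pi> e $$ w - w) + (w - v)"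
    by (simp add: bop_diff)
  moreover have "norm (\<pi> e $$ (v - w) + (\<pi> e $$ w - w) + (w - v)) \<le>
      norm (\<pi> e $$ (v - w)) + norm (\<pi> e $$ w - w) + norm (w - v)"
    by (intro norm_triangle_le add_mono order_refl norm_triangle_ineq)
  ultimately have "norm (\<pi> e $$ v - v) < d"
    using w(2) by (simp add: dist_norm norm_minus_commute)
  thus ?thesis using e(1) by blast
qed

end

section \<open>Amenability\<close>

text \<open>An integrable function vanishes off a set of \<open>\<sigma>\<close>-finite measure, where locally null sets
  are null.\<close>

lemma locally_AE_imp_AE_support:
  fixes W :: "'g::haar_group \<Rightarrow> 'b::{banach, second_countable_topology}"
  assumes P: "locally_AE P" and W: "integrable msr W"
  shows "AE x in msr. W x \<noteq> 0 \<longrightarrow> P x"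
proof -
  have 1: "AE x in msr. x \<in> U \<longrightarrow> P x" if U: "open U" "emeasure msr U < \<infinity>" for U :: "'g set"
  proof -
    have "\<exists>K. compact K \<and> K \<subseteq> U \<and> measure msr (U - K) < 1 / real (Suc n)" for n
      using inner_approx[OF U] by simp
    then obtain K where K: "\<And>n. compact (K n)" "\<And>n. K n \<subseteq> U" "\<And>n. measure msr (U - K n) < 1 / real (Suc n)" by metis
    \<comment> \<open>What is left of \<open>U\<close> after removing countably many compact sets
      has measure below every \<open>1/(n+1)\<close>. On the compact sets the local hypothesis
      applies.\<close>
    define N where "N = U - (\<Union>n. K n)"
    have Nm: "N \<in> sets msr" unfolding N_def 
      by (intro sets.Diff sets.countable_UN open_sets_msr U) (use K(1) compact_sets_msr in blast)
    have "measure msr N \<le> 1 / real (Suc n)" for n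
    proof -
      have "U - K n \<in> fmeasurable msr"
        using U K by (intro fmeasurableI) (auto simp: open_sets_msr compact_sets_msr intro: order_le_less_trans[OF emeasure_mono])
      hence "measure msr N \<le> measure msr (U - K n)"
        by (intro measure_mono_fmeasurable Nm) (auto simp: N_def)
      thus ?thesis using K(3)[of n] by linarith
    qed
    hence "measure msr N \<le> 0"
      by (intro LIMSEQ_le_const[OF LIMSEQ_inverse_real_of_nat]) (auto simp: inverse_eq_divide)
    moreover have "emeasure msr N < \<infinity>"
      using U by (auto simp: N_def open_sets_msr intro: order_le_less_trans[OF emeasure_mono])
    ultimately have "N \<in> null_sets msr"
      using Nm by (simp add: null_sets_def emeasure_eq_ennreal_measure less_top measure_le_0_iff)
    hence "AE x in msr. x \<notin> N" by (rule AE_not_in)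
    moreover have "AE x in msr. \<forall>n. x \<in> K n \<longrightarrow> P x"
      unfolding AE_all_countable using P K(1) by (simp add: locally_AE_def)
    ultimately show ?thesis by eventually_elim (auto simp: N_def)
  qed
  have [measurable]: "W \<in> borel_measurable msr" using W by (rule borel_measurable_integrable)
  \<comment> \<open>By Markov's inequality the set where \<open>norm (W x)\<close> is at least
    \<open>1/(n+1)\<close> has finite measure, so it lies in an open set of finite measure.\<close>
  have "AE x in msr. 1 / real (Suc n) \<le> norm (W x) \<longrightarrow> P x" for n
  proof -
    let ?B = "{x. 1 / real (Suc n) \<le> norm (W x)}"
    have Bm: "?B \<in> sets msr"
      using borel_measurable_le[of "\<lambda>_. 1 / real (Suc n)" msr "\<lambda>x. norm (W x)"] by (simp add: space_msr)
    have "emeasure msr ?B < \<infinity>"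
    proof -
      have "integrable msr (indicat_real ?B)"
      proof (rule Bochner_Integration.integrable_bound)
        show "integrable msr (\<lambda>x. real (Suc n) * norm (W x))" using W by simp
        show "AE x in msr. norm (indicat_real ?B x) \<le> norm (real (Suc n) * norm (W x))"
          by (auto simp: indicator_def field_simps)
      qed (use Bm in measurable)
      thus ?thesis by (simp add: integrable_indicator_iff space_msr)
    qed
    from outer_approx[OF Bm this, of 1] obtain U where U: "open U" "?B \<subseteq> U" "emeasure msr U < \<infinity>" by auto
    from 1[OF U(1,3)] show ?thesis by eventually_elim (use U(2) in auto)
  qed
  hence "AE x in msr. \<forall>n. 1 / real (Suc n) \<le> norm (W x) \<longrightarrow> P x"
    unfolding AE_all_countable by blast
  thus ?thesis
  proof eventually_elim
    fix x assume *: "\<forall>n. 1 / real (Suc n) \<le> norm (W x) \<longrightarrow> P x"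
    show "W x \<noteq> 0 \<longrightarrow> P x"
    proof
      assume "W x \<noteq> 0"
      then obtain n where "1 / real (Suc n) < norm (W x)" using nat_approx_posE[of "norm (W x)"] by auto
      thus "P x" using * by (meson less_imp_le)
    qed
  qed
qed

lemma locally_AE_mono: "locally_AE P \<Longrightarrow> (\<And>x. P x \<Longrightarrow> Q x) \<Longrightarrow> locally_AE Q"
  unfolding locally_AE_def by (auto elim!: eventually_mono)

lemma locally_AE_conj: "locally_AE P \<Longrightarrow> locally_AE Q \<Longrightarrow> locally_AE (\<lambda>x. P x \<and> Q x)"
  unfolding locally_AE_def by (simp add: AE_conj_iff imp_conjR)

lemma Linf_translate:
  assumes "f \<in> Linf" shows "(\<lambda>x. f (s + x)) \<in> (Linf :: ('g::haar_group \<Rightarrow> complex) set)"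
proof -
  obtain C where f: "f \<in> borel_measurable msr" "locally_AE (\<lambda>x. cmod (f x) \<le> C)"
    using assms by (auto simp: Linf_def)
  have "locally_AE (\<lambda>x. cmod (f (s + x)) \<le> C)"
    unfolding locally_AE_def
  proof (intro allI impI)
    fix K :: "'g set" assume K: "compact K"
    have "compact ((+) s ` K)" by (intro compact_continuous_image K continuous_intros)
    hence "AE x in msr. x \<in> (+) s ` K \<longrightarrow> cmod (f x) \<le> C" using f(2) by (simp add: locally_AE_def)
    from AE_translate[OF this, of s] show "AE x in msr. x \<in> K \<longrightarrow> cmod (f (s + x)) \<le> C"
      by eventually_elim auto
  qed
  moreover have "(\<lambda>x. f (s + x)) \<in> borel_measurable msr"
    by (rule measurable_compose[OF measurable_translate_msr f(1)])
  ultimately show ?thesis by (auto simp: Linf_def)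
qed

text \<open>The pairing of \<open>L^\<infinity>\<close> with \<open>L^1\<close>: a bound that holds
  locally almost everywhere holds almost everywhere on the support of \<open>W\<close>.\<close>

lemma Linf_times_integrable:
  fixes W :: "'g::haar_group \<Rightarrow> real"
  assumes f: "f \<in> borel_measurable msr" "locally_AE (\<lambda>x. cmod (f x) \<le> C)" and W: "integrable msr W"
  shows "integrable msr (\<lambda>x. f x * complex_of_real (W x))"
    and "cmod (LINT x|msr. f x * complex_of_real (W x)) \<le> C * (LINT x|msr. \<bar>W x\<bar>)"
proof -
  have [measurable]: "f \<in> borel_measurable msr" "W \<in> borel_measurable msr" using f W by auto
  have ae: "AE x in msr. cmod (f x * complex_of_real (W x)) \<le> C * \<bar>W x\<bar>"
    using locally_AE_imp_AE_support[OF f(2) W]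
  proof eventually_elim
    fix x assume "W x \<noteq> 0 \<longrightarrow> cmod (f x) \<le> C"
    thus "cmod (f x * complex_of_real (W x)) \<le> C * \<bar>W x\<bar>"
      by (cases "W x = 0") (simp_all add: norm_mult mult_right_mono)
  qed
  have iC: "integrable msr (\<lambda>x. C * \<bar>W x\<bar>)" using W by simp
  show i: "integrable msr (\<lambda>x. f x * complex_of_real (W x))"
  proof (rule Bochner_Integration.integrable_bound[OF iC])
    show "AE x in msr. norm (f x * complex_of_real (W x)) \<le> norm (C * \<bar>W x\<bar>)"
      using ae by eventually_elim simp
  qed measurable
  have "cmod (LINT x|msr. f x * complex_of_real (W x)) \<le> (LINT x|msr. cmod (f x * complex_of_real (W x)))"
    by (rule integral_norm_bound)
  also have "\<dots> \<le> (LINT x|msr. C * \<bar>W x\<bar>)"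
    using i iC ae by (intro integral_mono_AE integrable_norm)
  finally show "cmod (LINT x|msr. f x * complex_of_real (W x)) \<le> C * (LINT x|msr. \<bar>W x\<bar>)" by simp
qed

text \<open>The means given by densities lie in a product of discs, which is compact.\<close>

lemma amenable_of_almost_invariant_densities:
  assumes reiter: "\<And>(F :: 'g set) (\<epsilon>::real). finite F \<Longrightarrow> 0 < \<epsilon> \<Longrightarrow>
     \<exists>W. integrable msr W \<and> (\<forall>x. 0 \<le> W x) \<and> (LINT x|msr. W x) = 1 \<and>
         (\<forall>s\<in>F. (LINT x|msr. \<bar>W (- s + x) - W x\<bar>) \<le> \<epsilon>)"
  shows "amenable TYPE('g::haar_group)"
proof -
  let ?L = "Linf :: ('g \<Rightarrow> complex) set"
  define N where "N f = (SOME C. 0 \<le> C \<and> locally_AE (\<lambda>x::'g. cmod (f x) \<le> C))" for f :: "'g \<Rightarrow> complex"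
  have N: "0 \<le> N f \<and> locally_AE (\<lambda>x. cmod (f x) \<le> N f)" if f: "f \<in> ?L" for f
    unfolding N_def
  proof (rule someI_ex)
    obtain C where C: "locally_AE (\<lambda>x. cmod (f x) \<le> C)" using f by (auto simp: Linf_def)
    have "locally_AE (\<lambda>x. cmod (f x) \<le> max 0 C)"
      using C by (rule locally_AE_mono) auto
    thus "\<exists>C. 0 \<le> C \<and> locally_AE (\<lambda>x. cmod (f x) \<le> C)" by (intro exI[of _ "max 0 C"]) auto
  qed
  have one: "(\<lambda>_. 1) \<in> ?L" by (auto simp: Linf_def locally_AE_def intro!: exI[of _ 1])
  \<comment> \<open>The product runs over all functions, so those outside \<open>Linf\<close>
    receive a one-point factor to keep it compact.\<close>
  define K where "K = (PiE UNIV (\<lambda>f. if f \<in> ?L then cball 0 (N f) else {0}) :: (('g \<Rightarrow> complex) \<Rightarrow> complex) set)"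
  have K: "compact K"
  proof -
    have "compactin (product_topology (\<lambda>_. euclidean) UNIV) K"
      unfolding K_def compactin_PiE by auto
    thus ?thesis by (simp add: euclidean_product_topology)
  qed
  \<comment> \<open>\<open>Q\<close> collects what every mean with a density satisfies exactly,
    \<open>G (s, e)\<close> what almost invariance gives up to \<open>e\<close>. Each single
    condition involves finitely many coordinates, whence both sets are closed.\<close>
  define Q where "Q = {m :: ('g \<Rightarrow> complex) \<Rightarrow> complex.
     (\<forall>f. f \<in> ?L \<longrightarrow> (\<forall>g. g \<in> ?L \<longrightarrow> m (\<lambda>x. f x + g x) = m f + m g)) \<and>
     (\<forall>c f. f \<in> ?L \<longrightarrow> m (\<lambda>x. c * f x) = c * m f) \<and>
     (\<forall>f. f \<in> ?L \<longrightarrow> (\<forall>C. locally_AE (\<lambda>x. cmod (f x) \<le> C) \<longrightarrow> cmod (m f) \<le> C)) \<and>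
     m (\<lambda>_. 1) = 1}"
  define G where "G p = {m :: ('g \<Rightarrow> complex) \<Rightarrow> complex. \<forall>f. f \<in> ?L \<longrightarrow>
     cmod (m (\<lambda>x. f (fst p + x)) - m f) \<le> N f * snd p}" for p :: "'g \<times> real"
  note closed_rules = closed_Collect_all closed_Collect_conj closed_Collect_imp open_Collect_const
    closed_Collect_eq closed_Collect_le
  have coord: "continuous_on UNIV (\<lambda>m :: ('g \<Rightarrow> complex) \<Rightarrow> complex. m f)" for f
    by (rule continuous_on_product_coordinates)
  have Q_closed: "closed Q" unfolding Q_def
    by (intro closed_rules continuous_on_add continuous_on_mult continuous_on_const continuous_on_norm coord)
  have G_closed: "closed (G p)" for p unfolding G_def
    by (intro closed_rules continuous_on_diff continuous_on_const continuous_on_norm coord)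
  define \<F> where "\<F> = insert Q (G ` (UNIV \<times> {0<..}))"
  have "K \<inter> \<Inter>\<F> \<noteq> {}"
  proof (rule compact_imp_fip[OF K])
    show "closed T" if "T \<in> \<F>" for T using that Q_closed G_closed by (auto simp: \<F>_def)
    fix \<F>' assume fin: "finite \<F>'" and sub: "\<F>' \<subseteq> \<F>"
    have "\<F>' - {Q} \<subseteq> G ` (UNIV \<times> {0<..})" using sub by (auto simp: \<F>_def)
    then obtain Ps where Ps: "finite Ps" "Ps \<subseteq> UNIV \<times> {0<..}" "\<F>' - {Q} = G ` Ps"
      using finite_subset_image[of "\<F>' - {Q}" G] fin by (metis finite_Diff)
    \<comment> \<open>The element 1 covers the case that no invariance condition is among the
      finitely many sets.\<close>
    define \<epsilon> where "\<epsilon> = Min (insert 1 (snd ` Ps))"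
    have \<epsilon>: "0 < \<epsilon>" using Ps unfolding \<epsilon>_def by (subst Min_gr_iff) auto
    have \<epsilon>_le: "\<epsilon> \<le> snd p" if "p \<in> Ps" for p using Ps(1) that unfolding \<epsilon>_def by (intro Min_le) auto
    have "finite (fst ` Ps)" using Ps by simp
    from reiter[OF this \<epsilon>] obtain W where W: "integrable msr W" "\<And>x. 0 \<le> W x" "(LINT x|msr. W x) = 1"
      "\<And>s. s \<in> fst ` Ps \<Longrightarrow> (LINT x|msr. \<bar>W (- s + x) - W x\<bar>) \<le> \<epsilon>" by blast
    define m where "m f = (if f \<in> ?L then LINT x|msr. f x * complex_of_real (W x) else 0)" for f
    have fW: "integrable msr (\<lambda>x. f x * complex_of_real (W x))" if "f \<in> ?L" for f
      using that Linf_times_integrable(1)[OF _ _ W(1)] by (auto simp: Linf_def)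
    have bound: "cmod (m f) \<le> C" if "f \<in> ?L" "locally_AE (\<lambda>x. cmod (f x) \<le> C)" for f C
      using Linf_times_integrable(2)[of f C W] that W by (simp add: m_def Linf_def)
    have "m \<in> K" unfolding K_def using bound N by (auto simp: m_def)
    moreover have "m \<in> Q"
    proof -
      have add: "(\<lambda>x. f x + g x) \<in> ?L" if fg: "f \<in> ?L" "g \<in> ?L" for f g
      proof -
        obtain C D where CD: "locally_AE (\<lambda>x. cmod (f x) \<le> C)" "locally_AE (\<lambda>x. cmod (g x) \<le> D)"
          using fg by (auto simp: Linf_def)
        have "locally_AE (\<lambda>x. cmod (f x + g x) \<le> C + D)"
          using locally_AE_conj[OF CD] by (rule locally_AE_mono) (auto intro: norm_triangle_mono)
        thus ?thesis using fg by (auto simp: Linf_def)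
      qed
      have scale: "(\<lambda>x. c * f x) \<in> ?L" if f: "f \<in> ?L" for c f
      proof -
        obtain C where C: "locally_AE (\<lambda>x. cmod (f x) \<le> C)" using f by (auto simp: Linf_def)
        have "locally_AE (\<lambda>x. cmod (c * f x) \<le> cmod c * C)"
          using C by (rule locally_AE_mono) (auto simp: norm_mult intro: mult_left_mono)
        thus ?thesis using f by (auto simp: Linf_def)
      qed
      have "m (\<lambda>x. f x + g x) = m f + m g" if "f \<in> ?L" "g \<in> ?L" for f g
        using that add[OF that] fW by (simp add: m_def distrib_right)
      moreover have "m (\<lambda>x. c * f x) = c * m f" if "f \<in> ?L" for c f
        using that scale[OF that] by (simp add: m_def mult.assoc)
      moreover have "m (\<lambda>_. 1) = 1" using one W(3) by (simp add: m_def)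
      ultimately show ?thesis using bound by (simp add: Q_def)
    qed
    moreover have "m \<in> G p" if p: "p \<in> Ps" for p
      unfolding G_def mem_Collect_eq
    proof (intro allI impI)
      fix f assume f: "f \<in> ?L"
      define s where "s = fst p"
      have fm: "f \<in> borel_measurable msr" "locally_AE (\<lambda>x. cmod (f x) \<le> N f)" "0 \<le> N f"
        using f N[OF f] by (auto simp: Linf_def)
      have W': "integrable msr (\<lambda>x. W (- s + x))" by (rule integrable_translate[OF W(1)])
      have D: "integrable msr (\<lambda>x. W (- s + x) - W x)" using W' W(1) by simp
      have "(LINT x|msr. f (s + x) * complex_of_real (W x)) = (LINT x|msr. f x * complex_of_real (W (- s + x)))"
        using integral_translate[OF borel_measurable_integrable[OF Linf_times_integrable(1)[OF fm(1,2) W']], of s]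
        by (simp add: add.assoc[symmetric])
      hence "m (\<lambda>x. f (s + x)) - m f = (LINT x|msr. f x * complex_of_real (W (- s + x) - W x))"
        using f Linf_translate[OF f, of s] Linf_times_integrable(1)[OF fm(1,2) W'] fW[OF f]
        by (simp add: m_def right_diff_distrib)
      hence "cmod (m (\<lambda>x. f (s + x)) - m f) \<le> N f * (LINT x|msr. \<bar>W (- s + x) - W x\<bar>)"
        using Linf_times_integrable(2)[OF fm(1,2) D] by simp
      also have "\<dots> \<le> N f * snd p"
        using W(4)[of s] \<epsilon>_le[OF p] p fm(3) by (intro mult_left_mono) (auto simp: s_def)
      finally show "cmod (m (\<lambda>x. f (fst p + x)) - m f) \<le> N f * snd p" by (simp add: s_def)
    qed
    moreover have "\<F>' \<subseteq> insert Q (G ` Ps)" using Ps(3) by blast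
    ultimately have "m \<in> K \<inter> \<Inter>\<F>'" by blast
    thus "K \<inter> \<Inter>\<F>' \<noteq> {}" by blast
  qed
  then obtain m where m: "m \<in> \<Inter>\<F>" by auto
  have mQ: "m \<in> Q" using m by (simp add: \<F>_def)
  have mG: "m \<in> G p" if "p \<in> UNIV \<times> {0<..}" for p using InterD[OF m, of "G p"] that by (simp add: \<F>_def)
  have "m (\<lambda>x. f (s + x)) = m f" if f: "f \<in> ?L" for f s
  proof -
    have "cmod (m (\<lambda>x. f (s + x)) - m f) \<le> 0 + e" if e: "0 < e" for e
    proof -
      have "m \<in> G (s, e / (N f + 1))" using N[OF f] e by (intro mG) auto
      hence "cmod (m (\<lambda>x. f (s + x)) - m f) \<le> N f * (e / (N f + 1))" using f by (simp add: G_def)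
      also have "\<dots> \<le> e" using N[OF f] e by (simp add: field_simps)
      finally show ?thesis by simp
    qed
    hence "cmod (m (\<lambda>x. f (s + x)) - m f) \<le> 0" by (rule field_le_epsilon)
    thus ?thesis by simp
  qed
  hence "left_invariant_mean m" using mQ by (auto simp: left_invariant_mean_def Q_def)
  thus ?thesis by (auto simp: amenable_def)
qed

text \<open>The element \<open>\<Sum>j. w\<^sub>j \<otimes> v\<^sub>j\<close> of \<open>L\<^sup>2(G) \<otimes> H\<close> as a function with values in \<open>H\<close>, and the inner
  product of two such elements.\<close>

definition tensor_fun :: "nat \<Rightarrow> (nat \<Rightarrow> 'g::measured L2) \<Rightarrow> (nat \<Rightarrow> 'h::chilbert_space) \<Rightarrow> 'g \<Rightarrow> 'h" where
  "tensor_fun n w v x = (\<Sum>j<n. rep_L2 (w j) x *\<^sub>C v j)"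

definition tensor_inner ::
    "nat \<Rightarrow> (nat \<Rightarrow> 'l::complex_inner) \<Rightarrow> (nat \<Rightarrow> 'h::chilbert_space) \<Rightarrow> (nat \<Rightarrow> 'l) \<Rightarrow> (nat \<Rightarrow> 'h) \<Rightarrow> complex" where
  "tensor_inner n w v w' v' = (\<Sum>i<n. \<Sum>j<n. cinner (w j) (w' i) * cinner (v j) (v' i))"

lemma tensor_fun_integral:
  fixes w w' :: "nat \<Rightarrow> 'g::haar_group L2"
  shows "integrable msr (\<lambda>x. cinner (tensor_fun n w v x) (tensor_fun n w' v' x))"
    and "(LINT x|msr. cinner (tensor_fun n w v x) (tensor_fun n w' v' x)) = tensor_inner n w v w' v'"
proof -
  have eq: "cinner (tensor_fun n w v x) (tensor_fun n w' v' x) =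
     (\<Sum>i<n. \<Sum>j<n. (rep_L2 (w j) x * cnj (rep_L2 (w' i) x)) * cinner (v j) (v' i))" for x
    unfolding tensor_fun_def cinner_sum_right cinner_sum_left
    by (intro sum.cong refl) (simp add: cinner_scaleC_left cinner_scaleC_right mult_ac)
  have int: "integrable msr (\<lambda>x. rep_L2 (w j) x * cnj (rep_L2 (w' i) x))" for i j
    by (intro sq_integrable_mult_cnj sq_integrable_rep)
  show "integrable msr (\<lambda>x. cinner (tensor_fun n w v x) (tensor_fun n w' v' x))"
    unfolding eq by (intro Bochner_Integration.integrable_sum integrable_mult_left int)
  show "(LINT x|msr. cinner (tensor_fun n w v x) (tensor_fun n w' v' x)) = tensor_inner n w v w' v'"
    unfolding eq tensor_inner_def cinner_L2.rep_eq
    by (simp add: Bochner_Integration.integral_sum Bochner_Integration.integrable_sum int)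
qed

lemma norm_sq_cinner: "(norm (x::'h::complex_inner))\<^sup>2 = Re (cinner x x)"
  by (simp add: power2_norm_eq_inner inner_eq_Re_cinner)

lemma tensor_fun_integral_Re:
  fixes w w' :: "nat \<Rightarrow> 'g::haar_group L2"
  shows "integrable msr (\<lambda>x. Re (cinner (tensor_fun n w v x) (tensor_fun n w' v' x)))"
    and "(LINT x|msr. Re (cinner (tensor_fun n w v x) (tensor_fun n w' v' x))) = Re (tensor_inner n w v w' v')"
  using tensor_fun_integral[of n w v w' v'] by simp_all

lemma tensor_inner_ge_0: "0 \<le> Re (tensor_inner n w v w v)"
  for w :: "nat \<Rightarrow> 'g::haar_group L2"
  by (simp add: tensor_fun_integral_Re(2)[symmetric] norm_sq_cinner[symmetric])

text \<open>The square of the distance of two vectors of \<open>L^2(G) \<otimes> H\<close> is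
  non-negative; this is integrated from the same fact in \<open>H\<close>.\<close>

lemma tensor_inner_le:
  fixes w w' :: "nat \<Rightarrow> 'g::haar_group L2" and v v' :: "nat \<Rightarrow> 'h::chilbert_space"
  shows "2 * Re (tensor_inner n w v w' v') \<le> Re (tensor_inner n w v w v) + Re (tensor_inner n w' v' w' v')"
proof -
  let ?f = "tensor_fun n w v" and ?g = "tensor_fun n w' v'"
  have "2 * Re (cinner x y) \<le> Re (cinner x x) + Re (cinner y y)" for x y :: 'h
    using zero_le_power2[of "norm (x - y)"] unfolding power2_norm_eq_inner inner_eq_Re_cinner[symmetric]
    by (simp add: inner_diff_left inner_diff_right inner_commute)
  hence "(LINT x|msr. 2 * Re (cinner (?f x) (?g x))) \<le> (LINT x|msr. Re (cinner (?f x) (?f x)) + Re (cinner (?g x) (?g x)))"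
    by (intro integral_mono integrable_mult_right Bochner_Integration.integrable_add tensor_fun_integral_Re)
  thus ?thesis by (simp add: tensor_fun_integral_Re)
qed

text \<open>The density is \<open>(norm (tensor_fun n u v x))^2\<close>, normalized. With
  \<open>p\<close> and \<open>q\<close> for the images under \<open>\<lambda>_s \<otimes> 1\<close>
  and \<open>1 \<otimes> V_s\<close>, its change under translation is at most
  \<open>norm (p x - q x) * (norm (p x) + norm (q x))\<close>. A weighted arithmetic-geometric mean
  inequality splits this product pointwise, so that only squared norms are integrated.\<close>

lemma amenable_of_almost_invariant_tensors:
  fixes V :: "'g::haar_group \<Rightarrow> 'h::chilbert_space bop"
  assumes V: "\<And>s v u. cinner (V s $$ v) (V s $$ u) = cinner v u"
    and ai: "\<And>(F :: 'g set) \<delta>. finite F \<Longrightarrow> 0 < \<delta> \<Longrightarrow> \<exists>n u v. 0 < Re (tensor_inner n u v u v) \<and>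
       (\<forall>s\<in>F. 2 * Re (tensor_inner n u v u v)
           - 2 * Re (tensor_inner n (\<lambda>j. left_regular s (u j)) v u (\<lambda>j. V s $$ v j))
         \<le> \<delta> * Re (tensor_inner n u v u v))"
  shows "amenable TYPE('g)"
proof (rule amenable_of_almost_invariant_densities)
  fix F :: "'g set" and \<epsilon> :: real
  assume F: "finite F" and \<epsilon>: "0 < \<epsilon>"
  \<comment> \<open>\<open>t\<close> is the weight in that inequality. With almost invariance
    \<open>4 t^2\<close>, each of the two resulting terms is \<open>2 t c\<close>, and their sum
    \<open>4 t c\<close> equals \<open>\<epsilon> c\<close>.\<close>
  define t where "t = \<epsilon> / 4"
  have t: "0 < t" using \<epsilon> by (simp add: t_def)
  have "0 < 4 * t\<^sup>2" using t by simp
  from ai[OF F this] obtain n u v where pos: "0 < Re (tensor_inner n u v u v)"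
    and small: "\<And>s. s \<in> F \<Longrightarrow> 2 * Re (tensor_inner n u v u v)
        - 2 * Re (tensor_inner n (\<lambda>j. left_regular s (u j)) v u (\<lambda>j. V s $$ v j))
         \<le> 4 * t\<^sup>2 * Re (tensor_inner n u v u v)" by blast
  define c where "c = Re (tensor_inner n u v u v)"
  define w where "w x = (norm (tensor_fun n u v x))\<^sup>2" for x
  define W where "W x = w x / c" for x
  have c: "0 < c" using pos by (simp add: c_def)
  have w: "integrable msr w" "(LINT x|msr. w x) = c"
    unfolding w_def norm_sq_cinner c_def by (rule tensor_fun_integral_Re)+
  have small_W: "(LINT x|msr. \<bar>W (- s + x) - W x\<bar>) \<le> \<epsilon>" if s: "s \<in> F" for s
  proof -
    let ?w = "LINT x|msr. \<bar>w (- s + x) - w x\<bar>"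
    define p where "p = tensor_fun n (\<lambda>j. left_regular s (u j)) v"
    define q where "q = tensor_fun n u (\<lambda>j. V s $$ v j)"
    have pp: "integrable msr (\<lambda>x. (norm (p x))\<^sup>2)" "(LINT x|msr. (norm (p x))\<^sup>2) = c"
      unfolding norm_sq_cinner p_def by (rule tensor_fun_integral_Re, simp add: tensor_fun_integral_Re c_def tensor_inner_def cinner_left_regular)
    have qq: "integrable msr (\<lambda>x. (norm (q x))\<^sup>2)" "(LINT x|msr. (norm (q x))\<^sup>2) = c"
      unfolding norm_sq_cinner q_def by (rule tensor_fun_integral_Re, simp add: tensor_fun_integral_Re c_def tensor_inner_def V)
    define e where "e = Re (tensor_inner n (\<lambda>j. left_regular s (u j)) v u (\<lambda>j. V s $$ v j))"
    have pq: "integrable msr (\<lambda>x. Re (cinner (p x) (q x)))" "(LINT x|msr. Re (cinner (p x) (q x))) = e"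
      unfolding p_def q_def e_def by (rule tensor_fun_integral_Re)+
    let ?sum = "\<lambda>x. (norm (p x))\<^sup>2 + (norm (q x))\<^sup>2"
    let ?diff = "\<lambda>x. (norm (p x))\<^sup>2 + (norm (q x))\<^sup>2 - 2 * Re (cinner (p x) (q x))"
    have q_norm: "norm (q x) = norm (tensor_fun n u v x)" for x
    proof -
      have "q x = V s $$ tensor_fun n u v x"
        by (simp add: q_def tensor_fun_def bop_sum bop_scaleC)
      hence "(norm (q x))\<^sup>2 = (norm (tensor_fun n u v x))\<^sup>2" by (simp add: norm_sq_cinner V)
      thus ?thesis by (simp add: power2_eq_iff_nonneg)
    qed
    \<comment> \<open>A translated class has a representative of its own, so it agrees with the
      translated representative only almost everywhere.\<close>
    have "AE x in msr. \<forall>j. rep_L2 (left_regular s (u j)) x = rep_L2 (u j) (- s + x)"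
      unfolding AE_all_countable by (intro allI rep_left_regular)
    hence wp: "AE x in msr. w (- s + x) = (norm (p x))\<^sup>2"
      by eventually_elim (simp add: w_def p_def tensor_fun_def)
    have wi: "integrable msr (\<lambda>x. w (- s + x))" by (rule integrable_translate[OF w(1)])
    have bound: "AE x in msr. \<bar>w (- s + x) - w x\<bar> \<le>
       (1 / (2 * t)) * (?diff x) + t * (?sum x)"
      using wp
    proof eventually_elim
      fix x assume x: "w (- s + x) = (norm (p x))\<^sup>2"
      define A where "A = norm (p x - q x)"
      define B where "B = norm (p x) + norm (q x)"
      have wx: "w x = (norm (q x))\<^sup>2" by (simp add: w_def q_norm)
      have "\<bar>w (- s + x) - w x\<bar> = \<bar>norm (p x) - norm (q x)\<bar> * B"
        unfolding x wx B_def
        by (simp add: power2_eq_square square_diff_square_factored abs_mult mult.commute)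
      also have "\<dots> \<le> A * B" unfolding A_def by (intro mult_right_mono norm_triangle_ineq3) (simp add: B_def)
      also have "\<dots> \<le> (1 / (2 * t)) * A\<^sup>2 + (t / 2) * B\<^sup>2"
      proof -
        have "0 \<le> (A - t * B)\<^sup>2" by simp
        hence "2 * t * (A * B) \<le> A\<^sup>2 + t\<^sup>2 * B\<^sup>2" by (simp add: power2_diff power_mult_distrib mult_ac)
        thus ?thesis using t by (simp add: field_simps power2_eq_square)
      qed
      also have "A\<^sup>2 = ?diff x"
        unfolding A_def power2_norm_eq_inner inner_eq_Re_cinner[symmetric]
        by (simp add: inner_diff_left inner_diff_right inner_commute)
      also have "(t / 2) * B\<^sup>2 \<le> t * (?sum x)"
      proof -
        have "0 \<le> (norm (p x) - norm (q x))\<^sup>2" by simp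
        hence "B\<^sup>2 \<le> 2 * (?sum x)"
          unfolding B_def by (simp add: power2_sum power2_diff)
        hence "(t / 2) * B\<^sup>2 \<le> (t / 2) * (2 * (?sum x))"
          using t by (intro mult_left_mono) auto
        thus ?thesis by (simp add: algebra_simps)
      qed
      finally show "\<bar>w (- s + x) - w x\<bar> \<le>
         (1 / (2 * t)) * (?diff x) + t * (?sum x)"
        by simp
    qed
    have i1: "integrable msr (\<lambda>x. ?sum x)" using pp qq by simp
    have i2: "integrable msr (\<lambda>x. ?diff x)"
      by (intro Bochner_Integration.integrable_diff i1 integrable_mult_right pq)
    have "?w \<le> (LINT x|msr.
       (1 / (2 * t)) * (?diff x) + t * (?sum x))"
      by (intro integral_mono_AE bound integrable_abs Bochner_Integration.integrable_diff wi w
          Bochner_Integration.integrable_add integrable_mult_right i1 i2)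
    also have "\<dots> = (LINT x|msr. (1 / (2 * t)) * (?diff x))
        + (LINT x|msr. t * (?sum x))"
      by (intro Bochner_Integration.integral_add integrable_mult_right i1 i2)
    also have "\<dots> = (1 / (2 * t)) * (LINT x|msr. ?diff x)
        + t * (LINT x|msr. ?sum x)"
      by (simp only: integral_mult_right_zero)
    also have "(LINT x|msr. ?diff x) = 2 * c - 2 * e"
      using pp qq pq i1 by (subst Bochner_Integration.integral_diff) simp_all
    also have "(LINT x|msr. ?sum x) = 2 * c" using pp qq by simp
    also have "(1 / (2 * t)) * (2 * c - 2 * e) + t * (2 * c) \<le> (1 / (2 * t)) * (4 * t\<^sup>2 * c) + t * (2 * c)"
      using small[OF s] t by (intro add_right_mono mult_left_mono) (auto simp: c_def e_def)
    also have "\<dots> = \<epsilon> * c" using t by (simp add: t_def power2_eq_square field_simps)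
    finally have "?w / c \<le> \<epsilon>" using c by (simp add: pos_divide_le_eq)
    moreover have "\<bar>W (- s + x) - W x\<bar> = \<bar>w (- s + x) - w x\<bar> / c" for x
      using c by (simp add: W_def diff_divide_distrib[symmetric])
    ultimately show ?thesis by simp
  qed
  show "\<exists>W. integrable msr W \<and> (\<forall>x. 0 \<le> W x) \<and> (LINT x|msr. W x) = 1 \<and>
         (\<forall>s\<in>F. (LINT x|msr. \<bar>W (- s + x) - W x\<bar>) \<le> \<epsilon>)"
  proof (intro exI[of _ W] conjI ballI allI)
    show "integrable msr W" "(LINT x|msr. W x) = 1" using w c by (simp_all add: W_def[abs_def])
    show "0 \<le> W x" for x using c by (simp add: W_def w_def)
  qed (rule small_W)
qed

section \<open>The spectral gap\<close>

lift_definition id_bop :: "'h::chilbert_space bop" is "\<lambda>\<xi>. \<xi>"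
  by (rule bounded_clinearI[where K=1]) simp_all

lemma eventually_net_filter_ex:
  assumes I: "directed_set I le" and P: "eventually P (net_filter I le)"
  shows "\<exists>i\<in>I. P i"
proof -
  have "\<exists>i\<in>I. eventually P (principal {j \<in> I. le i j})"
  proof (rule eventually_INF_base[THEN iffD1])
    show "I \<noteq> {}" using I by (simp add: directed_set_def)
    show "eventually P (INF i\<in>I. principal {j \<in> I. le i j})" using P by (simp add: net_filter_def)
    fix i j assume ij: "i \<in> I" "j \<in> I"
    then obtain k where k: "k \<in> I" "le i k" "le j k" using I unfolding directed_set_def by blast
    have "{l \<in> I. le k l} \<subseteq> {l \<in> I. le i l} \<inter> {l \<in> I. le j l}"
      using I ij k unfolding directed_set_def by blast
    thus "\<exists>k\<in>I. principal {l \<in> I. le k l} \<le> inf (principal {l \<in> I. le i l}) (principal {l \<in> I. le j l})"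
      using k(1) by auto
  qed
  thus ?thesis using I unfolding directed_set_def eventually_principal by blast
qed

text \<open>The summand for \<open>s\<close> is \<open>\<parallel>(\<lambda>_s \<otimes> 1) x - (1
  \<otimes> V_s) x\<parallel>^2\<close>. If no vector is almost invariant for \<open>F\<close> and
  \<open>\<delta>\<close>, each nonzero vector has some \<open>s\<close> whose summand exceeds
  \<open>\<delta> \<parallel>x\<parallel>^2\<close>, and the other summands are
  non-negative.\<close>

lemma nonamenable_gap:
  fixes V :: "'g::haar_group \<Rightarrow> 'h::chilbert_space bop"
  assumes na: "\<not> amenable TYPE('g)"
    and V: "\<And>s v w. cinner (V s $$ v) (V s $$ w) = cinner v w"
  shows "\<exists>(F :: 'g set) \<delta>. finite F \<and> 0 < \<delta> \<and> (\<forall>n w v. \<delta> * Re (tensor_inner n w v w v) \<le>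
     (\<Sum>s\<in>F. 2 * Re (tensor_inner n w v w v)
           - 2 * Re (tensor_inner n (\<lambda>j. left_regular s (w j)) v w (\<lambda>j. V s $$ v j))))"
proof -
  let ?T = "\<lambda>n w v. Re (tensor_inner n w v w v)"
  let ?D = "\<lambda>n w v s. 2 * ?T n w v - 2 * Re (tensor_inner n (\<lambda>j. left_regular s (w j)) v w (\<lambda>j. V s $$ v j))"
  obtain F :: "'g set" and \<delta> where F: "finite F" "0 < \<delta>"
    and none: "\<And>n w v. \<not> (0 < ?T n w v \<and> (\<forall>s\<in>F. ?D n w v s \<le> \<delta> * ?T n w v))"
    using amenable_of_almost_invariant_tensors[of V, OF V] na by blast
  have "\<delta> * ?T n w v \<le> (\<Sum>s\<in>F. ?D n w v s)" for n w v
  proof -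
    have nonneg: "0 \<le> ?D n w v s" for s
      using tensor_inner_le[of n "\<lambda>j. left_regular s (w j)" v w "\<lambda>j. V s $$ v j"]
      by (simp add: tensor_inner_def cinner_left_regular V)
    show ?thesis
    proof (cases "0 < ?T n w v")
      case True
      then obtain s where s: "s \<in> F" "\<delta> * ?T n w v < ?D n w v s" using none[of n w v] by (auto simp: not_le)
      have "?D n w v s \<le> (\<Sum>s\<in>F. ?D n w v s)" by (rule member_le_sum) (use s F nonneg in auto)
      thus ?thesis using s(2) by linarith
    next
      case False
      hence "?T n w v = 0" using tensor_inner_ge_0[of n w v] by linarith
      thus ?thesis using nonneg by (simp add: sum_nonneg)
    qed
  qed
  thus ?thesis using F by blast
qed

text \<open>\<open>nuclear_commuting_positive\<close> is applied to the compressed element. Its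
  positivity is \<open>nonamenable_gap\<close> at the vectors \<open>c $$ w j\<close>, and the
  conclusion unfolds to the inequality at \<open>\<pi> c $$ v\<close>.\<close>

lemma bimodule_gap:
  fixes \<pi> \<rho> :: "'g::haar_group L2 bop \<Rightarrow> 'h::chilbert_space bop"
  assumes nuc: "nuclear (CrG :: 'g L2 bop set)" and na: "\<not> amenable TYPE('g)"
    and bimod: "hilbert_bimodule CrG \<pi> \<rho>"
  shows "\<exists>(F :: 'g set) \<delta>. finite F \<and> 0 < \<delta> \<and> (\<forall>v. \<delta> * (norm v)\<^sup>2 \<le>
     (\<Sum>s\<in>F. (norm (left_translation \<pi> s $$ v - right_translation \<rho> s $$ v))\<^sup>2))"
proof -
  let ?A = "CrG :: 'g L2 bop set"
  define L where "L = left_translation \<pi>"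
  define V where "V = right_translation \<rho>"
  have \<pi>: "star_representation ?A \<pi>" using bimod by (simp add: hilbert_bimodule_def)
  have mult: "\<pi> (a * b) = \<pi> a * \<pi> b" if "a \<in> ?A" "b \<in> ?A" for a b
    using \<pi> that by (simp add: star_representation_def)
  have st: "\<pi> (star a) = star (\<pi> a)" if "a \<in> ?A" for a
    using \<pi> that by (simp add: star_representation_def)
  have L_mult: "L s * \<pi> a = \<pi> (left_mult s * a)" if "a \<in> ?A" for s a
    unfolding L_def by (rule left_translation_mult[OF bimod that])
  have L_norm: "norm (L s $$ v) = norm v" for s v
    unfolding L_def by (rule norm_left_translation[OF bimod])
  have V_norm: "norm (V s $$ v) = norm v" for s v
    unfolding V_def by (rule norm_right_translation[OF bimod])
  have V_comm: "V s * \<pi> a = \<pi> a * V s" if "a \<in> ?A" for s a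
    unfolding V_def by (rule right_translation_commute[OF bimod that])
  have V_star_comm: "star (V s) * \<pi> a = \<pi> a * star (V s)" if "a \<in> ?A" for s a
    using arg_cong[OF V_comm[OF reduced_star[OF that], of s], of star] by (simp add: star_mult st that star_star)
  from nonamenable_gap[OF na, of V, OF isometry_cinner[OF V_norm]]
  obtain F :: "'g set" and \<delta> where F: "finite F" and \<delta>: "0 < \<delta>"
    and gap: "\<forall>n w v. \<delta> * Re (tensor_inner n w v w v) \<le>
     (\<Sum>s\<in>F. 2 * Re (tensor_inner n w v w v)
           - 2 * Re (tensor_inner n (\<lambda>j. left_regular s (w j)) v w (\<lambda>j. V s $$ v j)))"
    by (elim exE conjE)
  \<comment> \<open>The scalar part of the expanded sum: each of the \<open>card F\<close> squares
    contributes 2, and the gap is subtracted.\<close>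
  define r where "r = 2 * real (card F) - \<delta>"
  have on_image: "\<delta> * (norm (\<pi> c $$ v))\<^sup>2 \<le>
     (\<Sum>s\<in>F. (norm (L s $$ (\<pi> c $$ v) - V s $$ (\<pi> c $$ v)))\<^sup>2)"
    if c: "c \<in> ?A" for c v
  proof -
    define d where "d s = star c * (left_mult s * c)" for s
    have dA: "d s \<in> ?A" for s unfolding d_def by (intro reduced_mult reduced_star reduced_left_mult c)
    \<comment> \<open>\<open>None\<close> indexes the scalar term, \<open>Some (s, True)\<close> and
      \<open>Some (s, False)\<close> the cross term of \<open>s\<close> and its adjoint; together
      they form a self-adjoint element.\<close>
    define K where "K = insert None (Some ` (F \<times> (UNIV :: bool set)))"
    define a where "a k = (case k of None \<Rightarrow> star c * c | Some (s, t) \<Rightarrow> if t then d s else star (d s))" for k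
    define b where "b k = (case k of None \<Rightarrow> r *\<^sub>R id_bop | Some (s, t) \<Rightarrow> if t then - star (V s) else - V s)" for k
    have K_sum: "(\<Sum>k\<in>K. f k) = f None + (\<Sum>s\<in>F. f (Some (s, True)) + f (Some (s, False)))"
      for f :: "('g \<times> bool) option \<Rightarrow> 'x::comm_monoid_add"
    proof -
      have "(\<Sum>k\<in>K. f k) = f None + (\<Sum>k\<in>Some ` (F \<times> UNIV). f k)"
        unfolding K_def using F by (subst sum.insert) auto
      also have "(\<Sum>k\<in>Some ` (F \<times> (UNIV::bool set)). f k) = (\<Sum>p\<in>F \<times> UNIV. f (Some p))"
        by (subst sum.reindex) auto
      also have "\<dots> = (\<Sum>s\<in>F. \<Sum>t\<in>UNIV. f (Some (s, t)))"
        by (simp add: sum.cartesian_product)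
      finally show ?thesis by (simp add: UNIV_bool add.commute)
    qed
    have "0 \<le> Re (\<Sum>k\<in>K. cinner (\<pi> (a k) $$ (b k $$ v)) v)"
    proof (rule nuclear_commuting_positive[OF cstar_subalgebra_reduced nuc \<pi>])
      show "finite K" using F by (simp add: K_def)
      show "a k \<in> ?A" if "k \<in> K" for k
        using dA c by (auto simp: a_def split: option.split intro: reduced_star reduced_mult)
      show "b k * \<pi> x = \<pi> x * b k" if "x \<in> ?A" for k x
      proof (cases k)
        case None
        thus ?thesis by (intro bop_eqI) (simp add: b_def bop_simps id_bop.rep_eq)
      next
        case (Some p)
        thus ?thesis using V_comm[OF that] V_star_comm[OF that] by (cases p) (auto simp: b_def)
      qed
      show "star (\<Sum>k\<in>K. cinner (b k $$ v) w *\<^sub>C a k) = (\<Sum>k\<in>K. cinner (b k $$ w) v *\<^sub>C a k)" for v w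
      proof -
        have 1: "cnj (cinner (star (V s) $$ v) w) = cinner (V s $$ w) v"
          "cnj (cinner (V s $$ v) w) = cinner (star (V s) $$ w) v" for s
          using cinner_commute cinner_star_bop cinner_star_bop' by metis+
        have 2: "cnj (cinner v w) = cinner w v" using cinner_commute by metis
        show ?thesis
          unfolding K_sum star_add star_sum star_scaleC
          by (simp add: a_def b_def bop_simps cinner_simps id_bop.rep_eq 1 2 star_mult star_star add.commute)
      qed
      fix n and w :: "nat \<Rightarrow> 'g L2" and v :: "nat \<Rightarrow> 'h"
      \<comment> \<open>The outer factors of \<open>c^* \<lambda>_s c\<close> move onto the vectors,
        so the compressed form at \<open>w\<close> is the original form at
        \<open>w'\<close>.\<close>
      define w' where "w' j = c $$ w j" for j
      define T where "T = tensor_inner n w' v w' v"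
      define C where "C s = tensor_inner n (\<lambda>j. left_regular s (w' j)) v w' (\<lambda>j. V s $$ v j)" for s
      let ?f = "\<lambda>k. \<Sum>i<n. \<Sum>j<n. cinner (a k $$ w j) (w i) * cinner (b k $$ v j) (v i)"
      have f0: "?f None = complex_of_real r * T"
        by (simp add: a_def b_def T_def tensor_inner_def bop_simps cinner_simps cinner_star_bop' id_bop.rep_eq
            w'_def sum_distrib_left mult_ac)
      have f1: "?f (Some (s, True)) = - C s" for s
        by (simp add: a_def b_def C_def d_def tensor_inner_def bop_simps cinner_simps cinner_star_bop' w'_def
            left_mult.rep_eq sum_negf)
      have f2: "?f (Some (s, False)) = - cnj (C s)" for s
      proof -
        have "cinner (star (d s) $$ w j) (w i) * cinner (V s $$ v j) (v i) =
            cnj (cinner (left_regular s (w' i)) (w' j) * cinner (v i) (V s $$ v j))" for i j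
          using cinner_commute[of "left_regular s (w' i)" "w' j"] cinner_commute[of "v i" "V s $$ v j"]
          by (simp add: d_def star_mult star_star bop_simps cinner_star_bop' w'_def left_mult.rep_eq
              cinner_left_regular_left star_left_mult)
        hence "?f (Some (s, False)) = - (\<Sum>i<n. \<Sum>j<n. cnj (cinner (left_regular s (w' i)) (w' j) * cinner (v i) (V s $$ v j)))"
          by (simp add: a_def b_def bop_simps cinner_simps sum_negf)
        also have "\<dots> = - (\<Sum>j<n. \<Sum>i<n. cnj (cinner (left_regular s (w' i)) (w' j) * cinner (v i) (V s $$ v j)))"
          by (subst sum.swap) (rule refl)
        finally show ?thesis by (simp add: C_def tensor_inner_def)
      qed
      have "Re (\<Sum>k\<in>K. ?f k) = r * Re T - (\<Sum>s\<in>F. 2 * Re (C s))"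
        unfolding K_sum f0 f1 f2 by (simp add: sum_negf)
      also have "\<dots> = (\<Sum>s\<in>F. 2 * Re T - 2 * Re (C s)) - \<delta> * Re T"
        by (simp add: r_def sum_subtractf algebra_simps)
      finally show "0 \<le> Re (\<Sum>k\<in>K. ?f k)"
        using gap[rule_format, of n w' v] by (simp add: T_def C_def)
    qed
    moreover define \<zeta> where "\<zeta> = \<pi> c $$ v"
    let ?ip = "\<lambda>s. cinner (L s $$ \<zeta>) (V s $$ \<zeta>)" and ?nd = "\<lambda>s. (norm (L s $$ \<zeta> - V s $$ \<zeta>))\<^sup>2"
    \<comment> \<open>\<open>V s\<close> and its adjoint commute with the image of
      \<open>\<pi>\<close>, and \<open>\<pi> (d s)\<close> splits as
      \<open>star (\<pi> c) * (L s * \<pi> c)\<close>; both translations thus come to act on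
      \<open>\<zeta>\<close>.\<close>
    have dV: "cinner (\<pi> (d s) $$ (star (V s) $$ v)) v = ?ip s"
      "cinner (\<pi> (star (d s)) $$ (V s $$ v)) v = cnj (?ip s)" for s
    proof -
      have "\<pi> (d s) = star (\<pi> c) * (L s * \<pi> c)"
        by (simp add: d_def mult st L_mult c reduced_star reduced_left_mult)
      hence ds: "cinner (\<pi> (d s) $$ v) (V s $$ v) = ?ip s"
        using arg_cong[OF V_comm[OF c, of s], of "\<lambda>R. R $$ v"]
        by (simp add: bop_simps cinner_star_bop' \<zeta>_def)
      have "\<pi> (d s) $$ (star (V s) $$ v) = star (V s) $$ (\<pi> (d s) $$ v)"
        using arg_cong[OF V_star_comm[OF dA, of s s], of "\<lambda>R. R $$ v"] by (simp add: bop_simps)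
      thus "cinner (\<pi> (d s) $$ (star (V s) $$ v)) v = ?ip s"
        by (simp add: cinner_star_bop' ds)
      have "cinner (\<pi> (star (d s)) $$ (V s $$ v)) v = cnj (cinner (\<pi> (d s) $$ v) (V s $$ v))"
        using cinner_commute[of "V s $$ v" "\<pi> (d s) $$ v"] by (simp add: st dA cinner_star_bop')
      thus "cinner (\<pi> (star (d s)) $$ (V s $$ v)) v = cnj (?ip s)"
        by (simp add: ds)
    qed
    have c2: "cinner ((\<pi> (star c * c)) $$ v) v = complex_of_real ((norm \<zeta>)\<^sup>2)"
      by (simp add: mult st c reduced_star bop_simps cinner_star_bop' \<zeta>_def cinner_self)
    have "Re (\<Sum>k\<in>K. cinner (\<pi> (a k) $$ (b k $$ v)) v) =
       r * (norm \<zeta>)\<^sup>2 - (\<Sum>s\<in>F. 2 * Re (?ip s))"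
      unfolding K_sum
      by (simp add: a_def b_def bop_simps cinner_simps id_bop.rep_eq bop_minus dV c2 sum_negf)
    moreover have "?nd s =
        2 * (norm \<zeta>)\<^sup>2 - 2 * Re (?ip s)" for s
    proof -
      have "?nd s = (norm (L s $$ \<zeta>))\<^sup>2 + (norm (V s $$ \<zeta>))\<^sup>2
          - 2 * inner (L s $$ \<zeta>) (V s $$ \<zeta>)"
        by (simp add: power2_norm_eq_inner inner_diff_left inner_diff_right inner_commute)
      thus ?thesis by (simp add: L_norm V_norm inner_eq_Re_cinner)
    qed
    hence "(\<Sum>s\<in>F. ?nd s) =
        2 * real (card F) * (norm \<zeta>)\<^sup>2 - (\<Sum>s\<in>F. 2 * Re (?ip s))"
      by (simp add: sum_subtractf)
    ultimately have "0 \<le> (\<Sum>s\<in>F. ?nd s) - \<delta> * (norm \<zeta>)\<^sup>2"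
      by (simp only: r_def left_diff_distrib)
    thus ?thesis by (simp add: \<zeta>_def)
  qed
  \<comment> \<open>Both sides are continuous in \<open>v\<close>, and the vectors
    \<open>\<pi> c $$ v\<close> come arbitrarily close to \<open>v\<close>.\<close>
  have "\<delta> * (norm v)\<^sup>2 \<le> (\<Sum>s\<in>F. (norm (L s $$ v - V s $$ v))\<^sup>2)" for v
  proof -
    let ?E = "{v. \<delta> * (norm v)\<^sup>2 \<le> (\<Sum>s\<in>F. (norm (L s $$ v - V s $$ v))\<^sup>2)}"
    have "closed ?E"
      by (intro closed_Collect_le continuous_intros linear_continuous_on bounded_linear_bop)
    moreover have "v \<in> closure ?E"
      unfolding closure_approachable
    proof (intro allI impI)
      fix e :: real assume "0 < e"
      then obtain c where c: "c \<in> ?A" "norm (\<pi> c $$ v - v) < e" using left_action_approx[OF bimod] by blast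
      thus "\<exists>y\<in>?E. dist y v < e"
        using on_image[OF c(1), of v] by (intro bexI[of _ "\<pi> c $$ v"]) (simp_all add: dist_norm)
    qed
    ultimately show ?thesis by (simp add: closure_closed)
  qed
  thus ?thesis unfolding L_def V_def using F \<delta> by blast
qed

theorem theorem3:
  assumes "nuclear (reduced_group_cstar :: 'g::haar_group L2 bop set)"
    and "\<not> amenable TYPE('g)"
  shows "strong_property_T TYPE('h::chilbert_space) TYPE('i)
           (reduced_group_cstar :: 'g L2 bop set)"
  unfolding strong_property_T_def
proof (intro allI impI)
  fix \<pi> \<rho> :: "'g L2 bop \<Rightarrow> 'h bop" and I :: "'i set" and le and \<xi> :: "'i \<Rightarrow> 'h"
  assume bimod: "hilbert_bimodule reduced_group_cstar \<pi> \<rho>" and I: "directed_set I le"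
    and unit: "\<forall>i\<in>I. norm (\<xi> i) = 1" and central: "almost_K_central reduced_group_cstar \<pi> \<rho> I le \<xi>"
  obtain F :: "'g set" and \<delta> where F: "finite F" "0 < \<delta>" and gap: "\<And>\<xi>. \<delta> * (norm \<xi>)\<^sup>2 \<le>
     (\<Sum>s\<in>F. (norm (left_translation \<pi> s $$ \<xi> - right_translation \<rho> s $$ \<xi>))\<^sup>2)"
    using bimodule_gap[OF assms bimod] by blast
  let ?d = "\<lambda>s i. norm (left_translation \<pi> s $$ \<xi> i - right_translation \<rho> s $$ \<xi> i)"
  \<comment> \<open>Chosen so that \<open>card F\<close> times \<open>e^2\<close> stays below
    \<open>\<delta>\<close>; the summand 1 makes this strict and covers an empty
    \<open>F\<close>.\<close>
  define e where "e = sqrt (\<delta> / (real (card F) + 1))"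
  have e: "0 < e" using F by (simp add: e_def)
  have "\<forall>\<^sub>F i in net_filter I le. ?d s i < e" for s
  proof -
    have "compactin (strict_topology reduced_group_cstar) {translation_multiplier s}"
      by (rule compactin_singleton_multiplier[OF cstar_subalgebra_reduced translation_multiplier_in])
    hence "((\<lambda>i. ennreal (?d s i)) \<longlongrightarrow> 0) (net_filter I le)"
      using central[unfolded almost_K_central_def, rule_format, of "{translation_multiplier s}"]
      by (simp add: left_translation_def right_translation_def)
    hence "\<forall>\<^sub>F i in net_filter I le. ennreal (?d s i) < ennreal e"
      by (rule order_tendstoD) (use e in simp)
    thus ?thesis by eventually_elim (simp add: ennreal_less_iff)
  qed
  hence "\<forall>\<^sub>F i in net_filter I le. \<forall>s\<in>F. ?d s i < e" using F(1) by (simp add: eventually_ball_finite)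
  from eventually_net_filter_ex[OF I this] obtain i where i: "i \<in> I" "\<And>s. s \<in> F \<Longrightarrow> ?d s i < e" by blast
  have "\<delta> \<le> (\<Sum>s\<in>F. (?d s i)\<^sup>2)" using gap[of "\<xi> i"] unit i(1) by simp
  also have "\<dots> \<le> (\<Sum>s\<in>F. e\<^sup>2)" using i(2) by (intro sum_mono power_mono) (auto intro: less_imp_le)
  also have "\<dots> = real (card F) * (\<delta> / (real (card F) + 1))" using F by (simp add: e_def)
  also have "\<dots> < \<delta>" using F by (simp add: field_simps)
  \<comment> \<open>The chain reads \<open>\<delta> < \<delta>\<close>: a single index of the net
    already contradicts the gap, and the limit follows from the contradiction.\<close>
  finally show "((\<lambda>i. norm (\<xi> i - orthogonal_projection (central_vectors reduced_group_cstar \<pi> \<rho>) (\<xi> i)))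
      \<longlongrightarrow> 0) (net_filter I le)" by simp
qed

end
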